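(* Let $1\le p\le2$, and suppose that either $q=1$ and $s\ge0$, or $1<q\le p'$ and $s>n/q'$. Let $\mathcal I_F$ be the set of all closed ideals in $\mathcal{F}L^q_s(\mathbb{R}^n)$ and $\mathcal I_M$ the set of all closed ideals in $M^{p,q}_s(\mathbb{R}^n)$. Then the map $\iota:\mathcal I_F\to\mathcal I_M$, $\iota(I_F)=I_F\cap M^{p,q}_s(\mathbb{R}^n)$, is well defined and bijective, with inverse $\iota^{-1}(I_M)=\overline{I_M}$, the closure of $I_M$ in $\mathcal{F}L^q_s(\mathbb{R}^n)$; in particular $\overline{I_M}\cap M^{p,q}_s(\mathbb{R}^n)=I_M$ for every $I_M\in\mathcal I_M$.
   Context: $p',q'$ are conjugate exponents; $\langle x\rangle=(1+|x|^2)^{1/2}$; $\hat f(\xi)=\int f(x)e^{-ix\cdot\xi}dx$. $\mathcal{F}L^q_s(\mathbb{R}^n)$: tempered distributions $f$ with $\|f\|_{\mathcal{F}L^q_s}=\big(\int(\langle\xi\rangle^s|\hat f(\xi)|)^q d\xi\big)^{1/q}<\infty$. Fix $\varphi\in\mathcal S(\mathbb{R}^n)$ with $\operatorname{supp}\varphi\subset[-1,1]^n$ and $\sum_{k\in\mathbb{Z}^n}\varphi(\xi-k)=1$; $\varphi(D-k)f=\mathcal F^{-1}(\varphi(\cdot-k)\hat f)$; $M^{p,q}_s(\mathbb{R}^n)$: tempered distributions $f$ with $\|f\|_{M^{p,q}_s}=\big(\sum_{k}\langle k\rangle^{sq}\|\varphi(D-k)f\|_{L^p}^q\big)^{1/q}<\infty$.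 Under the stated conditions both are Banach algebras of continuous functions under pointwise multiplication and $M^{p,q}_s\subset\mathcal{F}L^q_s$ continuously. An ideal of an algebra $X$ is a linear subspace $I$ with $fg\in I$ for $f\in X$, $g\in I$; a closed ideal is an ideal closed in $X$.
   Formalization: The exponent q is taken finite: for p=1 the range 1<q≤p' would literally include q=∞, where the claim fails, since the closure of M^{1,∞}_s in FL^∞_s contains only f with continuous Fourier transform and is not all of FL^∞_s. *)

theory Defs
  imports "HOL-Analysis.Analysis"
begin

definition jbr :: "'a::euclidean_space \<Rightarrow> real" where
  "jbr x = sqrt (1 + (norm x)\<^sup>2)"

definition Zlat :: "'a::euclidean_space set" where
  "Zlat = {k. \<forall>b\<in>Basis. k \<bullet> b \<in> \<int>}"

text \<open>Inverse Fourier transform of an integrable function g (convention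
  hat f(xi) = int f(x) e^{-i x xi} dx, so f(x) = (2 pi)^{-n} int hat f(xi) e^{i x xi} dxi).\<close>
definition inv_fourier :: "('a::euclidean_space \<Rightarrow> complex) \<Rightarrow> 'a \<Rightarrow> complex" where
  "inv_fourier g x = complex_of_real ((2*pi) powr (- real DIM('a))) *
      (\<integral>\<xi>. g \<xi> * cis (x \<bullet> \<xi>) \<partial>lborel)"

definition fourier_rep :: "('a::euclidean_space \<Rightarrow> complex) \<Rightarrow> ('a \<Rightarrow> complex) \<Rightarrow> bool" where
  "fourier_rep f g \<longleftrightarrow> integrable lborel g \<and> f = inv_fourier g"

definition fhat :: "('a::euclidean_space \<Rightarrow> complex) \<Rightarrow> 'a \<Rightarrow> complex" where
  "fhat f = (SOME g. fourier_rep f g)"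

text \<open>Fourier--Lebesgue space FL^q_s (under the standing conditions its elements
  have integrable Fourier transform, hence are continuous functions).\<close>
definition FL :: "real \<Rightarrow> real \<Rightarrow> ('a::euclidean_space \<Rightarrow> complex) set" where
  "FL q s = {f. \<exists>g. fourier_rep f g \<and>
      integrable lborel (\<lambda>\<xi>. (jbr \<xi> powr s * cmod (g \<xi>)) powr q)}"

definition FL_norm :: "real \<Rightarrow> real \<Rightarrow> ('a::euclidean_space \<Rightarrow> complex) \<Rightarrow> real" where
  "FL_norm q s f = (\<integral>\<xi>. (jbr \<xi> powr s * cmod (fhat f \<xi>)) powr q \<partial>lborel) powr (1/q)"

text \<open>C^infinity functions: all iterated partial derivatives exist everywhere
  (F bs is the iterated partial derivative along the basis vectors in bs).\<close>
definition smooth_fun :: "('a::euclidean_space \<Rightarrow> complex) \<Rightarrow> bool" where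
  "smooth_fun f \<longleftrightarrow> (\<exists>F :: 'a list \<Rightarrow> 'a \<Rightarrow> complex. F [] = f \<and>
     (\<forall>bs x. (F bs has_derivative (\<lambda>h. \<Sum>b\<in>Basis. (h \<bullet> b) *\<^sub>R F (b # bs) x)) (at x)))"

definition admissible_window :: "('a::euclidean_space \<Rightarrow> complex) \<Rightarrow> bool" where
  "admissible_window \<phi> \<longleftrightarrow> smooth_fun \<phi> \<and>
     (\<forall>\<xi>. \<phi> \<xi> \<noteq> 0 \<longrightarrow> (\<forall>b\<in>Basis. \<bar>\<xi> \<bullet> b\<bar> \<le> 1)) \<and>
     (\<forall>\<xi>. ((\<lambda>k. \<phi> (\<xi> - k)) has_sum 1) Zlat)"

definition loc_piece :: "('a::euclidean_space \<Rightarrow> complex) \<Rightarrow> 'a \<Rightarrow> ('a \<Rightarrow> complex) \<Rightarrow> 'a \<Rightarrow> complex" where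
  "loc_piece \<phi> k f = inv_fourier (\<lambda>\<xi>. \<phi> (\<xi> - k) * fhat f \<xi>)"

definition Lp_norm :: "real \<Rightarrow> ('a::euclidean_space \<Rightarrow> complex) \<Rightarrow> real" where
  "Lp_norm p h = (\<integral>x. cmod (h x) powr p \<partial>lborel) powr (1/p)"

text \<open>Modulation space M^{p,q}_s (realised inside FL^q_s, using the continuous
  embedding M^{p,q}_s \<subseteq> FL^q_s).\<close>
definition Mod :: "('a::euclidean_space \<Rightarrow> complex) \<Rightarrow> real \<Rightarrow> real \<Rightarrow> real \<Rightarrow> ('a \<Rightarrow> complex) set" where
  "Mod \<phi> p q s = {f. f \<in> FL q s \<and>
      (\<forall>k\<in>Zlat. integrable lborel (\<lambda>x. cmod (loc_piece \<phi> k f x) powr p)) \<and>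
      (\<lambda>k. jbr k powr (s*q) * Lp_norm p (loc_piece \<phi> k f) powr q) summable_on Zlat}"

definition Mod_norm :: "('a::euclidean_space \<Rightarrow> complex) \<Rightarrow> real \<Rightarrow> real \<Rightarrow> real \<Rightarrow> ('a \<Rightarrow> complex) \<Rightarrow> real" where
  "Mod_norm \<phi> p q s f =
     (\<Sum>\<^sub>\<infinity>k\<in>Zlat. jbr k powr (s*q) * Lp_norm p (loc_piece \<phi> k f) powr q) powr (1/q)"

definition is_ideal :: "('a \<Rightarrow> complex) set \<Rightarrow> ('a \<Rightarrow> complex) set \<Rightarrow> bool" where
  "is_ideal X I \<longleftrightarrow> I \<subseteq> X \<and> (\<lambda>_. 0) \<in> I \<and>
     (\<forall>f\<in>I. \<forall>g\<in>I. (\<lambda>x. f x + g x) \<in> I) \<and>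
     (\<forall>c::complex. \<forall>f\<in>I. (\<lambda>x. c * f x) \<in> I) \<and>
     (\<forall>f\<in>X. \<forall>g\<in>I. (\<lambda>x. f x * g x) \<in> I)"

definition nclosure :: "('a \<Rightarrow> complex) set \<Rightarrow> (('a \<Rightarrow> complex) \<Rightarrow> real) \<Rightarrow> ('a \<Rightarrow> complex) set \<Rightarrow> ('a \<Rightarrow> complex) set" where
  "nclosure X N A = {f\<in>X. \<exists>u. (\<forall>j. u j \<in> A) \<and> (\<lambda>j. N (\<lambda>x. u j x - f x)) \<longlonglongrightarrow> 0}"

definition closed_ideals :: "('a \<Rightarrow> complex) set \<Rightarrow> (('a \<Rightarrow> complex) \<Rightarrow> real) \<Rightarrow> ('a \<Rightarrow> complex) set set" where
  "closed_ideals X N = {I. is_ideal X I \<and> nclosure X N I = I}"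

end

theory Submission
  imports Defs
begin

text \<open>\<open>M = Mod\<close> is an ideal of \<open>FL\<close> with \<open>\<parallel>f g\<parallel>\<^sub>M \<le> C \<parallel>f\<parallel>\<^sub>F\<^sub>L \<parallel>g\<parallel>\<^sub>M\<close>: on the Fourier side the product is
  a convolution, which is bounded by Minkowski's inequality on each window piece and by a weighted
  Young inequality over the lattice. The functions \<open>u n\<close> with transform \<open>n^d \<phi>(n \<xi>) / \<integral>\<phi>\<close> lie in \<open>M\<close> and
  are an approximate unit for both norms. Given this, the argument is that for abstract Segal
  algebras: if \<open>f\<close> lies in \<open>M\<close> and in the \<open>FL\<close>-closure of a closed ideal \<open>J\<close> of \<open>M\<close>, then \<open>u n f \<in> J\<close>
  because multiplication by \<open>u n\<close> is continuous from \<open>FL\<close> to \<open>M\<close>, and \<open>u n f\<close> tends to \<open>f\<close> in \<open>M\<close>.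
  Conversely, multiplication by the band-limited \<open>u n\<close> is continuous from \<open>M\<close> to \<open>FL\<close>. Because \<open>Mod\<close>
  is by definition a subset of \<open>FL\<close>, this suffices and the Hausdorff--Young inequality is avoided.\<close>

section \<open>Powers of extended nonnegative reals\<close>

text \<open>Two features of the definitions shape the work. \<open>fhat f\<close> is an arbitrary
  choice among integrands that agree only almost everywhere. Every estimate is therefore made for an
  arbitrary integrable \<open>g\<close> representing \<open>f\<close>, and independence of
  \<open>g\<close> rests on injectivity of the Fourier integral; this is why an inversion formula is
  proved, with the window as source of its kernel. Moreover \<open>FL_norm\<close> and
  \<open>Mod_norm\<close> are 0 when their integral or sum diverges, so small norms mean nothing
  without membership. Estimates live in \<open>ennreal\<close>, where finiteness expresses
  membership, and return to real norms only at the end. Closures involve only norms tending to 0, so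
  q-th powers of norms, with a triangle inequality up to a constant, serve as well as norms. For q >
  1 the condition s > n/q' enters as finiteness of the integral of <xi>^(-s q'): it bounds the L^1
  norm of a transform by its weighted L^q norm and makes the weighted L^q space a convolution
  algebra. The same holds on the lattice, so one locale treats both.\<close>

definition epow :: "ennreal \<Rightarrow> real \<Rightarrow> ennreal" where
  "epow x a = (if x = top then top else ennreal (enn2real x powr a))"

lemma epow_ennreal: "0 \<le> r \<Longrightarrow> epow (ennreal r) a = ennreal (r powr a)"
  by (simp add: epow_def)

text \<open>Infinity is fixed by every exponent, including 0 and negative ones, and so is 0 because
  \<open>0 powr a = 0\<close>. Hence finiteness and vanishing pass through \<open>epow\<close> for
  any exponent. The price is that exponent 0 gives 1 only on finite nonzero values.\<close>

lemma epow_top [simp]: "epow top a = top"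
  by (simp add: epow_def)

lemma epow_0 [simp]: "epow 0 a = 0"
  by (simp add: epow_def)

lemma epow_eq_top_iff [simp]: "epow x a = top \<longleftrightarrow> x = top"
  by (simp add: epow_def)

lemma epow_less_top_iff [simp]: "epow x a < top \<longleftrightarrow> x < top"
  by (simp add: epow_def less_top[symmetric])

lemma epow_eq_0_iff [simp]: "epow x a = 0 \<longleftrightarrow> x = 0"
  by (cases x) (auto simp: epow_def ennreal_eq_0_iff)

lemma epow_mono: "x \<le> y \<Longrightarrow> 0 \<le> a \<Longrightarrow> epow x a \<le> epow y a"
  by (cases x; cases y) (auto simp: epow_def top_unique intro!: ennreal_leI powr_mono2)

lemma epow_mult: "epow (x * y) a = epow x a * epow y a"
  by (cases x; cases y)
     (auto simp: epow_def ennreal_mult_top ennreal_top_mult powr_mult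
       ennreal_mult[symmetric] ennreal_eq_0_iff)

lemma epow_epow: "epow (epow x a) b = epow x (a * b)"
  by (cases x) (auto simp: epow_def powr_powr)

lemma epow_one [simp]: "epow x 1 = x"
  by (cases x) (auto simp: epow_def)

lemma epow_one_left [simp]: "epow 1 a = 1"
  using epow_ennreal[of 1 a] by simp

lemma epow_measurable [measurable]:
  assumes "f \<in> borel_measurable M"
  shows "(\<lambda>x. epow (f x) a) \<in> borel_measurable M"
  unfolding epow_def using assms by measurable

lemma epow_diff_one_mult: "1 \<le> p \<Longrightarrow> epow A (p - 1) * A = epow A p"
proof (cases A)
  case (real r)
  assume "1 \<le> p"
  have "r powr (p - 1) * r = r powr p"
    using real by (cases "r = 0") (auto simp: powr_diff)
  then show ?thesis using real
    by (simp add: epow_ennreal ennreal_mult[symmetric])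
qed simp

lemma ennreal_sum_less_top:
  fixes f :: "'b \<Rightarrow> ennreal"
  shows "finite I \<Longrightarrow> (\<And>i. i \<in> I \<Longrightarrow> f i < top) \<Longrightarrow> (\<Sum>i\<in>I. f i) < top"
  by (induction I rule: finite_induct) auto

text \<open>F^r = F^(r-1) F, so under a pointwise bound the integral of an r-th power is controlled
  by that of the first power.\<close>

lemma epow_le_bound: "F \<le> B \<Longrightarrow> 1 \<le> r \<Longrightarrow> epow F r \<le> epow B (r - 1) * F"
  using mult_right_mono[OF epow_mono[of F B "r - 1"], of F] by (simp add: epow_diff_one_mult)

text \<open>The sum is at most \<open>card I\<close> times its largest term, and the power of that
  term is one of the summands. Unlike a convexity bound this covers exponents below 1, such as
  1/p.\<close>

lemma epow_sum_le:
  assumes "finite I" "0 \<le> a"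
  shows "epow (\<Sum>i\<in>I. x i) a \<le> epow (of_nat (card I)) a * (\<Sum>i\<in>I. epow (x i) a)"
proof (cases "I = {}")
  case False
  define m where "m = Max (x ` I)"
  have fin: "finite (x ` I)" "x ` I \<noteq> {}" using assms False by auto
  obtain j where j: "j \<in> I" "m = x j" using Max_in[OF fin] by (auto simp: m_def)
  have "x i \<le> x j" if "i \<in> I" for i
    using Max_ge[OF fin(1), of "x i"] that j by (simp add: m_def)
  then have "(\<Sum>i\<in>I. x i) \<le> of_nat (card I) * x j"
    using sum_bounded_above[of I x "x j"] by simp
  then have "epow (\<Sum>i\<in>I. x i) a \<le> epow (of_nat (card I)) a * epow (x j) a"
    using epow_mono[OF _ assms(2)] by (metis epow_mult)
  also have "epow (x j) a \<le> (\<Sum>i\<in>I. epow (x i) a)"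
    using assms j by (intro member_le_sum) auto
  finally show ?thesis by (simp add: mult_left_mono)
qed simp

lemma epow_add_le:
  assumes "0 \<le> a"
  shows "epow (x + y) a \<le> epow 2 a * (epow x a + epow y a)"
  using epow_sum_le[of "UNIV :: bool set" a "\<lambda>b. if b then x else y"] assms
  by (simp add: UNIV_bool add.commute)

lemma epow_two_finite [simp]: "epow 2 a < top" "epow (of_nat n) a < top" "epow 2 a \<noteq> top"
   by (auto simp: of_nat_less_top)

lemma tendsto_0_epow:
  assumes f: "(f \<longlongrightarrow> 0) F" and a: "0 < a"
  shows "((\<lambda>i. epow (f i) a) \<longlongrightarrow> 0) F"
proof -
  have "eventually (\<lambda>i. f i < 1) F" using f by (auto simp: order_tendsto_iff)
  then have ev: "eventually (\<lambda>i. epow (f i) a = ennreal (enn2real (f i) powr a)) F"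
    by eventually_elim (auto simp: epow_def)
  have "((\<lambda>i. enn2real (f i)) \<longlongrightarrow> 0) F"
    using tendsto_enn2real[of f 0 F] f by simp
  then have "((\<lambda>i. enn2real (f i) powr a) \<longlongrightarrow> 0) F"
    using a by (intro tendsto_zero_powrI[where b=a]) auto
  then have "((\<lambda>i. ennreal (enn2real (f i) powr a)) \<longlongrightarrow> 0) F"
    using tendsto_ennrealI[of _ 0 F] by simp
  then show ?thesis using ev by (simp add: tendsto_cong)
qed

text \<open>The convex function t^q lies above its tangent at c: t^q \<ge> c^q + q c^(q-1) (t - c).
  This is Young's inequality with weights 1/q and 1 - 1/q.\<close>

lemma weighted_Young:
  fixes c t q :: real
  assumes "1 \<le> q" "0 \<le> t" "0 < c"
  shows "q * c powr (q - 1) * t \<le> t powr q + (q - 1) * c powr q"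
proof (cases "t = 0")
  case True
  then show ?thesis using assms by simp
next
  case False
  then have t: "t > 0" using assms by simp
  have "(t powr q) powr (1/q) * (c powr q) powr (1 - 1/q) \<le> (1/q) * t powr q + (1 - 1/q) * c powr q"
    using assms t by (intro Youngs_inequality_0) auto
  moreover have "(t powr q) powr (1/q) = t" using assms t by (simp add: powr_powr)
  moreover have "(c powr q) powr (1 - 1/q) = c powr (q - 1)"
    using assms by (simp add: powr_powr right_diff_distrib)
  ultimately have "t * c powr (q - 1) \<le> (1/q) * t powr q + (1 - 1/q) * c powr q" by simp
  then have "q * (t * c powr (q - 1)) \<le> q * ((1/q) * t powr q + (1 - 1/q) * c powr q)"
    using assms by (intro mult_left_mono) auto
  also have "\<dots> = t powr q + (q - 1) * c powr q" using assms by (simp add: field_simps)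
  finally show ?thesis by (simp add: mult_ac)
qed

section \<open>Integral inequalities\<close>

text \<open>Jensen's inequality for the measure with density \<open>k\<close>, with the
  normalisation by its total mass cleared; equivalently Hoelder's inequality for k = k^(1-1/q)
  k^(1/q). The tangent inequality at the mean of \<open>F\<close> is integrated.\<close>

lemma nn_integral_Jensen:
  assumes [measurable]: "k \<in> borel_measurable M" "F \<in> borel_measurable M" and q: "1 \<le> q"
  shows "epow (\<integral>\<^sup>+x. k x * F x \<partial>M) q \<le> epow (\<integral>\<^sup>+x. k x \<partial>M) (q - 1) * (\<integral>\<^sup>+x. k x * epow (F x) q \<partial>M)"
proof -
  define A where "A = (\<integral>\<^sup>+x. k x \<partial>M)"
  define S where "S = (\<integral>\<^sup>+x. k x * F x \<partial>M)"
  define X where "X = (\<integral>\<^sup>+x. k x * epow (F x) q \<partial>M)"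
  have zero: "S = 0" if "X = 0 \<or> A = 0"
  proof -
    have "AE x in M. k x * F x = 0"
      using that unfolding X_def A_def by (auto simp: nn_integral_0_iff_AE)
    then show ?thesis unfolding S_def by (subst nn_integral_0_iff_AE) auto
  qed
  consider "X = 0 \<or> A = 0" | "X \<noteq> 0" "A = top" | "X \<noteq> 0" "A \<noteq> 0" "A \<noteq> top" by blast
  then have "epow S q \<le> epow A (q - 1) * X"
  proof cases
    case 1 then show ?thesis using zero by simp
  next
    case 2 then show ?thesis by (simp add: ennreal_top_mult)
  next
    case 3
    show ?thesis
    proof (cases "X = top")
      case True
      have "epow A (q - 1) \<noteq> 0" using 3 by simp
      then show ?thesis using True by (simp add: ennreal_mult_top)
    next
      case False
      obtain r where r: "A = ennreal r" "r > 0" using 3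
        by (cases A) (auto simp: ennreal_eq_0_iff not_le)
      obtain v where v: "X = ennreal v" "v \<ge> 0" using False by (cases X) auto
      \<comment> \<open>Integrated against \<open>k\<close> this bounds \<open>S\<close> by A + X,
        so \<open>S\<close> is finite and its real value can be used to form the mean.\<close>
      have F1: "F x \<le> 1 + epow (F x) q" for x
      proof (cases "F x")
        case (real t)
        have "t \<le> 1 + t powr q"
        proof (cases "t \<le> 1")
          case False
          then have "t powr 1 \<le> t powr q" using q by (intro powr_mono) auto
          then show ?thesis using False by simp
        qed (simp add: add_increasing2)
        then have "ennreal t \<le> ennreal (1 + t powr q)" by (rule ennreal_leI)
        then show ?thesis using real by (simp add: epow_ennreal)
      qed simp
      have "S \<le> (\<integral>\<^sup>+x. k x + k x * epow (F x) q \<partial>M)" unfolding S_def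
        using F1 by (intro nn_integral_mono)
          (metis distrib_left mult.right_neutral mult_left_mono zero_le)
      also have "\<dots> = A + X" unfolding A_def X_def by (simp add: nn_integral_add)
      finally have "S < top" 
        using r v by (auto intro: le_less_trans[OF _ ennreal_less_top[of "r + v"]])
      then obtain S' where S': "S = ennreal S'" "S' \<ge> 0" by (cases S) auto
      show ?thesis
      proof (cases "S' = 0")
        case True then show ?thesis using S' by simp
      next
        case False
        \<comment> \<open>The mean of \<open>F\<close> with respect to \<open>k\<close>. With S' = c
          r the integrated tangent inequality collapses to c^q r \<le> v.\<close>
        define c where "c = S' / r"
        have c: "c > 0" using False S' r by (simp add: c_def)
        have pt: "ennreal (q * c powr (q - 1)) * F x \<le> epow (F x) q + ennreal ((q - 1) * c powr q)" for x
        proof (cases "F x")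
          case (real t)
          have "ennreal (q * c powr (q - 1) * t) \<le> ennreal (t powr q + (q - 1) * c powr q)"
            using weighted_Young[OF q _ c] real by (intro ennreal_leI) auto
          then show ?thesis using real q by (simp add: epow_ennreal ennreal_mult)
        qed simp
        have "ennreal (q * c powr (q - 1)) * S = (\<integral>\<^sup>+x. k x * (ennreal (q * c powr (q - 1)) * F x) \<partial>M)"
          unfolding S_def by (subst nn_integral_cmult[symmetric]) (auto simp: mult_ac)
        also have "\<dots> \<le> (\<integral>\<^sup>+x. k x * epow (F x) q + ennreal ((q - 1) * c powr q) * k x \<partial>M)"
          using pt by (intro nn_integral_mono) (metis distrib_left mult.commute mult_left_mono zero_le)
        also have "\<dots> = X + ennreal ((q - 1) * c powr q) * A"
          unfolding X_def A_def by (subst nn_integral_add) (auto simp: nn_integral_cmult)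
        finally have "ennreal (q * c powr (q - 1) * S') \<le> ennreal (v + (q - 1) * c powr q * r)"
          using S' v r q by (simp add: ennreal_mult)
        then have "q * c powr (q - 1) * S' \<le> v + (q - 1) * c powr q * r"
          using v r q by (subst (asm) ennreal_le_iff) auto
        moreover have "S' = c * r" using r by (simp add: c_def)
        moreover have "c powr (q - 1) * c = c powr q" using c by (simp add: powr_diff)
        ultimately have "q * (c powr q * r) \<le> v + (q - 1) * (c powr q * r)"
          by (metis mult.assoc)
        then have "c powr q * r \<le> v" by (simp add: left_diff_distrib)
        then have "r powr (q - 1) * (c powr q * r) \<le> r powr (q - 1) * v"
          by (intro mult_left_mono) auto
        moreover have "r powr (q - 1) * (c powr q * r) = S' powr q"
          using r c \<open>S' = c * r\<close> by (simp add: powr_mult powr_diff)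
        ultimately have "ennreal (S' powr q) \<le> ennreal (r powr (q - 1) * v)"
          by (simp add: ennreal_leI)
        then show ?thesis using S' v r by (simp add: epow_ennreal ennreal_mult)
      qed
    qed
  qed
  then show ?thesis unfolding A_def S_def X_def .
qed

text \<open>Minkowski's integral inequality from Jensen. Write a G = (a N)(G/N): the weight a N has
  exactly the mass on the right-hand side, and each slice of G/N has p-th power integral at most 1,
  so Fubini finishes.\<close>

lemma nn_integral_Minkowski:
  fixes G :: "'b \<Rightarrow> 'c \<Rightarrow> ennreal"
  assumes "sigma_finite_measure X" "sigma_finite_measure Y"
    and a[measurable]: "a \<in> borel_measurable Y" and N[measurable]: "N \<in> borel_measurable Y"
    and G[measurable]: "case_prod G \<in> borel_measurable (X \<Otimes>\<^sub>M Y)"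
    and p: "1 \<le> p" and Nfin: "\<And>y. N y < top"
    and le: "\<And>y. y \<in> space Y \<Longrightarrow> (\<integral>\<^sup>+x. epow (G x y) p \<partial>X) \<le> epow (N y) p"
  shows "(\<integral>\<^sup>+x. epow (\<integral>\<^sup>+y. a y * G x y \<partial>Y) p \<partial>X) \<le> epow (\<integral>\<^sup>+y. a y * N y \<partial>Y) p"
proof -
  interpret X: sigma_finite_measure X by fact
  interpret Y: sigma_finite_measure Y by fact
  interpret XY: pair_sigma_finite X Y ..
  \<comment> \<open>Division by \<open>N\<close> fails where N = 0. There the slice of
    \<open>G\<close> vanishes almost everywhere, so by Fubini these y contribute nothing to the
    inner integral for almost every x.\<close>
  define Z where "Z y = (indicator {0} (N y) :: ennreal)" for y
  have [measurable]: "Z \<in> borel_measurable Y" unfolding Z_def by measurable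
  have Z0: "Z y * (\<integral>\<^sup>+x. G x y \<partial>X) = 0" if y: "y \<in> space Y" for y
  proof (cases "N y = 0")
    case True
    then have "(\<integral>\<^sup>+x. epow (G x y) p \<partial>X) = 0" using le[OF y] by simp
    then have "AE x in X. epow (G x y) p = 0" using y by (subst (asm) nn_integral_0_iff_AE) auto
    then have "(\<integral>\<^sup>+x. G x y \<partial>X) = 0" using y by (subst nn_integral_0_iff_AE) auto
    then show ?thesis by simp
  qed (simp add: Z_def)
  have "(\<integral>\<^sup>+x. (\<integral>\<^sup>+y. a y * Z y * G x y \<partial>Y) \<partial>X) = (\<integral>\<^sup>+y. (\<integral>\<^sup>+x. a y * Z y * G x y \<partial>X) \<partial>Y)"
    by (rule XY.Fubini'[symmetric]) measurable
  also have "\<dots> = (\<integral>\<^sup>+y. 0 \<partial>Y)"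
    using Z0 by (intro nn_integral_cong) (auto simp: nn_integral_cmult mult.assoc)
  also have "\<dots> = 0" by simp
  finally have "AE x in X. (\<integral>\<^sup>+y. a y * Z y * G x y \<partial>Y) = 0"
    by (subst (asm) nn_integral_0_iff_AE) auto
  then have ae: "AE x in X. (\<integral>\<^sup>+y. a y * G x y \<partial>Y) = (\<integral>\<^sup>+y. a y * N y * (G x y / N y) \<partial>Y)"
  proof (rule AE_mp, intro AE_I2 impI)
    fix x assume x: "x \<in> space X" and z: "(\<integral>\<^sup>+y. a y * Z y * G x y \<partial>Y) = 0"
    have "a y * G x y = a y * Z y * G x y + a y * N y * (G x y / N y)" for y
    proof (cases "N y = 0")
      case True then show ?thesis by (simp add: Z_def)
    next
      case False
      then have "N y * (G x y / N y) = G x y"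
        using Nfin[of y] ennreal_mult_divide_eq[of "N y" "G x y"]
        by (simp add: ennreal_times_divide mult.commute[of "N y"])
      then show ?thesis using False by (simp add: Z_def mult.assoc)
    qed
    then have "(\<integral>\<^sup>+y. a y * G x y \<partial>Y) = (\<integral>\<^sup>+y. a y * Z y * G x y + a y * N y * (G x y / N y) \<partial>Y)"
      by simp
    also have "\<dots> = (\<integral>\<^sup>+y. a y * Z y * G x y \<partial>Y) + (\<integral>\<^sup>+y. a y * N y * (G x y / N y) \<partial>Y)"
      using x by (intro nn_integral_add) measurable
    finally show "(\<integral>\<^sup>+y. a y * G x y \<partial>Y) = (\<integral>\<^sup>+y. a y * N y * (G x y / N y) \<partial>Y)" using z by simp
  qed
  define A where "A = (\<integral>\<^sup>+y. a y * N y \<partial>Y)"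
  have "(\<integral>\<^sup>+x. epow (\<integral>\<^sup>+y. a y * G x y \<partial>Y) p \<partial>X)
      = (\<integral>\<^sup>+x. epow (\<integral>\<^sup>+y. a y * N y * (G x y / N y) \<partial>Y) p \<partial>X)"
    using ae by (intro nn_integral_cong_AE) auto
  also have "\<dots> \<le> (\<integral>\<^sup>+x. epow A (p - 1) * (\<integral>\<^sup>+y. a y * N y * epow (G x y / N y) p \<partial>Y) \<partial>X)"
    unfolding A_def using p by (intro nn_integral_mono nn_integral_Jensen) auto
  also have "\<dots> = epow A (p - 1) * (\<integral>\<^sup>+x. (\<integral>\<^sup>+y. a y * N y * epow (G x y / N y) p \<partial>Y) \<partial>X)"
    by (intro nn_integral_cmult) measurable
  also have "(\<integral>\<^sup>+x. (\<integral>\<^sup>+y. a y * N y * epow (G x y / N y) p \<partial>Y) \<partial>X)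
     = (\<integral>\<^sup>+y. (\<integral>\<^sup>+x. a y * N y * epow (G x y / N y) p \<partial>X) \<partial>Y)"
    by (rule XY.Fubini'[symmetric]) measurable
  also have "\<dots> \<le> (\<integral>\<^sup>+y. a y * N y \<partial>Y)"
  proof (rule nn_integral_mono)
    fix y assume y: "y \<in> space Y"
    show "(\<integral>\<^sup>+x. a y * N y * epow (G x y / N y) p \<partial>X) \<le> a y * N y"
    proof (cases "N y = 0")
      case False
      have i: "epow (inverse (N y)) p * epow (N y) p = 1"
        using False Nfin[of y] by (simp add: epow_mult[symmetric] ennreal_inverse_mult mult.commute
            ennreal_divide_self divide_ennreal_def[symmetric])
      have "(\<integral>\<^sup>+x. a y * N y * epow (G x y / N y) p \<partial>X)
          = a y * N y * (epow (inverse (N y)) p * (\<integral>\<^sup>+x. epow (G x y) p \<partial>X))"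
        using y by (simp add: divide_ennreal_def epow_mult nn_integral_cmult nn_integral_multc mult_ac)
      also have "\<dots> \<le> a y * N y * (epow (inverse (N y)) p * epow (N y) p)"
        using le[OF y] by (intro mult_left_mono) auto
      finally show ?thesis using i by simp
    qed simp
  qed
  also have "epow A (p - 1) * (\<integral>\<^sup>+y. a y * N y \<partial>Y) = epow A p"
    using epow_diff_one_mult[OF p] by (simp add: A_def)
  finally show ?thesis by (simp add: A_def mult_left_mono)
qed

section \<open>The weight and weighted convolution inequalities\<close>

lemma jbr_ge_1: "1 \<le> jbr x"
  by (simp add: jbr_def)

lemma jbr_pos [simp]: "0 < jbr x" "jbr x \<noteq> 0" "0 \<le> jbr x"
  using jbr_ge_1[of x] by auto

lemma jbr_measurable [measurable]: "jbr \<in> borel_measurable borel"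
  unfolding jbr_def[abs_def] by measurable

lemma norm_le_jbr: "norm x \<le> jbr x"
  unfolding jbr_def by (rule real_le_rsqrt) simp

lemma jbr_add_norm: "jbr (x + y) \<le> jbr x + norm y"
proof -
  have "1 + (norm (x + y))\<^sup>2 \<le> 1 + (norm x + norm y)\<^sup>2"
    by (simp add: norm_triangle_ineq power_mono)
  also have "\<dots> \<le> (jbr x + norm y)\<^sup>2"
  proof -
    have "norm x * norm y \<le> jbr x * norm y" by (intro mult_right_mono norm_le_jbr) auto
    then show ?thesis by (simp add: power2_sum jbr_def)
  qed
  finally show ?thesis unfolding jbr_def[of "x + y"]
    by (intro real_le_lsqrt) (auto intro: add_nonneg_nonneg)
qed

lemma jbr_add: "jbr (x + y) \<le> jbr x + jbr y"
  using jbr_add_norm[of x y] norm_le_jbr[of y] by linarith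

text \<open>The additive form of the weight inequality: in a convolution the weight falls on one
  factor at a time, and the other factor is measured in L^1 without weight.\<close>

lemma jbr_powr_add:
  assumes "0 \<le> s"
  shows "jbr (x + y) powr s \<le> 2 powr s * (jbr x powr s + jbr y powr s)"
proof -
  have "jbr (x + y) powr s \<le> (2 * max (jbr x) (jbr y)) powr s"
    using assms jbr_add[of x y] by (intro powr_mono2) auto
  also have "\<dots> = 2 powr s * max (jbr x) (jbr y) powr s" by (simp add: powr_mult)
  also have "\<dots> \<le> 2 powr s * (jbr x powr s + jbr y powr s)"
    by (intro mult_left_mono) (auto simp: max_def)
  finally show ?thesis .
qed

text \<open>Lebesgue measure on R^n and counting measure on Z^n share the invariance under
  translation and reflection, so both convolution algebras are obtained at once. Assumption
  \<open>W\<close> says that jbr^(-s) lies in L^(q') with q' = q/(q-1); for q = 1 the bound jbr^s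
  \<ge> 1 takes its place.\<close>

locale weighted_group =
  fixes M :: "'a::euclidean_space measure" and q s :: real
  assumes sf: "sigma_finite_measure M"
    and jbr_M [measurable]: "jbr \<in> borel_measurable M"
    and diff_M [measurable]: "(\<lambda>(x, y). x - y) \<in> M \<Otimes>\<^sub>M M \<rightarrow>\<^sub>M M"
    and shift: "\<And>f y. f \<in> borel_measurable M \<Longrightarrow> y \<in> space M \<Longrightarrow> (\<integral>\<^sup>+x. f (x - y) \<partial>M) = (\<integral>\<^sup>+x. f x \<partial>M)"
    and reflect: "\<And>f x. f \<in> borel_measurable M \<Longrightarrow> x \<in> space M \<Longrightarrow> (\<integral>\<^sup>+y. f (x - y) \<partial>M) = (\<integral>\<^sup>+x. f x \<partial>M)"
    and q1: "1 \<le> q" and s0: "0 \<le> s"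
    and W: "1 < q \<Longrightarrow> (\<integral>\<^sup>+x. ennreal (jbr x powr (- (s * q / (q - 1)))) \<partial>M) < top"
begin

sublocale sigma_finite_measure M by (rule sf)

definition wn :: "('a \<Rightarrow> ennreal) \<Rightarrow> ennreal" where
  "wn u = (\<integral>\<^sup>+x. epow (ennreal (jbr x powr s) * u x) q \<partial>M)"

lemma diff_measurable [measurable (raw)]:
  "f \<in> N \<rightarrow>\<^sub>M M \<Longrightarrow> g \<in> N \<rightarrow>\<^sub>M M \<Longrightarrow> (\<lambda>x. f x - g x) \<in> N \<rightarrow>\<^sub>M M"
  using measurable_compose[OF _ diff_M, of "\<lambda>x. (f x, g x)" N] by simp

lemma jbr_powr_ge_1: "1 \<le> ennreal (jbr x powr s)"
  using jbr_ge_1[of x] s0 ge_one_powr_ge_zero by (metis ennreal_1 ennreal_leI)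

lemma le_weighted: "u \<le> ennreal (jbr x powr s) * u"
  using mult_right_mono[OF jbr_powr_ge_1, of u x] by simp

text \<open>The embedding of weighted L^q into L^1. For q = 1 it is the bound jbr^s \<ge> 1; for q >
  1 it is Hoelder's inequality, read off from Jensen with the integrable weight jbr^(-t).\<close>

lemma L1_le_wn:
  "\<exists>C<top. \<forall>u\<in>borel_measurable M. epow (\<integral>\<^sup>+x. u x \<partial>M) q \<le> C * wn u"
proof (cases "q = 1")
  case True
  have "epow (\<integral>\<^sup>+x. u x \<partial>M) q \<le> 1 * wn u" for u
    unfolding wn_def by (simp add: True) (intro nn_integral_mono le_weighted)
  then show ?thesis by (intro exI[of _ 1]) auto
next
  case False
  then have q: "q > 1" using q1 by simp
  \<comment> \<open>t = s q', chosen so that t q - t = s q: the weight jbr^(-t) and the power jbr^(t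
    q) combine to jbr^(s q).\<close>
  define t where "t = s * q / (q - 1)"
  define A where "A = (\<integral>\<^sup>+x. ennreal (jbr x powr (- t)) \<partial>M)"
  show ?thesis
  proof (intro exI[of _ "epow A (q - 1)"] conjI ballI)
    show "epow A (q - 1) < top" using W[OF q] by (simp add: A_def t_def)
    fix u :: "'a \<Rightarrow> ennreal" assume [measurable]: "u \<in> borel_measurable M"
    have 1: "ennreal (jbr x powr (- t)) * (ennreal (jbr x powr t) * u x) = u x" for x
      by (simp add: mult.assoc[symmetric] ennreal_mult[symmetric] powr_add[symmetric])
    have "t * (q - 1) = s * q" using q by (simp add: t_def)
    then have e: "t * q - t = s * q" by (simp add: right_diff_distrib)
    have 2: "ennreal (jbr x powr (- t)) * epow (ennreal (jbr x powr t) * u x) q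
       = epow (ennreal (jbr x powr s) * u x) q" for x
      by (simp add: epow_mult epow_ennreal powr_powr mult.assoc[symmetric] ennreal_mult[symmetric]
          powr_add[symmetric] e)
    have "epow (\<integral>\<^sup>+x. ennreal (jbr x powr (- t)) * (ennreal (jbr x powr t) * u x) \<partial>M) q
       \<le> epow A (q - 1) * (\<integral>\<^sup>+x. ennreal (jbr x powr (- t)) * epow (ennreal (jbr x powr t) * u x) q \<partial>M)"
      unfolding A_def using q1 by (intro nn_integral_Jensen) auto
    then show "epow (\<integral>\<^sup>+x. u x \<partial>M) q \<le> epow A (q - 1) * wn u"
      unfolding 1 2 wn_def .
  qed
qed

text \<open>Young's inequality for L^1 against L^p, in p-th powers: Jensen in y with weight
  \<open>a\<close>, then Fubini and translation invariance.\<close>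

lemma Young_conv:
  assumes [measurable]: "a \<in> borel_measurable M" "v \<in> borel_measurable M" and p: "1 \<le> p"
  shows "(\<integral>\<^sup>+x. epow (\<integral>\<^sup>+y. a y * v (x - y) \<partial>M) p \<partial>M) \<le> epow (\<integral>\<^sup>+x. a x \<partial>M) p * (\<integral>\<^sup>+x. epow (v x) p \<partial>M)"
proof -
  interpret pair_sigma_finite M M ..
  define A where "A = (\<integral>\<^sup>+x. a x \<partial>M)"
  have "(\<integral>\<^sup>+x. epow (\<integral>\<^sup>+y. a y * v (x - y) \<partial>M) p \<partial>M)
     \<le> (\<integral>\<^sup>+x. epow A (p - 1) * (\<integral>\<^sup>+y. a y * epow (v (x - y)) p \<partial>M) \<partial>M)"
    unfolding A_def using p by (intro nn_integral_mono nn_integral_Jensen) measurable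
  also have "\<dots> = epow A (p - 1) * (\<integral>\<^sup>+x. (\<integral>\<^sup>+y. a y * epow (v (x - y)) p \<partial>M) \<partial>M)"
    by (intro nn_integral_cmult) measurable
  also have "(\<integral>\<^sup>+x. (\<integral>\<^sup>+y. a y * epow (v (x - y)) p \<partial>M) \<partial>M)
     = (\<integral>\<^sup>+y. (\<integral>\<^sup>+x. a y * epow (v (x - y)) p \<partial>M) \<partial>M)"
    by (rule Fubini'[symmetric]) measurable
  also have "\<dots> = (\<integral>\<^sup>+y. a y * (\<integral>\<^sup>+x. epow (v x) p \<partial>M) \<partial>M)"
  proof (rule nn_integral_cong)
    fix y assume y: "y \<in> space M"
    have "(\<integral>\<^sup>+x. a y * epow (v (x - y)) p \<partial>M) = a y * (\<integral>\<^sup>+x. epow (v (x - y)) p \<partial>M)"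
      using y by (intro nn_integral_cmult) measurable
    then show "(\<integral>\<^sup>+x. a y * epow (v (x - y)) p \<partial>M) = a y * (\<integral>\<^sup>+x. epow (v x) p \<partial>M)"
      using shift[of "\<lambda>x. epow (v x) p" y] y by simp
  qed
  also have "\<dots> = A * (\<integral>\<^sup>+x. epow (v x) p \<partial>M)"
    unfolding A_def by (rule nn_integral_multc) measurable
  finally show ?thesis using epow_diff_one_mult[OF p, of A]
    by (simp add: A_def mult.assoc[symmetric])
qed

text \<open>The weighted algebra property. The weight splits between the factors; each of the two
  convolutions is then L^1 against weighted L^q, and \<open>L1_le_wn\<close> bounds the unweighted
  factor.\<close>

lemma conv_wn:
  "\<exists>C<top. \<forall>u\<in>borel_measurable M. \<forall>v\<in>borel_measurable M.
      wn (\<lambda>x. \<integral>\<^sup>+y. u y * v (x - y) \<partial>M) \<le> C * wn u * wn v"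
proof -
  obtain C where C: "C < top" "\<And>u. u \<in> borel_measurable M \<Longrightarrow> epow (\<integral>\<^sup>+x. u x \<partial>M) q \<le> C * wn u"
    using L1_le_wn by blast
  define D where "D = epow (ennreal (2 powr s)) q * epow 2 q"
  have D: "D < top" by (simp add: D_def ennreal_mult_less_top)
  show ?thesis
  proof (intro exI[of _ "D * C * 2"] conjI ballI)
    show "D * C * 2 < top" using C D by (simp add: ennreal_mult_less_top)
    fix u v :: "'a \<Rightarrow> ennreal"
    assume [measurable]: "u \<in> borel_measurable M" "v \<in> borel_measurable M"
    define u' where "u' x = ennreal (jbr x powr s) * u x" for x
    define v' where "v' x = ennreal (jbr x powr s) * v x" for x
    have [measurable]: "u' \<in> borel_measurable M" "v' \<in> borel_measurable M"
      unfolding u'_def v'_def by measurable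
    define c1 where "c1 x = (\<integral>\<^sup>+y. v y * u' (x - y) \<partial>M)" for x
    define c2 where "c2 x = (\<integral>\<^sup>+y. u y * v' (x - y) \<partial>M)" for x
    have [measurable]: "c1 \<in> borel_measurable M" "c2 \<in> borel_measurable M"
      unfolding c1_def c2_def by measurable
    have "wn (\<lambda>x. \<integral>\<^sup>+y. u y * v (x - y) \<partial>M) \<le> (\<integral>\<^sup>+x. D * (epow (c1 x) q + epow (c2 x) q) \<partial>M)"
      unfolding wn_def
    proof (rule nn_integral_mono)
      fix x assume x: "x \<in> space M"
      \<comment> \<open>Reflection interchanges the factors: in \<open>c1\<close> the L^1 factor of
        Young's inequality is \<open>v\<close>, while \<open>u'\<close> carries the weight.\<close>
      have r: "c1 x = (\<integral>\<^sup>+y. u' y * v (x - y) \<partial>M)"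
        using reflect[of "\<lambda>z. v z * u' (x - z)" x] x unfolding c1_def
        by (simp add: mult.commute)
      have "ennreal (jbr x powr s) * (\<integral>\<^sup>+y. u y * v (x - y) \<partial>M)
         = (\<integral>\<^sup>+y. ennreal (jbr x powr s) * (u y * v (x - y)) \<partial>M)"
        using x by (intro nn_integral_cmult[symmetric]) measurable
      also have "\<dots> \<le> (\<integral>\<^sup>+y. ennreal (2 powr s) * (u' y * v (x - y) + u y * v' (x - y)) \<partial>M)"
      proof (rule nn_integral_mono)
        fix y
        have "ennreal (jbr x powr s) \<le> ennreal (2 powr s * (jbr y powr s + jbr (x - y) powr s))"
          using jbr_powr_add[OF s0, of y "x - y"] by (intro ennreal_leI) simp
        also have "\<dots> = ennreal (2 powr s) * (ennreal (jbr y powr s) + ennreal (jbr (x - y) powr s))"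
          by (simp add: ennreal_mult)
        finally have "ennreal (jbr x powr s) * (u y * v (x - y))
          \<le> ennreal (2 powr s) * (ennreal (jbr y powr s) + ennreal (jbr (x - y) powr s)) * (u y * v (x - y))"
          by (rule mult_right_mono) simp
        then show "ennreal (jbr x powr s) * (u y * v (x - y))
          \<le> ennreal (2 powr s) * (u' y * v (x - y) + u y * v' (x - y))"
          unfolding u'_def v'_def by (simp add: algebra_simps)
      qed
      also have "\<dots> = ennreal (2 powr s) * (\<integral>\<^sup>+y. (u' y * v (x - y) + u y * v' (x - y)) \<partial>M)"
        using x by (intro nn_integral_cmult) measurable
      also have "(\<integral>\<^sup>+y. (u' y * v (x - y) + u y * v' (x - y)) \<partial>M) = c1 x + c2 x"
        unfolding r c2_def using x by (intro nn_integral_add) measurable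
      finally have "epow (ennreal (jbr x powr s) * (\<integral>\<^sup>+y. u y * v (x - y) \<partial>M)) q
          \<le> epow (ennreal (2 powr s) * (c1 x + c2 x)) q"
        using q1 by (intro epow_mono) auto
      also have "\<dots> \<le> epow (ennreal (2 powr s)) q * (epow 2 q * (epow (c1 x) q + epow (c2 x) q))"
        unfolding epow_mult using q1 by (intro mult_left_mono epow_add_le) auto
      finally show "epow (ennreal (jbr x powr s) * (\<integral>\<^sup>+y. u y * v (x - y) \<partial>M)) q
          \<le> D * (epow (c1 x) q + epow (c2 x) q)" by (simp add: D_def mult.assoc)
    qed
    also have "\<dots> = D * ((\<integral>\<^sup>+x. epow (c1 x) q \<partial>M) + (\<integral>\<^sup>+x. epow (c2 x) q \<partial>M))"
      by (simp add: nn_integral_cmult nn_integral_add)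
    also have "\<dots> \<le> D * (C * wn v * wn u + C * wn u * wn v)"
    proof (intro mult_left_mono add_mono)
      have "(\<integral>\<^sup>+x. epow (c1 x) q \<partial>M) \<le> epow (\<integral>\<^sup>+x. v x \<partial>M) q * wn u"
        unfolding c1_def wn_def u'_def[symmetric] using q1 by (intro Young_conv) auto
      also have "\<dots> \<le> C * wn v * wn u" by (intro mult_right_mono C) auto
      finally show "(\<integral>\<^sup>+x. epow (c1 x) q \<partial>M) \<le> C * wn v * wn u" .
      have "(\<integral>\<^sup>+x. epow (c2 x) q \<partial>M) \<le> epow (\<integral>\<^sup>+x. u x \<partial>M) q * wn v"
        unfolding c2_def wn_def v'_def[symmetric] using q1 by (intro Young_conv) auto
      also have "\<dots> \<le> C * wn u * wn v" by (intro mult_right_mono C) auto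
      finally show "(\<integral>\<^sup>+x. epow (c2 x) q \<partial>M) \<le> C * wn u * wn v" .
    qed auto
    also have "\<dots> = D * C * 2 * wn u * wn v" by (simp add: algebra_simps mult_2)
    finally show "wn (\<lambda>x. \<integral>\<^sup>+y. u y * v (x - y) \<partial>M) \<le> D * C * 2 * wn u * wn v" .
  qed
qed

lemma wn_mono_AE:
  assumes "AE x in M. u x \<le> v x"
  shows "wn u \<le> wn v"
  unfolding wn_def using q1
  by (intro nn_integral_mono_AE, use assms in eventually_elim) (auto intro!: epow_mono mult_left_mono)

lemma wn_mono: "(\<And>x. x \<in> space M \<Longrightarrow> u x \<le> v x) \<Longrightarrow> wn u \<le> wn v"
  by (intro wn_mono_AE AE_I2)

lemma wn_cmult:
  assumes [measurable]: "u \<in> borel_measurable M"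
  shows "wn (\<lambda>x. c * u x) = epow c q * wn u"
proof -
  have "ennreal (jbr x powr s) * (c * u x) = c * (ennreal (jbr x powr s) * u x)" for x
    by (simp add: mult_ac)
  then show ?thesis unfolding wn_def by (simp add: epow_mult[of c] nn_integral_cmult)
qed

lemma wn_add_le:
  assumes [measurable]: "u \<in> borel_measurable M" "v \<in> borel_measurable M"
  shows "wn (\<lambda>x. u x + v x) \<le> epow 2 q * (wn u + wn v)"
proof -
  have "wn (\<lambda>x. u x + v x) \<le> (\<integral>\<^sup>+x. epow 2 q * (epow (ennreal (jbr x powr s) * u x) q + epow (ennreal (jbr x powr s) * v x) q) \<partial>M)"
    unfolding wn_def distrib_left using q1 by (intro nn_integral_mono order_trans[OF epow_add_le])
      (auto simp: distrib_left)
  also have "\<dots> = epow 2 q * (wn u + wn v)"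
    unfolding wn_def by (simp add: nn_integral_cmult nn_integral_add)
  finally show ?thesis .
qed

end

lemma distr_lborel_reflect:
  "distr lborel borel (\<lambda>y. x - y) = (lborel :: 'a::euclidean_space measure)"
  by (subst (2) lborel_affine[of "-1" x]) (auto simp: density_1)

lemma distr_lborel_shift:
  "distr lborel borel (\<lambda>x. x - y) = (lborel :: 'a::euclidean_space measure)"
proof -
  have "(\<lambda>x. x - y) = (+) (- y)" by auto
  then show ?thesis using lborel_distr_plus[of "- y"] by simp
qed

lemma nn_integral_lborel_shift:
  fixes f :: "'a::euclidean_space \<Rightarrow> ennreal"
  assumes [measurable]: "f \<in> borel_measurable borel"
  shows "(\<integral>\<^sup>+x. f (x - y) \<partial>lborel) = (\<integral>\<^sup>+x. f x \<partial>lborel)"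
  by (subst (2) distr_lborel_shift[of y, symmetric]) (simp add: nn_integral_distr)

lemma nn_integral_lborel_reflect:
  fixes f :: "'a::euclidean_space \<Rightarrow> ennreal"
  assumes [measurable]: "f \<in> borel_measurable borel"
  shows "(\<integral>\<^sup>+y. f (x - y) \<partial>lborel) = (\<integral>\<^sup>+x. f x \<partial>lborel)"
  by (subst (2) distr_lborel_reflect[of x, symmetric]) (simp add: nn_integral_distr)

text \<open>Dyadic shells: a point with 2^j \<le> jbr x < 2^(j+1) lies in a ball of volume
  comparable to 2^(j n), so the integral is dominated by a geometric series of ratio 2^(n - t) <
  1.\<close>

lemma nn_integral_jbr_powr_finite:
  assumes t: "real DIM('a) < t"
  shows "(\<integral>\<^sup>+x. ennreal (jbr (x::'a::euclidean_space) powr (- t)) \<partial>lborel) < top"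
proof -
  let ?n = "DIM('a)"
  define V where "V = unit_ball_vol (real ?n)"
  have V: "V \<ge> 0" by (simp add: V_def)
  define B where "B j = ball (0::'a) (2 ^ Suc j)" for j
  have [measurable]: "B j \<in> sets borel" for j unfolding B_def by (rule borel_open[OF open_ball])
  have le: "ennreal (jbr x powr (- t)) \<le> (\<Sum>j. ennreal ((2 ^ j) powr (- t)) * indicator (B j) x)" for x :: 'a
  proof -
    define j where "j = nat \<lfloor>log 2 (jbr x)\<rfloor>"
    have "0 \<le> log 2 (jbr x)" using jbr_ge_1[of x] by simp
    then have j': "\<lfloor>log 2 (jbr x)\<rfloor> = int j" by (simp add: j_def)
    then have "2 powr j \<le> jbr x" "jbr x < 2 powr (real j + 1)"
      using floor_log_eq_powr_iff[of "jbr x" 2 "int j"] by auto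
    then have j: "2 ^ j \<le> jbr x" "jbr x < 2 ^ Suc j"
      by (auto simp: powr_realpow powr_add)
    have "t > 0" using t by (smt (verit) of_nat_0_le_iff)
    then have "jbr x powr (- t) \<le> (2 ^ j) powr (- t)"
      using j by (intro powr_mono2') auto
    moreover have "x \<in> B j" unfolding B_def using j norm_le_jbr[of x] by auto
    ultimately have "ennreal (jbr x powr (- t)) \<le> ennreal ((2 ^ j) powr (- t)) * indicator (B j) x"
      by (simp add: ennreal_leI)
    also have "\<dots> \<le> (\<Sum>j. ennreal ((2 ^ j) powr (- t)) * indicator (B j) x)"
      using sum_le_suminf[of "\<lambda>j. ennreal ((2 ^ j) powr (- t)) * indicator (B j) x" "{j}"]
      by (simp only: sum.insert sum.empty finite.intros empty_iff not_False_eq_True add_0_right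
          summableI zero_le)
    finally show ?thesis .
  qed
  have "(\<integral>\<^sup>+x. ennreal (jbr (x::'a) powr (- t)) \<partial>lborel)
     \<le> (\<integral>\<^sup>+x. (\<Sum>j. ennreal ((2 ^ j) powr (- t)) * indicator (B j) (x::'a)) \<partial>lborel)"
    by (intro nn_integral_mono le)
  also have "\<dots> = (\<Sum>j. ennreal ((2 ^ j) powr (- t)) * emeasure lborel (B j))"
    by (subst nn_integral_suminf) (auto simp: nn_integral_cmult_indicator)
  also have "\<dots> = (\<Sum>j. ennreal (V * 2 ^ ?n * (2 powr (real ?n - t)) ^ j))"
  proof (intro suminf_cong)
    fix j
    have "emeasure lborel (B j) = ennreal (V * (2 ^ Suc j) ^ ?n)"
      unfolding V_def B_def by (rule emeasure_ball) simp
    then have "ennreal ((2 ^ j) powr (- t)) * emeasure lborel (B j)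
       = ennreal ((2 ^ j) powr (- t) * (V * (2 ^ Suc j) ^ ?n))"
      using V by (simp add: ennreal_mult)
    also have "(2 ^ j) powr (- t) * (V * (2 ^ Suc j) ^ ?n) = V * 2 ^ ?n * ((2 ^ j) powr (- t) * ((2 ^ j) ^ ?n))"
      by (simp add: power_mult_distrib)
    also have "((2::real) ^ j) ^ ?n = (2 ^ j) powr (real ?n)" by (rule powr_realpow[symmetric]) simp
    also have "(2 ^ j) powr (- t) * (2 ^ j) powr (real ?n) = ((2::real) ^ j) powr (real ?n - t)"
      unfolding powr_add[symmetric] by simp
    also have "\<dots> = (2 powr real j) powr (real ?n - t)" by (simp only: powr_realpow zero_less_numeral)
    also have "\<dots> = (2 powr (real ?n - t)) powr real j" by (simp only: powr_powr mult.commute)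
    also have "\<dots> = (2 powr (real ?n - t)) ^ j" by (rule powr_realpow) simp
    finally show "ennreal ((2 ^ j) powr (- t)) * emeasure lborel (B j)
       = ennreal (V * 2 ^ ?n * (2 powr (real ?n - t)) ^ j)" .
  qed
  also have "\<dots> < top"
  proof -
    have "2 powr (real ?n - t) < 2 powr (0::real)" using t by (subst powr_less_cancel_iff) auto
    then have "summable (\<lambda>j. (2 powr (real ?n - t)) ^ j)" by (intro summable_geometric) auto
    then have "summable (\<lambda>j. V * 2 ^ ?n * (2 powr (real ?n - t)) ^ j)" by (rule summable_mult)
    then show ?thesis using V by (subst suminf_ennreal2) auto
  qed
  finally show ?thesis .
qed

section \<open>The integer lattice\<close>

text \<open>Distance at most r in the maximum norm, for which the support of the window lies in the
  unit ball. Radii add in \<open>near_trans\<close>; this is where the radii 2 and 3 below come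
  from.\<close>

definition near :: "real \<Rightarrow> 'a::euclidean_space \<Rightarrow> 'a \<Rightarrow> bool" where
  "near r x y \<longleftrightarrow> (\<forall>b\<in>Basis. \<bar>(x - y) \<bullet> b\<bar> \<le> r)"

definition floorv :: "'a::euclidean_space \<Rightarrow> 'a" where
  "floorv x = (\<Sum>b\<in>Basis. of_int \<lfloor>x \<bullet> b\<rfloor> *\<^sub>R b)"

lemma near_sym: "near r x y \<longleftrightarrow> near r y x"
  unfolding near_def by (auto simp: inner_diff_left abs_minus_commute)

lemma near_trans: "near r x y \<Longrightarrow> near r' y z \<Longrightarrow> near (r + r') x z"
proof -
  assume 1: "near r x y" and 2: "near r' y z"
  have "\<bar>(x - z) \<bullet> b\<bar> \<le> r + r'" if "b \<in> Basis" for b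
    using 1[unfolded near_def, rule_format, OF that] 2[unfolded near_def, rule_format, OF that]
    by (simp add: inner_diff_left)
  then show ?thesis by (simp add: near_def)
qed

lemma near_mono: "near r x y \<Longrightarrow> r \<le> r' \<Longrightarrow> near r' x y"
  unfolding near_def by fastforce

lemma near_norm: "near r x y \<Longrightarrow> norm (x - y) \<le> r * real DIM('a)" for x :: "'a::euclidean_space"
proof -
  assume "near r x y"
  then have "norm (x - y) \<le> (\<Sum>b\<in>(Basis::'a set). r)"
    unfolding near_def by (intro order_trans[OF norm_le_l1] sum_mono) auto
  then show ?thesis by (simp add: mult.commute)
qed

lemma norm_near: "norm (x - y) \<le> r \<Longrightarrow> near r x y"
  unfolding near_def by (meson Basis_le_norm order_trans)

text \<open>Weights at bounded distance are comparable. The factor \<open>DIM('a)\<close> is the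
  price of passing from the maximum norm to the Euclidean one.\<close>

lemma near_jbr: "near r x y \<Longrightarrow> 0 \<le> r \<Longrightarrow> jbr x \<le> (1 + r * real DIM('a)) * jbr y" for x :: "'a::euclidean_space"
proof -
  assume n: "near r x y" and r: "0 \<le> r"
  have "jbr x \<le> jbr y + norm (x - y)" using jbr_add_norm[of y "x - y"] by simp
  also have "\<dots> \<le> jbr y + r * real DIM('a) * jbr y"
    using near_norm[OF n] mult_left_mono[OF jbr_ge_1[of y], of "r * real DIM('a)"] r by auto
  finally show ?thesis by (simp add: algebra_simps)
qed

lemma near_measurable [measurable]: "Measurable.pred borel (\<lambda>x. near r x y)" "Measurable.pred borel (\<lambda>y. near r x y)"
  unfolding near_def by measurable

lemma emeasure_near: "emeasure lborel {x::'a::euclidean_space. near r x y} < top"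
proof -
  have "{x. near r x y} \<subseteq> cball y (r * real DIM('a))"
    using near_norm by (auto simp: dist_norm norm_minus_commute)
  then have "emeasure lborel {x. near r x y} \<le> emeasure lborel (cball y (r * real DIM('a)))"
    by (intro emeasure_mono) auto
  also have "\<dots> < top"
    using emeasure_compact_finite[OF compact_cball, of y "r * real DIM('a)"] by simp
  finally show ?thesis .
qed

lemma emeasure_near_shift: "emeasure lborel {x::'a. near r x y} = emeasure lborel {x::'a::euclidean_space. near r x 0}"
proof -
  have "(\<integral>\<^sup>+x. indicator {x. near r x 0} (x - y) \<partial>lborel) = (\<integral>\<^sup>+x. indicator {x::'a. near r x 0} x \<partial>lborel)"
    using nn_integral_lborel_shift[of "indicator {x. near r x 0}" y] by simp
  moreover have "(\<lambda>x. indicator {x. near r x 0} (x - y) :: ennreal) = indicator {x. near r x y}"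
    by (auto simp: indicator_def near_def fun_eq_iff)
  ultimately show ?thesis by simp
qed

lemma floorv_inner [simp]: "b \<in> Basis \<Longrightarrow> floorv x \<bullet> b = of_int \<lfloor>x \<bullet> b\<rfloor>"
  unfolding floorv_def by (simp add: inner_sum_left_Basis)

lemma floorv_Zlat [simp]: "floorv x \<in> Zlat"
  by (auto simp: Zlat_def)

lemma near_floorv: "near 1 x (floorv x)"
  unfolding near_def by (auto simp: inner_diff_left) linarith

lemma floorv_measurable [measurable]: "floorv \<in> borel_measurable borel"
  unfolding floorv_def[abs_def] by measurable

lemma Zlat_add: "x \<in> Zlat \<Longrightarrow> y \<in> Zlat \<Longrightarrow> x + y \<in> Zlat"
  and Zlat_diff: "x \<in> Zlat \<Longrightarrow> y \<in> Zlat \<Longrightarrow> x - y \<in> Zlat"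
  by (auto simp: Zlat_def inner_add_left inner_diff_left)

lemma finite_Zlat_near_0: "finite {l \<in> Zlat. near r l (0::'a::euclidean_space)}"
proof (rule finite_subset)
  let ?S = "(\<lambda>f. \<Sum>b\<in>(Basis::'a set). of_int (f b) *\<^sub>R b) ` (PiE (Basis::'a set) (\<lambda>_. {- \<lceil>r\<rceil>..\<lceil>r\<rceil>}))"
  show "finite ?S" by (intro finite_imageI finite_PiE) auto
  show "{l \<in> Zlat. near r l (0::'a)} \<subseteq> ?S"
  proof safe
    fix l :: 'a assume l: "l \<in> Zlat" "near r l 0"
    let ?f = "restrict (\<lambda>b. \<lfloor>l \<bullet> b\<rfloor>) Basis"
    have e: "of_int \<lfloor>l \<bullet> b\<rfloor> = l \<bullet> b" if "b \<in> Basis" for b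
      using l that by (auto simp: Zlat_def elim!: Ints_cases)
    have "?f \<in> PiE Basis (\<lambda>_. {- \<lceil>r\<rceil>..\<lceil>r\<rceil>})"
    proof (rule restrict_PiE_iff[THEN iffD2], rule ballI)
      fix b :: 'a assume b: "b \<in> Basis"
      have "\<bar>l \<bullet> b\<bar> \<le> r" using l b by (auto simp: near_def)
      then have "\<bar>real_of_int \<lfloor>l \<bullet> b\<rfloor>\<bar> \<le> r" by (simp only: e[OF b])
      then show "\<lfloor>l \<bullet> b\<rfloor> \<in> {- \<lceil>r\<rceil>..\<lceil>r\<rceil>}"
        unfolding atLeastAtMost_iff by linarith
    qed
    moreover have "l = (\<Sum>b\<in>Basis. of_int (?f b) *\<^sub>R b)"
      by (subst euclidean_representation[symmetric]) (auto intro!: sum.cong simp: e)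
    ultimately show "l \<in> ?S" by blast
  qed
qed

lemma countable_Zlat: "countable (Zlat :: 'a::euclidean_space set)"
proof (rule countable_subset)
  show "(Zlat :: 'a set) \<subseteq> (\<Union>n::nat. {l \<in> Zlat. near (real n) l 0})"
  proof
    fix l :: 'a assume l: "l \<in> Zlat"
    obtain n :: nat where "norm l \<le> real n" using real_arch_simple by blast
    then have "near (real n) l 0" using norm_near[of l 0 "real n"] by simp
    then show "l \<in> (\<Union>n::nat. {l \<in> Zlat. near (real n) l 0})" using l by blast
  qed
  show "countable (\<Union>n::nat. {l \<in> Zlat. near (real n) l (0::'a)})"
    by (rule countable_UN) (auto intro: countable_finite finite_Zlat_near_0)
qed

text \<open>Serves as a bound uniform in the centre: moving an arbitrary centre y to the lattice
  point \<open>floorv y\<close> costs distance 1, hence the radius r + 1.\<close>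

definition Zcount :: "'a::euclidean_space itself \<Rightarrow> real \<Rightarrow> nat" where
  "Zcount _ r = card {l \<in> Zlat. near (r + 1) l (0::'a)}"

lemma Zlat_near_card:
  fixes y :: "'a::euclidean_space"
  shows "finite {l \<in> Zlat. near r l y} \<and> card {l \<in> Zlat. near r l y} \<le> Zcount TYPE('a) r"
proof -
  let ?f = "\<lambda>l. l - floorv y"
  have i: "inj_on ?f {l \<in> Zlat. near r l y}" by (auto simp: inj_on_def)
  have "near r l y \<Longrightarrow> near (r + 1) (l - floorv y) 0" for l
    using near_trans[OF _ near_floorv, of r l y] by (simp add: near_def)
  then have sub: "?f ` {l \<in> Zlat. near r l y} \<subseteq> {l \<in> Zlat. near (r + 1) l 0}"
    by (auto intro!: Zlat_diff)
  show ?thesis unfolding Zcount_def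
    using card_inj_on_le[OF i sub finite_Zlat_near_0]
      inj_on_finite[OF i sub finite_Zlat_near_0] by blast
qed

lemma floorv_diff:
  assumes k: "k \<in> Zlat"
  shows "floorv (x - k) = floorv x - k"
proof (rule euclidean_eqI)
  fix b :: 'a assume b: "b \<in> Basis"
  obtain n where "k \<bullet> b = of_int n" using k b unfolding Zlat_def by (auto elim: Ints_cases)
  then have fl: "\<lfloor>(x - k) \<bullet> b\<rfloor> = \<lfloor>x \<bullet> b\<rfloor> - k \<bullet> b" by (simp add: inner_diff_left)
  show "floorv (x - k) \<bullet> b = (floorv x - k) \<bullet> b"
    unfolding floorv_inner[OF b] fl inner_diff_left[of "floorv x"] ..
qed

lemma emeasure_cell:
  shows "emeasure lborel {x::'a::euclidean_space. floorv x = 0} \<noteq> 0"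
    and "emeasure lborel {x::'a. floorv x = 0} < top"
proof -
  have [measurable]: "{x::'a. floorv x = k} \<in> sets borel" for k by measurable
  have sub: "{x::'a. floorv x = 0} \<subseteq> {x. near 1 x 0}"
    by (metis (mono_tags, lifting) mem_Collect_eq near_floorv subsetI)
  show "emeasure lborel {x::'a. floorv x = 0} < top"
    using emeasure_mono[OF sub, of lborel] emeasure_near[of 1 "0::'a"]
    by (simp add: le_less_trans)
  have "box 0 One \<subseteq> {x::'a. floorv x = 0}"
  proof
    fix x :: 'a assume x: "x \<in> box 0 One"
    have "floorv x \<bullet> b = 0" if "b \<in> Basis" for b
      using x that by (auto simp: mem_box floor_eq_iff less_imp_le)
    then show "x \<in> {x::'a. floorv x = 0}" by (auto intro: euclidean_eqI)
  qed
  then have "emeasure lborel (box 0 (One::'a)) \<le> emeasure lborel {x::'a. floorv x = 0}"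
    by (intro emeasure_mono) auto
  then show "emeasure lborel {x::'a. floorv x = 0} \<noteq> 0" by (auto simp: emeasure_lborel_box_eq)
qed

text \<open>The unit cells tile the space and have equal volume \<open>v\<close>, so a lattice sum
  is the integral of a function constant on cells.\<close>

lemma nn_integral_floorv:
  "\<exists>v. v \<noteq> 0 \<and> v < top \<and> (\<forall>F :: 'a::euclidean_space \<Rightarrow> ennreal.
     (\<integral>\<^sup>+x. F (floorv x) \<partial>lborel) = v * (\<integral>\<^sup>+k. F k \<partial>count_space Zlat))"
proof -
  define v where "v = emeasure lborel {x::'a. floorv x = 0}"
  have [measurable]: "{x::'a. floorv x = k} \<in> sets borel" for k by measurable
  have vk: "emeasure lborel {x::'a. floorv x = k} = v" if k: "k \<in> Zlat" for k
  proof -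
    have "(\<lambda>x. indicator {x::'a. floorv x = 0} (x - k) :: ennreal) = indicator {x. floorv x = k}"
      by (auto simp: indicator_def floorv_diff[OF k])
    then show ?thesis
      using nn_integral_lborel_shift[of "indicator {x::'a. floorv x = 0}" k] by (simp add: v_def)
  qed
  have "(\<integral>\<^sup>+x. F (floorv x) \<partial>lborel) = v * (\<integral>\<^sup>+k. F k \<partial>count_space Zlat)" for F :: "'a \<Rightarrow> ennreal"
  proof -
    have "F (floorv x) = (\<integral>\<^sup>+k. F k * indicator {x. floorv x = k} x \<partial>count_space Zlat)" for x
    proof -
      have "(\<integral>\<^sup>+k. F k * indicator {x. floorv x = k} x \<partial>count_space Zlat)
          = (\<integral>\<^sup>+k. F k * indicator {floorv x} k \<partial>count_space Zlat)"
        by (intro nn_integral_cong) (auto simp: indicator_def)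
      also have "\<dots> = F (floorv x)" by (subst nn_integral_indicator_singleton) auto
      finally show ?thesis by simp
    qed
    then have "(\<integral>\<^sup>+x. F (floorv x) \<partial>lborel)
        = (\<integral>\<^sup>+x. (\<integral>\<^sup>+k. F k * indicator {x. floorv x = k} x \<partial>count_space Zlat) \<partial>lborel)" by simp
    also have "\<dots> = (\<integral>\<^sup>+k. (\<integral>\<^sup>+x. F k * indicator {x. floorv x = k} x \<partial>lborel) \<partial>count_space Zlat)"
      by (rule nn_integral_count_space_nn_integral[OF countable_Zlat]) measurable
    also have "\<dots> = (\<integral>\<^sup>+k. F k * v \<partial>count_space Zlat)"
      by (intro nn_integral_cong) (auto simp: nn_integral_cmult_indicator vk)
    also have "\<dots> = v * (\<integral>\<^sup>+k. F k \<partial>count_space Zlat)"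
      by (simp add: nn_integral_cmult mult.commute)
    finally show ?thesis .
  qed
  then show ?thesis using emeasure_cell[where 'a='a] unfolding v_def by blast
qed

text \<open>Comparison with the integral: the weights at the corner of a cell and at any other point
  of it differ by a bounded factor.\<close>

lemma nn_sum_Zlat_jbr_powr_finite:
  assumes t: "real DIM('a) < t"
  shows "(\<integral>\<^sup>+k. ennreal (jbr (k::'a::euclidean_space) powr (- t)) \<partial>count_space Zlat) < top"
proof -
  obtain v where v: "v \<noteq> 0" "v < top" "\<And>F :: 'a \<Rightarrow> ennreal.
     (\<integral>\<^sup>+x. F (floorv x) \<partial>lborel) = v * (\<integral>\<^sup>+k. F k \<partial>count_space Zlat)"
    using nn_integral_floorv by blast
  define c where "c = 1 + 1 * real DIM('a)"
  have c: "c > 0" by (simp add: c_def add_pos_nonneg)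
  have t0: "t > 0" using t by (smt (verit) of_nat_0_le_iff)
  have "v * (\<integral>\<^sup>+k. ennreal (jbr (k::'a) powr (- t)) \<partial>count_space Zlat)
     = (\<integral>\<^sup>+x. ennreal (jbr (floorv (x::'a)) powr (- t)) \<partial>lborel)" by (rule v(3)[symmetric])
  also have "\<dots> \<le> (\<integral>\<^sup>+x. ennreal (c powr t) * ennreal (jbr (x::'a) powr (- t)) \<partial>lborel)"
  proof (rule nn_integral_mono)
    fix x :: 'a
    have "jbr x \<le> c * jbr (floorv x)" unfolding c_def by (rule near_jbr[OF near_floorv]) simp
    then have "(c * jbr (floorv x)) powr (- t) \<le> jbr x powr (- t)"
      using t0 by (intro powr_mono2') auto
    then have "c powr t * (c powr (- t) * jbr (floorv x) powr (- t)) \<le> c powr t * jbr x powr (- t)"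
      by (intro mult_left_mono) (auto simp: powr_mult)
    then show "ennreal (jbr (floorv x) powr (- t)) \<le> ennreal (c powr t) * ennreal (jbr x powr (- t))"
      using c by (simp add: ennreal_mult[symmetric] mult.assoc[symmetric] powr_add[symmetric] ennreal_leI)
  qed
  also have "\<dots> < top"
    using nn_integral_jbr_powr_finite[OF t] by (simp add: nn_integral_cmult ennreal_mult_less_top)
  finally show ?thesis using v by (auto simp: ennreal_mult_less_top)
qed

lemma weighted_group_instances:
  assumes "(q = 1 \<and> s \<ge> 0) \<or> (1 < q \<and> s > real DIM('a) / (q / (q - 1)))"
  shows "weighted_group (lborel :: 'a::euclidean_space measure) q s"
    and "weighted_group (count_space (Zlat :: 'a set)) q s"
proof -
  have q: "1 \<le> q" using assms by auto
  have s: "0 \<le> s"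
  proof (cases "q = 1")
    case False
    then have "0 \<le> real DIM('a) / (q / (q - 1))" using assms by (intro divide_nonneg_nonneg) auto
    then show ?thesis using assms False by linarith
  qed (use assms in auto)
  \<comment> \<open>This is s > n/q' multiplied by q' = q/(q-1), the threshold of the two finiteness
    lemmas.\<close>
  have t: "real DIM('a) < s * q / (q - 1)" if "1 < q"
    using assms that by (auto simp: field_simps)
  show "weighted_group (lborel :: 'a measure) q s"
    using q s nn_integral_jbr_powr_finite[OF t]
    by unfold_locales
      (auto simp: nn_integral_lborel_shift nn_integral_lborel_reflect
        intro: sigma_finite_measure.sigma_finite_countable[OF sigma_finite_lborel])
  have "sigma_finite_measure (count_space (Zlat :: 'a set))"
    by (rule sigma_finite_measure_count_space_countable[OF countable_Zlat])
  moreover have "(\<lambda>(x, y). x - y) \<in> count_space (Zlat::'a set) \<Otimes>\<^sub>M count_space Zlat \<rightarrow>\<^sub>M count_space Zlat"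
    by (auto simp: pair_measure_countable[OF countable_Zlat countable_Zlat] Zlat_diff)
  moreover have "bij_betw (\<lambda>x. x - y) Zlat Zlat" if "y \<in> Zlat" for y :: 'a
    using that by (intro bij_betwI[of _ _ _ "\<lambda>x. x + y"]) (auto simp: Zlat_add Zlat_diff)
  moreover have "bij_betw (\<lambda>x. y - x) Zlat Zlat" if "y \<in> Zlat" for y :: 'a
    using that by (intro bij_betwI[of _ _ _ "\<lambda>x. y - x"]) (auto simp: Zlat_diff)
  ultimately show "weighted_group (count_space (Zlat :: 'a set)) q s"
    using q s nn_sum_Zlat_jbr_powr_finite[OF t]
    by (intro weighted_group.intro) (auto intro: nn_integral_bij_count_space)
qed

section \<open>Continuity of translations and approximate identities\<close>

text \<open>An epsilon argument in place of limits superior: the null majorant may depend on the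
  error allowed. The density arguments below end here.\<close>

lemma tendsto_0_ennreal_approx:
  fixes f :: "'b \<Rightarrow> ennreal"
  assumes "\<And>e::real. 0 < e \<Longrightarrow> \<exists>g. (g \<longlongrightarrow> 0) F \<and> (\<forall>n. f n \<le> g n + ennreal e)"
  shows "(f \<longlongrightarrow> 0) F"
proof (rule order_tendstoI)
  fix a :: ennreal assume "0 < a"
  then obtain m where m: "0 < m" "m < a" using dense by blast
  then obtain r where r: "m = ennreal r" "0 < r" by (cases m) auto
  obtain g where g: "(g \<longlongrightarrow> 0) F" "\<And>n. f n \<le> g n + ennreal (r/2)"
    using assms[of "r/2"] r by auto
  have "eventually (\<lambda>n. g n < ennreal (r/2)) F" using g r by (intro order_tendstoD) auto
  then show "eventually (\<lambda>n. f n < a) F"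
  proof eventually_elim
    case (elim n)
    have "f n \<le> g n + ennreal (r/2)" by (rule g)
    also have "\<dots> \<le> ennreal (r/2) + ennreal (r/2)" using elim by (intro add_right_mono) auto
    also have "\<dots> = m" using r by (simp flip: ennreal_plus)
    finally show ?case using m by simp
  qed
qed auto

lemma tendsto_0_ennreal_le:
  fixes f g :: "'b \<Rightarrow> ennreal"
  assumes "(g \<longlongrightarrow> 0) F" "\<And>n. f n \<le> g n"
  shows "(f \<longlongrightarrow> 0) F"
  by (rule tendsto_0_ennreal_approx, rule exI[of _ g])
     (use assms in \<open>auto intro: order_trans add_increasing2\<close>)

text \<open>For a function that is not integrable the left side is 0 by the convention of the
  Bochner integral. Convolutions can thus be estimated at every point, also where the defining
  integral diverges.\<close>

lemma norm_integral_le_nn: "ennreal (norm (\<integral>x. f x \<partial>M)) \<le> (\<integral>\<^sup>+x. ennreal (norm (f x)) \<partial>M)"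
  using integral_norm_bound_ennreal[of M f] not_integrable_integral_eq[of M f] by fastforce

section \<open>Affine substitutions in Lebesgue integrals\<close>

lemma lborel_integral_affine:
  fixes f :: "'a::euclidean_space \<Rightarrow> 'b::{banach, second_countable_topology}"
  assumes [measurable]: "f \<in> borel_measurable borel" and c: "c \<noteq> 0"
  shows "(\<integral>x. f x \<partial>lborel) = \<bar>c\<bar> ^ DIM('a) *\<^sub>R (\<integral>x. f (t + c *\<^sub>R x) \<partial>lborel)"
  by (subst lborel_affine[OF c, of t], subst integral_density)
     (auto simp: integral_distr)

lemma lborel_integrable_affine:
  fixes f :: "'a::euclidean_space \<Rightarrow> 'b::{banach, second_countable_topology}"
  assumes f: "integrable lborel f" and c: "c \<noteq> 0"
  shows "integrable lborel (\<lambda>x. f (t + c *\<^sub>R x))"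
proof -
  have [measurable]: "f \<in> borel_measurable borel" using f by auto
  have "integrable (density (distr lborel borel (\<lambda>x. t + c *\<^sub>R x)) (\<lambda>_. \<bar>c\<bar> ^ DIM('a))) f"
    using f lborel_affine[OF c, of t] by simp
  then have "integrable lborel (\<lambda>x. (\<bar>c\<bar> ^ DIM('a)) *\<^sub>R f (t + c *\<^sub>R x))"
    by (subst (asm) integrable_density) (auto simp: integrable_distr_eq)
  then have "integrable lborel (\<lambda>x. inverse (\<bar>c\<bar> ^ DIM('a)) *\<^sub>R (\<bar>c\<bar> ^ DIM('a)) *\<^sub>R f (t + c *\<^sub>R x))"
    by (rule integrable_scaleR_right)
  then show ?thesis using c by simp
qed

lemma lborel_integral_shift:
  fixes f :: "'a::euclidean_space \<Rightarrow> 'b::{banach, second_countable_topology}"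
  assumes "f \<in> borel_measurable borel"
  shows "(\<integral>x. f (x - y) \<partial>lborel) = (\<integral>x. f x \<partial>lborel)"
  using lborel_integral_affine[OF assms, of 1 "- y"] by (simp add: add.commute[of "- y"])

lemma lborel_integrable_shift:
  fixes f :: "'a::euclidean_space \<Rightarrow> 'b::{banach, second_countable_topology}"
  assumes "integrable lborel f"
  shows "integrable lborel (\<lambda>x. f (x - y))"
  using lborel_integrable_affine[OF assms, of 1 "- y"] by (simp add: add.commute[of "- y"])

section \<open>The L^1 modulus of continuity\<close>

definition trans_mod :: "('a::euclidean_space \<Rightarrow> 'b::{banach, second_countable_topology}) \<Rightarrow> 'a \<Rightarrow> ennreal" where
  "trans_mod g y = (\<integral>\<^sup>+x. ennreal (norm (g (x - y) - g x)) \<partial>lborel)"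

text \<open>Triangle inequality through \<open>g\<close>. The error counts twice because it also
  occurs translated, and translation preserves its integral.\<close>

lemma trans_mod_approx:
  fixes f g :: "'a::euclidean_space \<Rightarrow> 'b::{banach, second_countable_topology}"
  assumes [measurable]: "f \<in> borel_measurable borel" "g \<in> borel_measurable borel"
  shows "trans_mod f y \<le> trans_mod g y + 2 * (\<integral>\<^sup>+x. ennreal (norm (f x - g x)) \<partial>lborel)"
proof -
  have "trans_mod f y \<le> (\<integral>\<^sup>+x. ennreal (norm (f (x - y) - g (x - y))) +
      (ennreal (norm (g (x - y) - g x)) + ennreal (norm (f x - g x))) \<partial>lborel)"
    unfolding trans_mod_def
  proof (rule nn_integral_mono)
    fix x
    have "norm (f (x - y) - f x) = norm ((f (x - y) - g (x - y)) + ((g (x - y) - g x) - (f x - g x)))" by simp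
    also have "\<dots> \<le> norm (f (x - y) - g (x - y)) + (norm (g (x - y) - g x) + norm (f x - g x))"
      by (intro norm_triangle_le add_mono order_refl norm_triangle_le_diff)
    finally show "ennreal (norm (f (x - y) - f x)) \<le> ennreal (norm (f (x - y) - g (x - y))) +
      (ennreal (norm (g (x - y) - g x)) + ennreal (norm (f x - g x)))"
      by (simp add: ennreal_leI flip: ennreal_plus)
  qed
  also have "\<dots> = (\<integral>\<^sup>+x. ennreal (norm (f (x - y) - g (x - y))) \<partial>lborel) +
      (trans_mod g y + (\<integral>\<^sup>+x. ennreal (norm (f x - g x)) \<partial>lborel))"
    unfolding trans_mod_def by (simp add: nn_integral_add)
  also have "(\<integral>\<^sup>+x. ennreal (norm (f (x - y) - g (x - y))) \<partial>lborel) = (\<integral>\<^sup>+x. ennreal (norm (f x - g x)) \<partial>lborel)"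
    using nn_integral_lborel_shift[of "\<lambda>x. ennreal (norm (f x - g x))" y] by simp
  finally show ?thesis by (simp add: mult_2 ac_simps)
qed

text \<open>\<open>U\<close> and its translate have the same finite measure, so the two halves of
  their symmetric difference have equal measure. It suffices to treat the half inside
  \<open>U\<close>: it is dominated by the indicator of \<open>U\<close> and vanishes pointwise in
  the limit because \<open>U\<close> is open.\<close>

lemma trans_mod_open:
  fixes U :: "'a::euclidean_space set"
  assumes U: "open U" and fin: "emeasure lborel U < top" and Y: "Y \<longlonglongrightarrow> 0"
  shows "(\<lambda>n. trans_mod (indicator U :: 'a \<Rightarrow> real) (Y n)) \<longlonglongrightarrow> 0"
proof -
  have [measurable]: "U \<in> sets borel" using U by simp
  define I1 where "I1 y = (\<integral>\<^sup>+x. indicator U x * indicator (- U) (x - y) \<partial>lborel)" for y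
  have "trans_mod (indicator U :: 'a \<Rightarrow> real) y = 2 * I1 y" for y
  proof -
    define I2 where "I2 = (\<integral>\<^sup>+x. indicator (- U) x * indicator U (x - y) \<partial>lborel)"
    define I12 where "I12 = (\<integral>\<^sup>+x. indicator U x * indicator U (x - y) \<partial>lborel)"
    have "I1 y + I12 = (\<integral>\<^sup>+x. indicator U x \<partial>lborel)"
      unfolding I1_def I12_def by (subst nn_integral_add[symmetric], measurable, intro nn_integral_cong)
        (auto simp: indicator_def)
    moreover have "I2 + I12 = (\<integral>\<^sup>+x. indicator U (x - y) \<partial>lborel)"
      unfolding I2_def I12_def by (subst nn_integral_add[symmetric], measurable, intro nn_integral_cong)
        (auto simp: indicator_def)
    moreover have "(\<integral>\<^sup>+x. indicator U (x - y) \<partial>lborel) = (\<integral>\<^sup>+x. indicator U x \<partial>(lborel::'a measure))"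
      using nn_integral_lborel_shift[of "indicator U" y] by simp
    \<comment> \<open>Finiteness of the overlap permits its cancellation from the two equal
      sums.\<close>
    moreover have "I12 \<noteq> top"
    proof -
      have "I12 \<le> (\<integral>\<^sup>+x. indicator U x \<partial>lborel)"
        unfolding I12_def by (intro nn_integral_mono) (auto simp: indicator_def)
      then show ?thesis using fin by (auto simp: top_unique)
    qed
    ultimately have "I1 y = I2" 
      by (metis add.commute ennreal_add_left_cancel infinity_ennreal_def)
    moreover have "trans_mod (indicator U :: 'a \<Rightarrow> real) y = I1 y + I2"
      unfolding trans_mod_def I1_def I2_def by (subst nn_integral_add[symmetric], measurable, intro nn_integral_cong)
        (auto simp: indicator_def)
    ultimately show ?thesis by (simp add: mult_2)
  qed
  moreover have "(\<lambda>n. I1 (Y n)) \<longlonglongrightarrow> (\<integral>\<^sup>+x. 0 \<partial>(lborel::'a measure))"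
    unfolding I1_def
  proof (rule nn_integral_dominated_convergence[where w="indicator U"])
    show "AE x in lborel. (\<lambda>n. indicator U x * indicator (- U) (x - Y n) :: ennreal) \<longlonglongrightarrow> 0"
    proof (rule AE_I2)
      fix x
      show "(\<lambda>n. indicator U x * indicator (- U) (x - Y n) :: ennreal) \<longlonglongrightarrow> 0"
      proof (cases "x \<in> U")
        case True
        have "(\<lambda>n. x - Y n) \<longlonglongrightarrow> x" using tendsto_diff[OF tendsto_const Y, of x] by simp
        then have "eventually (\<lambda>n. x - Y n \<in> U) sequentially" using U True topological_tendstoD by blast
        then have "eventually (\<lambda>n. indicator U x * indicator (- U) (x - Y n) = (0::ennreal)) sequentially"
          by eventually_elim (auto simp: indicator_def)
        then show ?thesis by (rule tendsto_eventually)
      qed simp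
    qed
    show "(\<integral>\<^sup>+x. indicator U x \<partial>(lborel::'a measure)) < \<infinity>" using fin by simp
  qed (auto simp: indicator_def)
  then have "(\<lambda>n. 2 * I1 (Y n)) \<longlonglongrightarrow> 2 * 0"
    by (intro ennreal_tendsto_cmult) auto
  ultimately show ?thesis by simp
qed

text \<open>Induction on the integrable function. Indicators are approximated by those of open sets
  through outer regularity, the modulus is subadditive in the function, and dominated limits are L^1
  limits, which \<open>trans_mod_approx\<close> tolerates.\<close>

lemma trans_mod_tendsto_0:
  fixes g :: "'a::euclidean_space \<Rightarrow> 'b::{banach, second_countable_topology}"
  assumes g: "integrable lborel g" and Y: "Y \<longlonglongrightarrow> 0"
  shows "(\<lambda>n. trans_mod g (Y n)) \<longlonglongrightarrow> 0"
  using g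
proof induction
  case (base A c)
  have A [measurable]: "A \<in> sets borel" using base by simp
  have trans_mod_c: "trans_mod (\<lambda>x. indicator A x *\<^sub>R c) y = trans_mod (indicator A :: 'a \<Rightarrow> real) y * ennreal (norm c)" for y
  proof -
    have "trans_mod (\<lambda>x. indicator A x *\<^sub>R c) y
      = (\<integral>\<^sup>+x. ennreal (norm (indicator A (x - y) - indicator A x :: real)) * ennreal (norm c) \<partial>lborel)"
      unfolding trans_mod_def by (intro nn_integral_cong) (simp add: ennreal_mult[symmetric] scaleR_diff_left[symmetric])
    also have "\<dots> = trans_mod (indicator A :: 'a \<Rightarrow> real) y * ennreal (norm c)"
      unfolding trans_mod_def by (rule nn_integral_multc) measurable
    finally show ?thesis .
  qed
  have "(\<lambda>n. trans_mod (indicator A :: 'a \<Rightarrow> real) (Y n)) \<longlonglongrightarrow> 0"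
  proof (rule tendsto_0_ennreal_approx)
    fix e :: real assume e: "0 < e"
    obtain U where U: "open U" "A \<subseteq> U" "emeasure lborel (U - A) < ennreal (e/2)"
      using outer_regular_lborel[OF A, of "e/2"] e by auto
    have [measurable]: "U \<in> sets borel" using U by simp
    have "emeasure lborel U = emeasure lborel A + emeasure lborel (U - A)"
      using U by (subst plus_emeasure) (auto intro!: arg_cong[where f="emeasure lborel"])
    also have "\<dots> < top" using base U by (auto simp: less_top[symmetric] top_unique)
    finally have fin: "emeasure lborel U < top" .
    have "(\<integral>\<^sup>+x. ennreal (norm (indicator A x - indicator U x :: real)) \<partial>lborel) = (\<integral>\<^sup>+x. indicator (U - A) x \<partial>lborel)"
      using U by (intro nn_integral_cong) (auto simp: indicator_def)
    then have "2 * (\<integral>\<^sup>+x. ennreal (norm (indicator A x - indicator U x :: real)) \<partial>lborel) \<le> 2 * ennreal (e/2)"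
      using U by (intro mult_left_mono) auto
    also have "\<dots> = ennreal e" using e by (simp flip: ennreal_plus add: mult_2)
    finally have "trans_mod (indicator A :: 'a \<Rightarrow> real) y \<le> trans_mod (indicator U :: 'a \<Rightarrow> real) y + ennreal e" for y
      using trans_mod_approx[of "indicator A :: 'a \<Rightarrow> real" "indicator U" y]
      by (auto intro: order_trans add_left_mono)
    then show "\<exists>g. g \<longlonglongrightarrow> 0 \<and> (\<forall>n. trans_mod (indicator A :: 'a \<Rightarrow> real) (Y n) \<le> g n + ennreal e)"
      using trans_mod_open[OF U(1) fin Y] by (intro exI[of _ "\<lambda>n. trans_mod (indicator U :: 'a \<Rightarrow> real) (Y n)"]) auto
  qed
  then have "(\<lambda>n. ennreal (norm c) * trans_mod (indicator A :: 'a \<Rightarrow> real) (Y n)) \<longlonglongrightarrow> ennreal (norm c) * 0"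
    by (intro ennreal_tendsto_cmult) auto
  then show ?case by (simp add: trans_mod_c mult.commute)
next
  case (add f g)
  have [measurable]: "f \<in> borel_measurable borel" "g \<in> borel_measurable borel" using add by auto
  have "trans_mod (\<lambda>x. f x + g x) y \<le> trans_mod f y + trans_mod g y" for y
  proof -
    have "trans_mod (\<lambda>x. f x + g x) y \<le> (\<integral>\<^sup>+x. ennreal (norm (f (x - y) - f x)) + ennreal (norm (g (x - y) - g x)) \<partial>lborel)"
      unfolding trans_mod_def
    proof (rule nn_integral_mono)
      fix x
      have "norm (f (x - y) + g (x - y) - (f x + g x)) \<le> norm (f (x - y) - f x) + norm (g (x - y) - g x)"
        by (metis add_diff_add norm_triangle_ineq)
      then show "ennreal (norm (f (x - y) + g (x - y) - (f x + g x)))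
        \<le> ennreal (norm (f (x - y) - f x)) + ennreal (norm (g (x - y) - g x))"
        by (simp flip: ennreal_plus add: ennreal_leI)
    qed
    then show ?thesis unfolding trans_mod_def by (simp add: nn_integral_add)
  qed
  note le = this
  have "(\<lambda>n. trans_mod f (Y n) + trans_mod g (Y n)) \<longlonglongrightarrow> 0"
    using tendsto_add[OF add.IH] by simp
  then show ?case by (rule tendsto_0_ennreal_le) (rule le)
next
  case (lim f s)
  have [measurable]: "f \<in> borel_measurable borel" "s i \<in> borel_measurable borel" for i using lim by auto
  have L: "(\<lambda>i. \<integral>\<^sup>+x. ennreal (norm (f x - s i x)) \<partial>lborel) \<longlonglongrightarrow> 0"
  proof (rule nn_integral_dominated_convergence_norm[where w="\<lambda>x. 2 * norm (f x)"])
    show "(\<integral>\<^sup>+x. ennreal (2 * norm (f x)) \<partial>lborel) < \<infinity>"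
      using \<open>integrable lborel f\<close> by (simp add: integrable_iff_bounded ennreal_mult nn_integral_cmult ennreal_mult_less_top)
  qed (use lim in auto)
  show ?case
  proof (rule tendsto_0_ennreal_approx)
    fix e :: real assume e: "0 < e"
    have "eventually (\<lambda>i. (\<integral>\<^sup>+x. ennreal (norm (f x - s i x)) \<partial>lborel) < ennreal (e/2)) sequentially"
      using L e by (intro order_tendstoD) auto
    then obtain i where i: "(\<integral>\<^sup>+x. ennreal (norm (f x - s i x)) \<partial>lborel) < ennreal (e/2)"
      by (auto simp: eventually_sequentially)
    then have "2 * (\<integral>\<^sup>+x. ennreal (norm (f x - s i x)) \<partial>lborel) \<le> 2 * ennreal (e/2)"
      by (intro mult_left_mono) auto
    also have "\<dots> = ennreal e" using e by (simp flip: ennreal_plus add: mult_2)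
    finally have "trans_mod f y \<le> trans_mod (s i) y + ennreal e" for y
      using trans_mod_approx[of f "s i" y] by (auto intro: order_trans add_left_mono)
    then show "\<exists>g. g \<longlonglongrightarrow> 0 \<and> (\<forall>n. trans_mod f (Y n) \<le> g n + ennreal e)"
      using lim.IH by (intro exI[of _ "\<lambda>n. trans_mod (s i) (Y n)"]) auto
  qed
qed

section \<open>Convolution, dilation and approximate identities in L^1\<close>

definition conv :: "('a::euclidean_space \<Rightarrow> complex) \<Rightarrow> ('a \<Rightarrow> complex) \<Rightarrow> 'a \<Rightarrow> complex" where
  "conv a g x = (\<integral>y. a y * g (x - y) \<partial>lborel)"

lemma conv_measurable [measurable]:
  assumes [measurable]: "a \<in> borel_measurable borel" "g \<in> borel_measurable borel"
  shows "conv a g \<in> borel_measurable borel"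
  unfolding conv_def[abs_def] by measurable

lemma norm_conv_le: "ennreal (cmod (conv a g x)) \<le> (\<integral>\<^sup>+y. ennreal (cmod (a y)) * ennreal (cmod (g (x - y))) \<partial>lborel)"
  unfolding conv_def using norm_integral_le_nn[of lborel "\<lambda>y. a y * g (x - y)"]
  by (simp add: norm_mult ennreal_mult)

lemma nn_integral_lborel_Fubini:
  fixes f :: "'a::euclidean_space \<Rightarrow> 'a \<Rightarrow> ennreal"
  assumes "case_prod f \<in> borel_measurable (borel \<Otimes>\<^sub>M borel)"
  shows "(\<integral>\<^sup>+y. (\<integral>\<^sup>+x. f x y \<partial>lborel) \<partial>lborel) = (\<integral>\<^sup>+x. (\<integral>\<^sup>+y. f x y \<partial>lborel) \<partial>lborel)"
  using lborel_pair.Fubini'[of f] assms by simp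

text \<open>The bounded factor \<open>B\<close> lets one justification of Fubini serve several
  integrals: a character in \<open>ft_conv\<close>, a window times a character in
  \<open>norm_pc_conv_le\<close>.\<close>

lemma integrable_conv_pair:
  assumes a: "integrable lborel a" and g: "integrable lborel (g :: 'a::euclidean_space \<Rightarrow> complex)"
    and B [measurable]: "case_prod B \<in> borel_measurable (borel \<Otimes>\<^sub>M borel)" and Bb: "\<And>x y. cmod (B x y) \<le> K"
  shows "integrable (lborel \<Otimes>\<^sub>M lborel) (\<lambda>(x, y). a y * g (x - y) * B x y)"
proof (rule integrableI_bounded)
  have [measurable]: "a \<in> borel_measurable borel" "g \<in> borel_measurable borel" using a g by auto
  show "(\<lambda>(x, y). a y * g (x - y) * B x y) \<in> borel_measurable (lborel \<Otimes>\<^sub>M lborel)"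
    by measurable
  have K: "0 \<le> K" using Bb[of undefined undefined] norm_ge_zero order_trans by blast
  have "(\<integral>\<^sup>+z. ennreal (cmod (case z of (x, y) \<Rightarrow> a y * g (x - y) * B x y)) \<partial>(lborel \<Otimes>\<^sub>M lborel))
     \<le> (\<integral>\<^sup>+z. (case z of (x, y) \<Rightarrow> ennreal (cmod (a y)) * ennreal (cmod (g (x - y))) * ennreal K) \<partial>(lborel \<Otimes>\<^sub>M lborel))"
    using K by (intro nn_integral_mono)
      (auto simp: norm_mult ennreal_mult[symmetric] intro!: ennreal_leI mult_left_mono Bb split: prod.split)
  also have "\<dots> = (\<integral>\<^sup>+x. (\<integral>\<^sup>+y. ennreal (cmod (a y)) * ennreal (cmod (g (x - y))) * ennreal K \<partial>lborel) \<partial>lborel)"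
    by (subst lborel.nn_integral_fst[symmetric]) simp_all
  also have "\<dots> = (\<integral>\<^sup>+y. (\<integral>\<^sup>+x. ennreal (cmod (a y)) * ennreal (cmod (g (x - y))) * ennreal K \<partial>lborel) \<partial>lborel)"
    by (rule nn_integral_lborel_Fubini[symmetric]) measurable
  also have "\<dots> = (\<integral>\<^sup>+y. ennreal (cmod (a y)) * (\<integral>\<^sup>+x. ennreal (cmod (g x)) \<partial>lborel) * ennreal K \<partial>lborel)"
  proof (intro nn_integral_cong)
    fix y
    have "(\<integral>\<^sup>+x. ennreal (cmod (g (x - y))) \<partial>lborel) = (\<integral>\<^sup>+x. ennreal (cmod (g x)) \<partial>lborel)"
      by (rule nn_integral_lborel_shift[of "\<lambda>x. ennreal (cmod (g x))" y]) measurable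
    then show "(\<integral>\<^sup>+x. ennreal (cmod (a y)) * ennreal (cmod (g (x - y))) * ennreal K \<partial>lborel)
       = ennreal (cmod (a y)) * (\<integral>\<^sup>+x. ennreal (cmod (g x)) \<partial>lborel) * ennreal K"
      by (simp add: nn_integral_cmult nn_integral_multc)
  qed
  also have "\<dots> = (\<integral>\<^sup>+y. ennreal (cmod (a y)) \<partial>lborel) * (\<integral>\<^sup>+x. ennreal (cmod (g x)) \<partial>lborel) * ennreal K"
    by (simp add: nn_integral_multc)
  also have "\<dots> < \<infinity>"
    using a g by (simp add: integrable_iff_bounded ennreal_mult_less_top)
  finally show "(\<integral>\<^sup>+z. ennreal (cmod (case z of (x, y) \<Rightarrow> a y * g (x - y) * B x y)) \<partial>(lborel \<Otimes>\<^sub>M lborel)) < \<infinity>" .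
qed

lemma integrable_conv_pair':
  assumes "integrable lborel a" and "integrable lborel (g :: 'a::euclidean_space \<Rightarrow> complex)"
  shows "integrable (lborel \<Otimes>\<^sub>M lborel) (\<lambda>(x, y). a y * g (x - y))"
  using integrable_conv_pair[OF assms, of "\<lambda>_ _. 1" 1] by simp

lemma integrable_conv:
  assumes "integrable lborel a" "integrable lborel g"
  shows "integrable lborel (conv a g)"
  using lborel_pair.integrable_fst'[OF integrable_conv_pair'[OF assms]]
  by (simp add: conv_def[abs_def])

lemma AE_integrable_conv:
  assumes "integrable lborel a" "integrable lborel (g :: 'a::euclidean_space \<Rightarrow> complex)"
  shows "AE x in lborel. integrable lborel (\<lambda>y. a y * g (x - y))"
  using lborel_pair.AE_integrable_fst'[OF integrable_conv_pair'[OF assms]] by simp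

text \<open>Linearity may fail on the null set where one of the convolution integrals diverges,
  hence the almost everywhere form.\<close>

lemma conv_diff_right:
  assumes "integrable lborel a" "integrable lborel g" "integrable lborel h"
  shows "AE x in lborel. conv a (\<lambda>z. g z - h z) x = conv a g x - conv a h x"
  using AE_integrable_conv[OF assms(1,2)] AE_integrable_conv[OF assms(1,3)]
  by eventually_elim (simp add: conv_def right_diff_distrib)

text \<open>Normalised to preserve the integral; increasing r concentrates the mass at 0.\<close>

definition dilate :: "real \<Rightarrow> ('a::euclidean_space \<Rightarrow> complex) \<Rightarrow> 'a \<Rightarrow> complex" where
  "dilate r K x = complex_of_real (r ^ DIM('a)) * K (r *\<^sub>R x)"

lemma dilate_measurable [measurable]:
  assumes [measurable]: "K \<in> borel_measurable borel"
  shows "dilate r K \<in> borel_measurable borel"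
  unfolding dilate_def[abs_def] by measurable

lemma integrable_dilate: "integrable lborel K \<Longrightarrow> 0 < r \<Longrightarrow> integrable lborel (dilate r K)"
  unfolding dilate_def[abs_def] using lborel_integrable_affine[of K r 0] by simp

lemma integral_dilate:
  fixes K F :: "'a::euclidean_space \<Rightarrow> complex"
  assumes [measurable]: "K \<in> borel_measurable borel" "F \<in> borel_measurable borel" and r: "0 < r"
  shows "(\<integral>y. dilate r K y * F y \<partial>lborel) = (\<integral>z. K z * F (z /\<^sub>R r) \<partial>lborel)"
proof -
  have "(\<integral>z. K z * F (z /\<^sub>R r) \<partial>lborel) = \<bar>r\<bar> ^ DIM('a) *\<^sub>R (\<integral>z. K (0 + r *\<^sub>R z) * F ((0 + r *\<^sub>R z) /\<^sub>R r) \<partial>lborel)"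
    using r by (intro lborel_integral_affine) auto
  also have "\<dots> = (\<integral>y. dilate r K y * F y \<partial>lborel)"
    using r by (simp add: dilate_def scaleR_conv_of_real mult.assoc)
  finally show ?thesis by simp
qed

lemma conv_dilate:
  fixes K g :: "'a::euclidean_space \<Rightarrow> complex"
  assumes [measurable]: "K \<in> borel_measurable borel" "g \<in> borel_measurable borel" and r: "0 < r"
  shows "conv (dilate r K) g x = (\<integral>z. K z * g (x - z /\<^sub>R r) \<partial>lborel)"
  unfolding conv_def using integral_dilate[of K "\<lambda>y. g (x - y)" r] r by simp

text \<open>After rescaling, the error at x is the integral of K z (g (x - z/r) - g x), so its L^1
  norm is at most the integral of |K z| times the modulus of continuity of \<open>g\<close> at z/r.
  This tends to 0 pointwise and is dominated by 2 |K z| times the norm of \<open>g\<close>. The mean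
  of \<open>K\<close> is left general because the kernel in \<open>ft_inversion\<close> is not
  normalised.\<close>

lemma approximate_identity:
  fixes K g :: "'a::euclidean_space \<Rightarrow> complex"
  assumes K: "integrable lborel K" and g: "integrable lborel g"
  shows "(\<lambda>j. \<integral>\<^sup>+x. ennreal (cmod (conv (dilate (real (Suc j)) K) g x - (\<integral>z. K z \<partial>lborel) * g x)) \<partial>lborel) \<longlonglongrightarrow> 0"
proof -
  have [measurable]: "K \<in> borel_measurable borel" "g \<in> borel_measurable borel" using K g by auto
  define G where "G = (\<integral>\<^sup>+x. ennreal (cmod (g x)) \<partial>lborel)"
  have G: "G < top" using g by (simp add: G_def integrable_iff_bounded)
  have trans_mod_meas [measurable]: "trans_mod g \<in> borel_measurable borel" unfolding trans_mod_def[abs_def] by measurable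
  have trans_mod_le: "trans_mod g y \<le> 2 * G" for y
    using trans_mod_approx[of g "\<lambda>_. 0" y] by (simp add: trans_mod_def G_def)
  define r where "r j = real (Suc j)" for j
  have r: "r j > 0" for j by (simp add: r_def)
  have lim: "(\<lambda>j. \<integral>\<^sup>+z. ennreal (cmod (K z)) * trans_mod g (z /\<^sub>R r j) \<partial>lborel) \<longlonglongrightarrow> (\<integral>\<^sup>+z. 0 \<partial>(lborel :: 'a measure))"
  proof (rule nn_integral_dominated_convergence[where w="\<lambda>z. ennreal (cmod (K z)) * (2 * G)"])
    show "(\<integral>\<^sup>+z. ennreal (cmod (K z)) * (2 * G) \<partial>lborel) < \<infinity>"
      using K G by (simp add: nn_integral_multc integrable_iff_bounded ennreal_mult_less_top)
    show "AE z in lborel. (\<lambda>j. ennreal (cmod (K z)) * trans_mod g (z /\<^sub>R r j)) \<longlonglongrightarrow> 0"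
    proof (rule AE_I2)
      fix z :: 'a
      have "(\<lambda>j. inverse (r j) *\<^sub>R z) \<longlonglongrightarrow> 0 *\<^sub>R z"
        unfolding r_def by (intro tendsto_intros LIMSEQ_inverse_real_of_nat)
      then have "(\<lambda>j. trans_mod g (z /\<^sub>R r j)) \<longlonglongrightarrow> 0" using trans_mod_tendsto_0[OF g] by simp
      then have "(\<lambda>j. ennreal (cmod (K z)) * trans_mod g (z /\<^sub>R r j)) \<longlonglongrightarrow> ennreal (cmod (K z)) * 0"
        by (intro ennreal_tendsto_cmult) auto
      then show "(\<lambda>j. ennreal (cmod (K z)) * trans_mod g (z /\<^sub>R r j)) \<longlonglongrightarrow> 0" by simp
    qed
  qed (auto intro!: mult_left_mono trans_mod_le)
  have "(\<integral>\<^sup>+x. ennreal (cmod (conv (dilate (r j) K) g x - (\<integral>z. K z \<partial>lborel) * g x)) \<partial>lborel)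
     \<le> (\<integral>\<^sup>+z. ennreal (cmod (K z)) * trans_mod g (z /\<^sub>R r j) \<partial>lborel)" for j
  proof -
    have "AE x in lborel. ennreal (cmod (conv (dilate (r j) K) g x - (\<integral>z. K z \<partial>lborel) * g x))
       \<le> (\<integral>\<^sup>+z. ennreal (cmod (K z)) * ennreal (cmod (g (x - z /\<^sub>R r j) - g x)) \<partial>lborel)"
      using AE_integrable_conv[OF integrable_dilate[OF K r] g, of j]
    proof eventually_elim
      case (elim x)
      \<comment> \<open>Integrability in y, known for almost every x, is carried to z = r y by an
        affine substitution; it permits splitting the integral of the difference.\<close>
      have "integrable lborel (\<lambda>z. dilate (r j) K (0 + inverse (r j) *\<^sub>R z) * g (x - (0 + inverse (r j) *\<^sub>R z)))"
        using r[of j] by (intro lborel_integrable_affine[OF elim]) auto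
      then have "integrable lborel (\<lambda>z. complex_of_real (r j ^ DIM('a)) * (K z * g (x - z /\<^sub>R r j)))"
        using r[of j] by (simp add: dilate_def mult.assoc)
      then have i: "integrable lborel (\<lambda>z. K z * g (x - z /\<^sub>R r j))"
        using r[of j] integrable_mult_right[of "inverse (complex_of_real (r j ^ DIM('a)))" lborel
          "\<lambda>z. complex_of_real (r j ^ DIM('a)) * (K z * g (x - z /\<^sub>R r j))"]
        by (simp add: mult.assoc[symmetric])
      have "conv (dilate (r j) K) g x - (\<integral>z. K z \<partial>lborel) * g x = (\<integral>z. K z * (g (x - z /\<^sub>R r j) - g x) \<partial>lborel)"
        using i K r[of j] by (simp add: conv_dilate right_diff_distrib)
      then show ?case
        using norm_integral_le_nn[of lborel "\<lambda>z. K z * (g (x - z /\<^sub>R r j) - g x)"]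
        by (simp add: norm_mult ennreal_mult)
    qed
    then have "(\<integral>\<^sup>+x. ennreal (cmod (conv (dilate (r j) K) g x - (\<integral>z. K z \<partial>lborel) * g x)) \<partial>lborel)
       \<le> (\<integral>\<^sup>+x. (\<integral>\<^sup>+z. ennreal (cmod (K z)) * ennreal (cmod (g (x - z /\<^sub>R r j) - g x)) \<partial>lborel) \<partial>lborel)"
      by (rule nn_integral_mono_AE)
    also have "\<dots> = (\<integral>\<^sup>+z. (\<integral>\<^sup>+x. ennreal (cmod (K z)) * ennreal (cmod (g (x - z /\<^sub>R r j) - g x)) \<partial>lborel) \<partial>lborel)"
      by (rule nn_integral_lborel_Fubini[symmetric]) measurable
    also have "\<dots> = (\<integral>\<^sup>+z. ennreal (cmod (K z)) * trans_mod g (z /\<^sub>R r j) \<partial>lborel)"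
      unfolding trans_mod_def by (simp add: nn_integral_cmult)
    finally show ?thesis .
  qed
  note le = this
  have "(\<lambda>j. \<integral>\<^sup>+z. ennreal (cmod (K z)) * trans_mod g (z /\<^sub>R r j) \<partial>lborel) \<longlonglongrightarrow> 0"
    using lim by simp
  then have "(\<lambda>j. \<integral>\<^sup>+x. ennreal (cmod (conv (dilate (r j) K) g x - (\<integral>z. K z \<partial>lborel) * g x)) \<partial>lborel) \<longlonglongrightarrow> 0"
    by (rule tendsto_0_ennreal_le) (rule le)
  then show ?thesis unfolding r_def .
qed

section \<open>The Fourier integral\<close>

text \<open>The inverse transform without its constant: a function with Fourier transform
  \<open>g\<close> is a multiple of \<open>ft g\<close>. Using \<open>ft\<close> in both directions
  postpones the powers of 2 pi.\<close>

definition ft :: "('a::euclidean_space \<Rightarrow> complex) \<Rightarrow> 'a \<Rightarrow> complex" where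
  "ft g x = (\<integral>\<xi>. g \<xi> * cis (x \<bullet> \<xi>) \<partial>lborel)"

lemma cis_measurable [measurable (raw)]:
  "f \<in> borel_measurable M \<Longrightarrow> (\<lambda>x. cis (f x)) \<in> borel_measurable M"
  by (rule measurable_compose[of f M borel cis])
     (auto intro!: borel_measurable_continuous_onI continuous_on_cis continuous_on_id)

lemma cnj_measurable [measurable (raw)]:
  "f \<in> borel_measurable M \<Longrightarrow> (\<lambda>x. cnj (f x)) \<in> borel_measurable M"
  by (rule measurable_compose[of f M borel cnj])
     (auto intro!: borel_measurable_continuous_onI continuous_on_cnj continuous_on_id)

lemma ft_measurable [measurable]:
  assumes [measurable]: "g \<in> borel_measurable borel"
  shows "ft g \<in> borel_measurable borel"
  unfolding ft_def[abs_def] by measurable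

lemma integrable_mult_bounded:
  fixes f h :: "'a \<Rightarrow> complex"
  assumes "integrable M f" "h \<in> borel_measurable M" "\<And>x. cmod (h x) \<le> K"
  shows "integrable M (\<lambda>x. f x * h x)" "integrable M (\<lambda>x. h x * f x)"
proof -
  have K: "0 \<le> K" using assms(3)[of undefined] norm_ge_zero order_trans by blast
  show "integrable M (\<lambda>x. f x * h x)"
  proof (rule Bochner_Integration.integrable_bound[where f="\<lambda>x. K * cmod (f x)"])
    show "AE x in M. norm (f x * h x) \<le> norm (K * cmod (f x))"
      using assms(3) K by (auto simp: norm_mult mult.commute[of "cmod (f _)"] intro!: AE_I2 mult_right_mono)
  qed (use assms in auto)
  then show "integrable M (\<lambda>x. h x * f x)" by (simp add: mult.commute)
qed

lemma integrable_cis: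
  fixes g :: "'a::euclidean_space \<Rightarrow> complex"
  shows "integrable lborel g \<Longrightarrow> integrable lborel (\<lambda>\<xi>. g \<xi> * cis (x \<bullet> \<xi>))"
  by (rule integrable_mult_bounded[where K=1]) auto

lemma norm_ft_le: "cmod (ft g x) \<le> (\<integral>\<xi>. cmod (g \<xi>) \<partial>lborel)"
  unfolding ft_def using integral_norm_bound[of lborel "\<lambda>\<xi>. g \<xi> * cis (x \<bullet> \<xi>)"]
  by (simp add: norm_mult)

lemma ft_cong_AE:
  assumes [measurable]: "g \<in> borel_measurable borel" "h \<in> borel_measurable borel"
    and "AE x in lborel. g x = h x"
  shows "ft g = ft h"
  unfolding ft_def using assms(3) by (intro ext integral_cong_AE) (auto elim: eventually_mono)

lemma ft_add: "integrable lborel g \<Longrightarrow> integrable lborel h \<Longrightarrow> ft (\<lambda>x. g x + h x) y = ft g y + ft h y"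
  unfolding ft_def by (simp add: distrib_right integrable_cis)

lemma ft_diff: "integrable lborel g \<Longrightarrow> integrable lborel h \<Longrightarrow> ft (\<lambda>x. g x - h x) y = ft g y - ft h y"
  unfolding ft_def by (simp add: left_diff_distrib integrable_cis)

lemma ft_cmult: "ft (\<lambda>x. c * g x) y = c * ft g y"
  unfolding ft_def by (simp add: mult.assoc)

lemma ft_sum: "(\<And>i. i \<in> I \<Longrightarrow> integrable lborel (g i)) \<Longrightarrow> ft (\<lambda>x. \<Sum>i\<in>I. g i x) y = (\<Sum>i\<in>I. ft (g i) y)"
  unfolding ft_def by (simp add: sum_distrib_right integrable_cis)

lemma ft_translate:
  assumes [measurable]: "g \<in> borel_measurable borel"
  shows "ft (\<lambda>\<xi>. g (\<xi> - \<zeta>)) x = cis (x \<bullet> \<zeta>) * ft g x"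
proof -
  have "ft (\<lambda>\<xi>. g (\<xi> - \<zeta>)) x = (\<integral>\<xi>. cis (x \<bullet> \<zeta>) * (g (\<xi> - \<zeta>) * cis (x \<bullet> (\<xi> - \<zeta>))) \<partial>lborel)"
    unfolding ft_def by (intro Bochner_Integration.integral_cong)
      (auto simp: inner_diff_right cis_mult[symmetric] cis_divide[symmetric])
  also have "\<dots> = cis (x \<bullet> \<zeta>) * (\<integral>\<xi>. g (\<xi> - \<zeta>) * cis (x \<bullet> (\<xi> - \<zeta>)) \<partial>lborel)" by simp
  also have "(\<integral>\<xi>. g (\<xi> - \<zeta>) * cis (x \<bullet> (\<xi> - \<zeta>)) \<partial>lborel) = ft g x"
    unfolding ft_def by (rule lborel_integral_shift[of "\<lambda>\<xi>. g \<xi> * cis (x \<bullet> \<xi>)" \<zeta>]) measurable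
  finally show ?thesis .
qed

lemma ft_conv:
  fixes a g :: "'a::euclidean_space \<Rightarrow> complex"
  assumes a: "integrable lborel a" and g: "integrable lborel g"
  shows "ft (conv a g) x = ft a x * ft g x"
proof -
  have [measurable]: "a \<in> borel_measurable borel" "g \<in> borel_measurable borel" using a g by auto
  have "ft (conv a g) x = (\<integral>\<xi>. (\<integral>\<eta>. a \<eta> * g (\<xi> - \<eta>) * cis (x \<bullet> \<xi>) \<partial>lborel) \<partial>lborel)"
    unfolding ft_def conv_def by simp
  also have "\<dots> = (\<integral>\<eta>. (\<integral>\<xi>. a \<eta> * g (\<xi> - \<eta>) * cis (x \<bullet> \<xi>) \<partial>lborel) \<partial>lborel)"
    by (rule lborel_pair.Fubini_integral[symmetric])
       (use integrable_conv_pair[OF a g, of "\<lambda>\<xi> \<eta>. cis (x \<bullet> \<xi>)" 1] in simp)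
  also have "\<dots> = (\<integral>\<eta>. a \<eta> * cis (x \<bullet> \<eta>) * ft g x \<partial>lborel)"
    using ft_translate[of g _ x] by (simp add: mult.assoc flip: ft_def)
  also have "\<dots> = ft a x * ft g x" unfolding ft_def by simp
  finally show ?thesis .
qed

lemma isCont_ft:
  fixes g :: "'a::euclidean_space \<Rightarrow> complex"
  assumes g: "integrable lborel g"
  shows "isCont (ft g) x"
  unfolding continuous_at_sequentially comp_def
proof (intro allI impI)
  fix X assume X: "X \<longlonglongrightarrow> x"
  have [measurable]: "g \<in> borel_measurable borel" using g by auto
  show "(\<lambda>n. ft g (X n)) \<longlonglongrightarrow> ft g x"
    unfolding ft_def
  proof (rule integral_dominated_convergence[where w="\<lambda>\<xi>. cmod (g \<xi>)"])
    show "AE \<xi> in lborel. (\<lambda>n. g \<xi> * cis (X n \<bullet> \<xi>)) \<longlonglongrightarrow> g \<xi> * cis (x \<bullet> \<xi>)"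
      using X by (intro AE_I2 tendsto_intros)
  qed (use g in \<open>auto simp: norm_mult\<close>)
qed

lemma integrable_pair_product:
  fixes f h :: "'a::euclidean_space \<Rightarrow> complex"
  assumes f: "integrable lborel f" and h: "integrable lborel h"
    and B [measurable]: "case_prod B \<in> borel_measurable (borel \<Otimes>\<^sub>M borel)" and Bb: "\<And>x y. cmod (B x y) \<le> 1"
  shows "integrable (lborel \<Otimes>\<^sub>M lborel) (\<lambda>(x, y). f x * h y * B x y)"
proof (rule integrableI_bounded)
  have [measurable]: "f \<in> borel_measurable borel" "h \<in> borel_measurable borel" using f h by auto
  show "(\<lambda>(x, y). f x * h y * B x y) \<in> borel_measurable (lborel \<Otimes>\<^sub>M lborel)"
    by measurable
  have "(\<integral>\<^sup>+z. ennreal (cmod (case z of (x, y) \<Rightarrow> f x * h y * B x y)) \<partial>(lborel \<Otimes>\<^sub>M lborel))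
     \<le> (\<integral>\<^sup>+z. (case z of (x, y) \<Rightarrow> ennreal (cmod (f x)) * ennreal (cmod (h y))) \<partial>(lborel \<Otimes>\<^sub>M lborel))"
    using Bb by (intro nn_integral_mono)
      (auto simp: norm_mult ennreal_mult[symmetric] intro!: ennreal_leI mult_left_le split: prod.split)
  also have "\<dots> = (\<integral>\<^sup>+x. (\<integral>\<^sup>+y. ennreal (cmod (f x)) * ennreal (cmod (h y)) \<partial>lborel) \<partial>lborel)"
    by (subst lborel.nn_integral_fst[symmetric]) simp_all
  also have "\<dots> = (\<integral>\<^sup>+x. ennreal (cmod (f x)) \<partial>lborel) * (\<integral>\<^sup>+x. ennreal (cmod (h x)) \<partial>lborel)"
    by (simp add: nn_integral_multc nn_integral_cmult)
  also have "\<dots> < \<infinity>"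
    using f h by (simp add: integrable_iff_bounded ennreal_mult_less_top)
  finally show "(\<integral>\<^sup>+z. ennreal (cmod (case z of (x, y) \<Rightarrow> f x * h y * B x y)) \<partial>(lborel \<Otimes>\<^sub>M lborel)) < \<infinity>" .
qed

lemma AE_lborel_open_nonempty:
  assumes "open U" "x \<in> (U :: 'a::euclidean_space set)"
  shows "\<not> (AE x in lborel. x \<notin> U)"
proof
  assume ae: "AE x in lborel. x \<notin> U"
  obtain e where e: "e > 0" "ball x e \<subseteq> U" using assms openE by blast
  have "U \<in> null_sets lborel"
    using ae assms(1) by (subst AE_iff_null_sets[of U lborel]) auto
  then have "emeasure lborel (ball x e) \<le> 0"
    using emeasure_mono[OF e(2), of lborel] assms(1) by auto
  then show False using e(1) unit_ball_vol_pos[of "real DIM('a)"]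
    by (auto simp: emeasure_ball ennreal_mult[symmetric])
qed

text \<open>The kernel of the approximate identity is \<open>K = |ft \<phi>|\<^sup>2 = ft \<kappa>\<close>, the Fourier integral of
  the autocorrelation \<open>\<kappa>\<close> of \<open>\<phi>\<close>. Dilated convolutions of \<open>g\<close> with \<open>K\<close> converge in mean to
  \<open>(\<integral>K) g\<close> and, by Fubini, pointwise to \<open>\<kappa> 0\<close> times the double Fourier integral of \<open>g\<close>. The value
  of the constant is never needed.\<close>

lemma ft_inversion:
  fixes \<phi> :: "'a::euclidean_space \<Rightarrow> complex"
  assumes \<phi>: "integrable lborel \<phi>" and B: "\<And>x. cmod (\<phi> x) \<le> B" and cont: "continuous_on UNIV \<phi>"
    and ft\<phi>: "integrable lborel (ft \<phi>)" and nz: "(\<integral>x. \<phi> x \<partial>lborel) \<noteq> 0"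
  shows "\<exists>c. \<forall>g :: 'a \<Rightarrow> complex. integrable lborel g \<longrightarrow> integrable lborel (ft g) \<longrightarrow>
     (AE y in lborel. g y = c * ft (\<lambda>\<eta>. ft g (- \<eta>)) y)"
proof -
  have [measurable]: "\<phi> \<in> borel_measurable borel" using \<phi> by auto
  \<comment> \<open>The conjugate reflection: \<open>ft \<phi>'\<close> is the conjugate of
    \<open>ft \<phi>\<close>, which makes the transform of the autocorrelation nonnegative.\<close>
  define \<phi>' where "\<phi>' \<eta> = cnj (\<phi> (- \<eta>))" for \<eta>
  have [measurable]: "\<phi>' \<in> borel_measurable borel" unfolding \<phi>'_def[abs_def] by measurable
  have \<phi>': "integrable lborel \<phi>'"
    using lborel_integrable_affine[OF \<phi>, of "-1" 0] unfolding \<phi>'_def[abs_def] by simp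
  have ft\<phi>': "ft \<phi>' x = cnj (ft \<phi> x)" for x
  proof -
    have "ft \<phi>' x = (\<integral>\<eta>. \<phi>' (0 + (-1) *\<^sub>R \<eta>) * cis (x \<bullet> (0 + (-1) *\<^sub>R \<eta>)) \<partial>lborel)"
      unfolding ft_def by (subst lborel_integral_affine[of _ "-1" 0]) auto
    also have "\<dots> = (\<integral>\<eta>. cnj (\<phi> \<eta> * cis (x \<bullet> \<eta>)) \<partial>lborel)"
      by (intro Bochner_Integration.integral_cong) (auto simp: \<phi>'_def cis_cnj)
    also have "\<dots> = cnj (ft \<phi> x)" unfolding ft_def by (rule Bochner_Integration.integral_cnj)
    finally show ?thesis .
  qed
  define \<kappa> where "\<kappa> = conv \<phi> \<phi>'"
  have \<kappa>: "integrable lborel \<kappa>" unfolding \<kappa>_def by (rule integrable_conv[OF \<phi> \<phi>'])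
  then have [measurable]: "\<kappa> \<in> borel_measurable borel" by auto
  define N where "N = (\<integral>x. cmod (\<phi> x) \<partial>lborel)"
  define K where "K x = ft \<phi> x * cnj (ft \<phi> x)" for x
  have K_ft: "K = ft \<kappa>" unfolding K_def \<kappa>_def ft_conv[OF \<phi> \<phi>'] ft\<phi>' ..
  have ftmeas: "(\<lambda>x. cnj (ft \<phi> x)) \<in> borel_measurable lborel" by measurable
  have K: "integrable lborel K" unfolding K_def
    by (rule integrable_mult_bounded[OF ft\<phi> ftmeas, of N]) (simp add: N_def norm_ft_le)
  have [measurable]: "K \<in> borel_measurable borel" using K by auto
  have \<kappa>B: "cmod (\<kappa> x) \<le> N * B" for x
  proof -
    have "cmod (\<kappa> x) \<le> (\<integral>y. cmod (\<phi> y) * B \<partial>lborel)"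
      unfolding \<kappa>_def conv_def
    proof (rule Bochner_Integration.integral_norm_bound_integral)
      show "integrable lborel (\<lambda>y. \<phi> y * \<phi>' (x - y))"
        by (rule integrable_mult_bounded[OF \<phi>, of _ B]) (auto simp: \<phi>'_def B)
    qed (use \<phi> B in \<open>auto simp: norm_mult \<phi>'_def intro!: mult_left_mono\<close>)
    then show ?thesis by (simp add: N_def)
  qed
  have \<kappa>0: "(\<lambda>j. \<kappa> (\<eta> /\<^sub>R real (Suc j))) \<longlonglongrightarrow> \<kappa> 0" for \<eta>
    unfolding \<kappa>_def conv_def
  proof (rule integral_dominated_convergence[where w="\<lambda>y. cmod (\<phi> y) * B"])
    have \<phi>'c: "continuous_on UNIV \<phi>'" unfolding \<phi>'_def[abs_def]
      by (intro continuous_on_cnj continuous_on_compose2[OF cont] continuous_intros) auto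
    have "(\<lambda>j. inverse (real (Suc j)) *\<^sub>R \<eta>) \<longlonglongrightarrow> 0 *\<^sub>R \<eta>"
      by (intro tendsto_intros LIMSEQ_inverse_real_of_nat)
    then have l: "(\<lambda>j. \<eta> /\<^sub>R real (Suc j) - y) \<longlonglongrightarrow> 0 - y" for y
      by (intro tendsto_diff) auto
    then have "(\<lambda>j. \<phi>' (\<eta> /\<^sub>R real (Suc j) - y)) \<longlonglongrightarrow> \<phi>' (0 - y)" for y
      by (intro continuous_on_tendsto_compose[OF \<phi>'c l]) auto
    then show "AE y in lborel. (\<lambda>j. \<phi> y * \<phi>' (\<eta> /\<^sub>R real (Suc j) - y)) \<longlonglongrightarrow> \<phi> y * \<phi>' (0 - y)"
      by (intro AE_I2 tendsto_mult tendsto_const)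
  qed (use \<phi> B in \<open>auto simp: norm_mult \<phi>'_def intro!: mult_left_mono\<close>)
  define IK where "IK = (\<integral>x. K x \<partial>lborel)"
  \<comment> \<open>If the integral of the nonnegative \<open>K\<close> vanished,
    \<open>ft \<phi>\<close> would be 0 almost everywhere. But it is continuous, and its value at 0
    is the integral of \<open>\<phi>\<close>.\<close>
  have IK: "IK \<noteq> 0"
  proof
    assume "IK = 0"
    have K2: "K x = complex_of_real ((cmod (ft \<phi> x))\<^sup>2)" for x
      unfolding K_def by (rule complex_norm_square[symmetric])
    have "integrable lborel (\<lambda>x. Re (K x))" using K by (rule integrable_Re)
    then have i2: "integrable lborel (\<lambda>x. (cmod (ft \<phi> x))\<^sup>2)" unfolding K2 by simp
    have "Re IK = (\<integral>x. (cmod (ft \<phi> x))\<^sup>2 \<partial>lborel)"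
      unfolding IK_def K2 integral_complex_of_real Re_complex_of_real ..
    then have "(\<integral>x. (cmod (ft \<phi> x))\<^sup>2 \<partial>lborel) = 0" using \<open>IK = 0\<close> by simp
    then have "AE x in lborel. (cmod (ft \<phi> x))\<^sup>2 = 0"
      using i2 by (subst (asm) integral_nonneg_eq_0_iff_AE) auto
    then have ae: "AE x in lborel. x \<notin> {x. ft \<phi> x \<noteq> 0}" by auto
    have "continuous_on UNIV (ft \<phi>)"
      using isCont_ft[OF \<phi>] by (simp add: continuous_at_imp_continuous_on)
    then have "open {x. ft \<phi> x \<noteq> 0}"
      by (intro open_Collect_neq continuous_intros)
    moreover have "ft \<phi> 0 \<noteq> 0" using nz by (simp add: ft_def)
    ultimately show False using AE_lborel_open_nonempty ae by blast
  qed
  show ?thesis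
  proof (rule exI[of _ "\<kappa> 0 / IK"], intro allI impI)
    fix g :: "'a \<Rightarrow> complex" assume g: "integrable lborel g" and fg: "integrable lborel (ft g)"
    have [measurable]: "g \<in> borel_measurable borel" using g by auto
    define L where "L y = \<kappa> 0 * ft (\<lambda>\<eta>. ft g (- \<eta>)) y" for y
    have [measurable]: "L \<in> borel_measurable borel" unfolding L_def[abs_def] by measurable
    define T where "T j y = conv (dilate (real (Suc j)) K) g y" for j y
    have [measurable]: "T j \<in> borel_measurable borel" for j unfolding T_def[abs_def] by measurable
    \<comment> \<open>The multiplication formula moves the transform from \<open>\<kappa>\<close> to
      \<open>g'\<close>, the reflected, dilated and translated copy of \<open>g\<close>. The
      dilation ends up inside \<open>\<kappa>\<close>, which is then evaluated near 0.\<close>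
    have T_eq: "T j y = (\<integral>\<eta>. cis (y \<bullet> \<eta>) * ft g (- \<eta>) * \<kappa> (\<eta> /\<^sub>R real (Suc j)) \<partial>lborel)" for j y
    proof -
      define r where "r = real (Suc j)"
      have r: "r > 0" by (simp add: r_def)
      define g' where "g' z = g (y + (- inverse r) *\<^sub>R z)" for z
      have g': "integrable lborel g'" unfolding g'_def using r by (intro lborel_integrable_affine g) auto
      then have [measurable]: "g' \<in> borel_measurable borel" by auto
      have inner: "ft g' \<zeta> = complex_of_real (r ^ DIM('a)) * (cis (y \<bullet> (r *\<^sub>R \<zeta>)) * ft g (- (r *\<^sub>R \<zeta>)))" for \<zeta>
      proof -
        have "ft g' \<zeta> = \<bar>- r\<bar> ^ DIM('a) *\<^sub>R (\<integral>t. g' (r *\<^sub>R y + (- r) *\<^sub>R t) * cis (\<zeta> \<bullet> (r *\<^sub>R y + (- r) *\<^sub>R t)) \<partial>lborel)"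
          unfolding ft_def using r by (intro lborel_integral_affine) auto
        also have "(\<integral>t. g' (r *\<^sub>R y + (- r) *\<^sub>R t) * cis (\<zeta> \<bullet> (r *\<^sub>R y + (- r) *\<^sub>R t)) \<partial>lborel)
          = (\<integral>t. cis (y \<bullet> (r *\<^sub>R \<zeta>)) * (g t * cis ((- (r *\<^sub>R \<zeta>)) \<bullet> t)) \<partial>lborel)"
        proof (intro Bochner_Integration.integral_cong refl)
          fix t
          have "g' (r *\<^sub>R y + (- r) *\<^sub>R t) = g t" using r by (simp add: g'_def scaleR_diff_right)
          moreover have "cis (\<zeta> \<bullet> (r *\<^sub>R y + (- r) *\<^sub>R t)) = cis (y \<bullet> (r *\<^sub>R \<zeta>)) * cis ((- (r *\<^sub>R \<zeta>)) \<bullet> t)"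
            unfolding cis_mult by (simp add: inner_diff_right inner_commute)
          ultimately show "g' (r *\<^sub>R y + (- r) *\<^sub>R t) * cis (\<zeta> \<bullet> (r *\<^sub>R y + (- r) *\<^sub>R t))
            = cis (y \<bullet> (r *\<^sub>R \<zeta>)) * (g t * cis ((- (r *\<^sub>R \<zeta>)) \<bullet> t))" by simp
        qed
        also have "\<dots> = cis (y \<bullet> (r *\<^sub>R \<zeta>)) * ft g (- (r *\<^sub>R \<zeta>))" unfolding ft_def by simp
        finally show ?thesis using r by (simp add: scaleR_conv_of_real)
      qed
      have "T j y = (\<integral>z. K z * g' z \<partial>lborel)"
        unfolding T_def using r by (simp add: conv_dilate g'_def r_def)
      also have "\<dots> = (\<integral>z. (\<integral>\<zeta>. g' z * \<kappa> \<zeta> * cis (z \<bullet> \<zeta>) \<partial>lborel) \<partial>lborel)"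
        unfolding K_ft ft_def by (simp add: mult.assoc mult.commute[of _ "g' _"])
      also have "\<dots> = (\<integral>\<zeta>. (\<integral>z. g' z * \<kappa> \<zeta> * cis (z \<bullet> \<zeta>) \<partial>lborel) \<partial>lborel)"
        by (rule lborel_pair.Fubini_integral[symmetric])
           (use integrable_pair_product[OF g' \<kappa>, of "\<lambda>z \<zeta>. cis (z \<bullet> \<zeta>)"] in simp)
      also have "\<dots> = (\<integral>\<zeta>. ft g' \<zeta> * \<kappa> \<zeta> \<partial>lborel)"
      proof (intro Bochner_Integration.integral_cong refl)
        fix \<zeta>
        have "(\<integral>z. g' z * \<kappa> \<zeta> * cis (z \<bullet> \<zeta>) \<partial>lborel) = (\<integral>z. g' z * cis (\<zeta> \<bullet> z) * \<kappa> \<zeta> \<partial>lborel)"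
          by (intro Bochner_Integration.integral_cong refl) (simp add: inner_commute mult_ac)
        then show "(\<integral>z. g' z * \<kappa> \<zeta> * cis (z \<bullet> \<zeta>) \<partial>lborel) = ft g' \<zeta> * \<kappa> \<zeta>"
          unfolding ft_def by simp
      qed
      also have "\<dots> = (\<integral>\<zeta>. dilate r (\<lambda>\<eta>. cis (y \<bullet> \<eta>) * ft g (- \<eta>)) \<zeta> * \<kappa> \<zeta> \<partial>lborel)"
        unfolding inner dilate_def ..
      also have "\<dots> = (\<integral>\<eta>. cis (y \<bullet> \<eta>) * ft g (- \<eta>) * \<kappa> (\<eta> /\<^sub>R r) \<partial>lborel)"
        using r by (intro integral_dilate) auto
      finally show ?thesis by (simp add: r_def)
    qed
    have fg': "integrable lborel (\<lambda>\<eta>. cmod (ft g (- \<eta>)))"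
      using lborel_integrable_affine[OF fg, of "-1" 0] by simp
    have T_lim: "(\<lambda>j. T j y) \<longlonglongrightarrow> L y" for y
    proof -
      have "(\<lambda>j. T j y) \<longlonglongrightarrow> (\<integral>\<eta>. cis (y \<bullet> \<eta>) * ft g (- \<eta>) * \<kappa> 0 \<partial>lborel)"
        unfolding T_eq
      proof (rule integral_dominated_convergence[where w="\<lambda>\<eta>. cmod (ft g (- \<eta>)) * (N * B)"])
        show "AE \<eta> in lborel. (\<lambda>j. cis (y \<bullet> \<eta>) * ft g (- \<eta>) * \<kappa> (\<eta> /\<^sub>R real (Suc j)))
            \<longlonglongrightarrow> cis (y \<bullet> \<eta>) * ft g (- \<eta>) * \<kappa> 0"
          by (intro AE_I2 tendsto_mult tendsto_const \<kappa>0)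
        show "integrable lborel (\<lambda>\<eta>. cmod (ft g (- \<eta>)) * (N * B))" using fg' by simp
      qed (auto simp: norm_mult intro!: mult_left_mono \<kappa>B)
      also have "(\<integral>\<eta>. cis (y \<bullet> \<eta>) * ft g (- \<eta>) * \<kappa> 0 \<partial>lborel) = L y"
        unfolding L_def ft_def by (simp add: mult_ac)
      finally show ?thesis .
    qed
    \<comment> \<open>The means converge pointwise to \<open>L\<close> and in L^1 to IK g; Fatou's
      lemma identifies the two limits almost everywhere.\<close>
    have "(\<integral>\<^sup>+y. ennreal (cmod (L y - IK * g y)) \<partial>lborel)
       = (\<integral>\<^sup>+y. liminf (\<lambda>j. ennreal (cmod (T j y - IK * g y))) \<partial>lborel)"
    proof (intro nn_integral_cong)
      fix y
      have "(\<lambda>j. ennreal (cmod (T j y - IK * g y))) \<longlonglongrightarrow> ennreal (cmod (L y - IK * g y))"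
        by (intro tendsto_intros T_lim)
      then show "ennreal (cmod (L y - IK * g y)) = liminf (\<lambda>j. ennreal (cmod (T j y - IK * g y)))"
        by (intro lim_imp_Liminf[symmetric]) auto
    qed
    also have "\<dots> \<le> liminf (\<lambda>j. \<integral>\<^sup>+y. ennreal (cmod (T j y - IK * g y)) \<partial>lborel)"
      by (rule nn_integral_liminf) measurable
    also have "\<dots> = 0"
      using approximate_identity[OF K g] unfolding T_def IK_def
      by (intro lim_imp_Liminf) auto
    finally have "(\<integral>\<^sup>+y. ennreal (cmod (L y - IK * g y)) \<partial>lborel) = 0" by simp
    then have "AE y in lborel. L y = IK * g y"
      by (subst (asm) nn_integral_0_iff_AE) auto
    then show "AE y in lborel. g y = (\<kappa> 0 / IK) * ft (\<lambda>\<eta>. ft g (- \<eta>)) y"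
      by eventually_elim (use IK in \<open>simp add: L_def field_simps\<close>)
  qed
qed

section \<open>Smooth functions of compact support\<close>

definition smooth_on_cube :: "('a::euclidean_space \<Rightarrow> complex) \<Rightarrow> bool" where
  "smooth_on_cube f \<longleftrightarrow> smooth_fun f \<and> (\<forall>\<xi>. f \<xi> \<noteq> 0 \<longrightarrow> near 1 \<xi> 0)"

lemma near_box: "{x. near r x 0} = cbox (- (r *\<^sub>R One)) (r *\<^sub>R (One::'a::euclidean_space))"
  unfolding near_def by (auto simp: mem_box abs_le_iff inner_diff_left) (smt (verit))+

lemma integrable_supp_near:
  fixes f :: "'a::euclidean_space \<Rightarrow> complex"
  assumes [measurable]: "f \<in> borel_measurable borel"
    and B: "\<And>x. cmod (f x) \<le> B" and s: "\<And>\<xi>. f \<xi> \<noteq> 0 \<Longrightarrow> near r \<xi> y"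
  shows "integrable lborel f"
proof (rule Bochner_Integration.integrable_bound[where f="\<lambda>x. B * indicator {x. near r x y} x"])
  show "integrable lborel (\<lambda>x. B * indicator {x. near r x y} x)"
    using emeasure_near[of r y] by (intro integrable_mult_right integrable_real_indicator) auto
  have "0 \<le> B" using B[of undefined] norm_ge_zero order_trans by blast
  then show "AE x in lborel. norm (f x) \<le> norm (B * indicator {x. near r x y} x)"
    using B s by (intro AE_I2) (auto simp: indicator_def)
qed simp

lemma continuous_supp_bounded:
  fixes f :: "'a::euclidean_space \<Rightarrow> complex"
  assumes c: "continuous_on UNIV f" and s: "\<And>\<xi>. f \<xi> \<noteq> 0 \<Longrightarrow> near r \<xi> 0"
  shows "\<exists>B. \<forall>x. cmod (f x) \<le> B"
proof -
  have "compact (f ` {x. near r x 0})"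
    unfolding near_box using c by (intro compact_continuous_image continuous_on_subset[OF c]) auto
  then have "bounded (f ` {x. near r x 0})" by (rule compact_imp_bounded)
  then obtain B where B: "B > 0" "\<And>x. near r x 0 \<Longrightarrow> cmod (f x) \<le> B"
    unfolding bounded_pos by auto
  then have "cmod (f x) \<le> B" for x using s[of x] by (cases "f x = 0") auto
  then show ?thesis by blast
qed

lemma continuous_supp_integrable:
  fixes f :: "'a::euclidean_space \<Rightarrow> complex"
  assumes "continuous_on UNIV f" and "\<And>\<xi>. f \<xi> \<noteq> 0 \<Longrightarrow> near r \<xi> 0"
  shows "integrable lborel f"
proof -
  obtain B where "\<And>x. cmod (f x) \<le> B" using continuous_supp_bounded[OF assms] by blast
  then show ?thesis
    using assms by (intro integrable_supp_near[of f B r 0] borel_measurable_continuous_onI) auto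
qed

text \<open>The steps 1/(j+1) form a sequence, so that dominated convergence can be applied to the
  difference quotients.\<close>

lemma has_derivative_sequence:
  assumes f: "(f has_derivative D) (at x)" and v: "norm v = 1"
  shows "(\<lambda>j. (f (x + (1 / real (Suc j)) *\<^sub>R v) - f x) /\<^sub>R (1 / real (Suc j))) \<longlonglongrightarrow> D v"
proof -
  define t where "t j = 1 / real (Suc j)" for j
  have t: "t j > 0" for j by (simp add: t_def)
  have "t \<longlonglongrightarrow> 0" unfolding t_def[abs_def]
    using LIMSEQ_inverse_real_of_nat by (simp add: inverse_eq_divide)
  then have "(\<lambda>j. t j *\<^sub>R v) \<longlonglongrightarrow> 0 *\<^sub>R v" by (intro tendsto_intros)
  moreover have "t j *\<^sub>R v \<noteq> 0" for j using t[of j] v by auto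
  ultimately have at: "filterlim (\<lambda>j. t j *\<^sub>R v) (at 0) sequentially"
    by (intro filterlim_atI) auto
  have D: "bounded_linear D" and L: "(\<lambda>h. norm (f (x + h) - f x - D h) / norm h) \<midarrow>0\<rightarrow> 0"
    using f unfolding has_derivative_at by auto
  have "(\<lambda>j. norm (f (x + t j *\<^sub>R v) - f x - D (t j *\<^sub>R v)) / norm (t j *\<^sub>R v)) \<longlonglongrightarrow> 0"
    using filterlim_compose[OF L at] by simp
  moreover have "norm (f (x + t j *\<^sub>R v) - f x - D (t j *\<^sub>R v)) / norm (t j *\<^sub>R v)
     = norm ((f (x + t j *\<^sub>R v) - f x) /\<^sub>R t j - D v)" for j
  proof -
    interpret bounded_linear D by (rule D)
    have "(f (x + t j *\<^sub>R v) - f x) /\<^sub>R t j - D v = (f (x + t j *\<^sub>R v) - f x - D (t j *\<^sub>R v)) /\<^sub>R t j"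
      using t[of j] by (simp add: scaleR scaleR_diff_right)
    then show ?thesis using t[of j] v by (simp add: divide_inverse mult.commute)
  qed
  ultimately have "(\<lambda>j. norm ((f (x + t j *\<^sub>R v) - f x) /\<^sub>R t j - D v)) \<longlonglongrightarrow> 0" by simp
  then show ?thesis unfolding t_def by (simp add: tendsto_norm_zero_iff LIM_zero_iff)
qed

text \<open>Integration by parts, as the limit of the translation identity for difference quotients.\<close>

lemma ft_partial:
  fixes f fb :: "'a::euclidean_space \<Rightarrow> complex"
  assumes D: "\<And>\<xi>. (f has_derivative D \<xi>) (at \<xi>)" and Db: "\<And>\<xi>. D \<xi> b = fb \<xi>"
    and b: "b \<in> Basis" and c: "continuous_on UNIV fb"
    and s: "\<And>\<xi>. f \<xi> \<noteq> 0 \<Longrightarrow> near 1 \<xi> 0" and sb: "\<And>\<xi>. fb \<xi> \<noteq> 0 \<Longrightarrow> near 1 \<xi> 0"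
  shows "ft fb x = - \<i> * complex_of_real (x \<bullet> b) * ft f x"
proof -
  define t where "t j = 1 / real (Suc j)" for j
  have t: "t j > 0" "t j \<le> 1" for j by (auto simp: t_def)
  have cf: "continuous_on UNIV f"
    using has_derivative_continuous[OF D] by (simp add: continuous_on_eq_continuous_at)
  have f: "integrable lborel f" by (rule continuous_supp_integrable[OF cf s])
  then have [measurable]: "f \<in> borel_measurable borel" by auto
  have fb: "integrable lborel fb" by (rule continuous_supp_integrable[OF c sb])
  then have [measurable]: "fb \<in> borel_measurable borel" by auto
  obtain M where M: "\<And>x. cmod (fb x) \<le> M" using continuous_supp_bounded[OF c sb] by blast
  define S where "S j \<xi> = (f (\<xi> + t j *\<^sub>R b) - f \<xi>) /\<^sub>R t j * cis (x \<bullet> \<xi>)" for j \<xi>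
  \<comment> \<open>Mean value inequality along the segment from \<xi> to \<xi> + t b. The cube has
    radius 2 because a step t \<le> 1 may lead from outside the unit cube into it.\<close>
  have S_le: "cmod (S j \<xi>) \<le> M * indicator {x. near 2 x 0} \<xi>" for j \<xi>
  proof (cases "near 2 \<xi> 0")
    case True
    have "norm (f (\<xi> + t j *\<^sub>R b) - f (\<xi> + 0 *\<^sub>R b)) \<le> M * norm (t j - 0)"
    proof (rule differentiable_bound[where S="{0..t j}" and f="\<lambda>\<tau>. f (\<xi> + \<tau> *\<^sub>R b)" and f'="\<lambda>\<tau> h. D (\<xi> + \<tau> *\<^sub>R b) (h *\<^sub>R b)"])
      fix \<tau> :: real
      show "((\<lambda>\<tau>. f (\<xi> + \<tau> *\<^sub>R b)) has_derivative (\<lambda>h. D (\<xi> + \<tau> *\<^sub>R b) (h *\<^sub>R b))) (at \<tau> within {0..t j})"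
        by (rule has_derivative_compose[OF _ D]) (auto intro!: derivative_eq_intros)
      have "D (\<xi> + \<tau> *\<^sub>R b) (h *\<^sub>R b) = h *\<^sub>R fb (\<xi> + \<tau> *\<^sub>R b)" for h
        using bounded_linear.linear[OF has_derivative_bounded_linear[OF D]] Db
        by (simp add: linear_scale)
      then show "onorm (\<lambda>h. D (\<xi> + \<tau> *\<^sub>R b) (h *\<^sub>R b)) \<le> M"
        using M by (intro onorm_le) (simp add: mult.commute[of M] mult_left_mono)
    qed (use t[of j] in auto)
    then have "cmod (f (\<xi> + t j *\<^sub>R b) - f \<xi>) \<le> t j * M" using t[of j] by (simp add: mult.commute)
    then have "inverse (t j) * cmod (f (\<xi> + t j *\<^sub>R b) - f \<xi>) \<le> inverse (t j) * (t j * M)"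
      using t[of j] by (intro mult_left_mono) auto
    also have "\<dots> = M" using t[of j] by simp
    finally show ?thesis using True t[of j] by (simp add: S_def norm_mult)
  next
    case False
    have "\<not> near 1 \<xi> 0" using False near_mono[of 1 \<xi> 0 2] by auto
    moreover have "\<not> near 1 (\<xi> + t j *\<^sub>R b) 0"
    proof
      assume 1: "near 1 (\<xi> + t j *\<^sub>R b) 0"
      have "near 1 \<xi> (\<xi> + t j *\<^sub>R b)"
        using t[of j] b by (intro norm_near) auto
      from near_trans[OF this 1] False show False by simp
    qed
    ultimately have "f \<xi> = 0" "f (\<xi> + t j *\<^sub>R b) = 0" using s by blast+
    then show ?thesis using False by (simp add: S_def)
  qed
  have "(\<lambda>j. (\<integral>\<xi>. S j \<xi> \<partial>lborel)) \<longlonglongrightarrow> (\<integral>\<xi>. fb \<xi> * cis (x \<bullet> \<xi>) \<partial>lborel)"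
  proof (rule integral_dominated_convergence[where w="\<lambda>\<xi>. M * indicator {x. near 2 x 0} \<xi>"])
    show "integrable lborel (\<lambda>x::'a. M * indicator {x. near 2 x 0} x)"
      using emeasure_near[of 2 "0::'a"] by (intro integrable_mult_right integrable_real_indicator) auto
    show "AE \<xi> in lborel. (\<lambda>j. S j \<xi>) \<longlonglongrightarrow> fb \<xi> * cis (x \<bullet> \<xi>)"
      unfolding S_def t_def using has_derivative_sequence[OF D, of b] b Db
      by (intro AE_I2 tendsto_mult tendsto_const) auto
    show "AE \<xi> in lborel. cmod (S j \<xi>) \<le> M * indicator {x. near 2 x 0} \<xi>" for j
      by (intro AE_I2 S_le)
    show "S j \<in> borel_measurable lborel" for j unfolding S_def[abs_def] by measurable
  qed measurable
  \<comment> \<open>Shifting \<open>f\<close> by t b multiplies its transform by cis (-t (x . b)),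
    so the difference quotient of \<open>f\<close> becomes one of the exponential at 0.\<close>
  moreover have "(\<integral>\<xi>. S j \<xi> \<partial>lborel) = (cis (- (x \<bullet> b) * (0 + t j *\<^sub>R 1)) - cis (- (x \<bullet> b) * 0)) /\<^sub>R t j * ft f x" for j
  proof -
    have i: "integrable lborel (\<lambda>\<xi>. f (\<xi> - (- (t j *\<^sub>R b))))"
      by (rule lborel_integrable_shift[OF f])
    have "(\<integral>\<xi>. S j \<xi> \<partial>lborel) = (\<integral>\<xi>. inverse (t j) *\<^sub>R (f (\<xi> - (- (t j *\<^sub>R b))) * cis (x \<bullet> \<xi>) - f \<xi> * cis (x \<bullet> \<xi>)) \<partial>lborel)"
      unfolding S_def by (simp add: left_diff_distrib)
    also have "\<dots> = inverse (t j) *\<^sub>R (ft (\<lambda>\<xi>. f (\<xi> - (- (t j *\<^sub>R b)))) x - ft f x)"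
      unfolding ft_def using integrable_cis[OF i, of x] integrable_cis[OF f, of x]
      by (subst integral_scaleR_right, subst Bochner_Integration.integral_diff) auto
    also have "\<dots> = (cis (- (x \<bullet> b) * (0 + t j *\<^sub>R 1)) - cis (- (x \<bullet> b) * 0)) /\<^sub>R t j * ft f x"
      by (subst ft_translate) (auto simp: left_diff_distrib right_diff_distrib mult.commute)
    finally show ?thesis .
  qed
  moreover have "(\<lambda>j. (cis (- (x \<bullet> b) * (0 + t j *\<^sub>R 1)) - cis (- (x \<bullet> b) * 0)) /\<^sub>R t j * ft f x)
     \<longlonglongrightarrow> (- \<i> * complex_of_real (x \<bullet> b)) * ft f x"
  proof -
    have "((\<lambda>\<tau>. cis (- (x \<bullet> b) * \<tau>)) has_derivative (\<lambda>h. (- (x \<bullet> b) * h) *\<^sub>R (\<i> * cis (- (x \<bullet> b) * 0)))) (at 0)"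
      by (rule has_derivative_cis) (auto intro!: derivative_eq_intros)
    from has_derivative_sequence[OF this, of 1]
    have "(\<lambda>j. (cis (- (x \<bullet> b) * (0 + t j *\<^sub>R 1)) - cis (- (x \<bullet> b) * 0)) /\<^sub>R t j)
       \<longlonglongrightarrow> (- (x \<bullet> b) * 1) *\<^sub>R (\<i> * cis (- (x \<bullet> b) * 0))" unfolding t_def by simp
    also have "(- (x \<bullet> b) * 1) *\<^sub>R (\<i> * cis (- (x \<bullet> b) * 0)) = - \<i> * complex_of_real (x \<bullet> b)"
      by (simp add: scaleR_conv_of_real mult.commute)
    finally show ?thesis by (intro tendsto_mult tendsto_const)
  qed
  ultimately show ?thesis unfolding ft_def[of fb] by (simp add: LIMSEQ_unique)
qed

lemma smooth_fun_continuous: "smooth_fun f \<Longrightarrow> continuous_on UNIV f"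
proof -
  assume "smooth_fun f"
  then obtain F :: "'a list \<Rightarrow> 'a \<Rightarrow> complex" where F: "F [] = f"
    "\<And>x. (F [] has_derivative (\<lambda>h. \<Sum>b\<in>Basis. (h \<bullet> b) *\<^sub>R F [b] x)) (at x)"
    unfolding smooth_fun_def by blast
  then show ?thesis using has_derivative_continuous[OF F(2)] by (simp add: continuous_on_eq_continuous_at)
qed

text \<open>On the transform side 1 minus the Laplacian is multiplication by 1 + |x|^2. The operator
  preserves smoothness and the support cube, so it can be iterated.\<close>

lemma smooth_on_cube_laplace:
  fixes f :: "'a::euclidean_space \<Rightarrow> complex"
  assumes f: "smooth_on_cube f"
  shows "\<exists>f'. smooth_on_cube f' \<and> (\<forall>x. complex_of_real ((jbr x)\<^sup>2) * ft f x = ft f' x)"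
proof -
  obtain F :: "'a list \<Rightarrow> 'a \<Rightarrow> complex" where F0: "F [] = f"
    and FD: "\<And>bs x. (F bs has_derivative (\<lambda>h. \<Sum>b\<in>Basis. (h \<bullet> b) *\<^sub>R F (b # bs) x)) (at x)"
    using f unfolding smooth_on_cube_def smooth_fun_def by blast
  have dir: "(\<Sum>b'\<in>Basis. (b \<bullet> b') *\<^sub>R F (b' # bs) x) = F (b # bs) x" if "b \<in> Basis" for b bs x
  proof -
    have "(\<Sum>b'\<in>Basis. (b \<bullet> b') *\<^sub>R F (b' # bs) x) = (\<Sum>b'\<in>Basis. if b = b' then F (b' # bs) x else 0)"
      using that by (intro sum.cong) (auto simp: inner_Basis)
    then show ?thesis using that by simp
  qed
  have cont: "continuous_on UNIV (F bs)" for bs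
    using has_derivative_continuous[OF FD] by (simp add: continuous_on_eq_continuous_at)
  \<comment> \<open>On the open complement of the closed cube the function is 0, so by uniqueness of
    derivatives all partial derivatives vanish there too.\<close>
  have supp: "set bs \<subseteq> Basis \<Longrightarrow> F bs \<xi> \<noteq> 0 \<Longrightarrow> near 1 \<xi> 0" for bs \<xi>
  proof (induction bs arbitrary: \<xi>)
    case Nil then show ?case using f F0 by (auto simp: smooth_on_cube_def)
  next
    case (Cons b bs)
    have b: "b \<in> Basis" and bs: "set bs \<subseteq> Basis" using Cons.prems by auto
    show ?case
    proof (rule ccontr)
      assume n: "\<not> near 1 \<xi> 0"
      have op: "open (- {x::'a. near 1 x 0})" unfolding near_box by (intro open_Compl closed_cbox)
      have eq: "0 = F bs y" if y: "y \<in> - {x::'a. near 1 x 0}" for y using Cons.IH[OF bs, of y] y by auto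
      have "\<xi> \<in> - {x::'a. near 1 x 0}" using n by simp
      from has_derivative_transform_within_open[OF has_derivative_const op this eq]
      have "(F bs has_derivative (\<lambda>h. 0)) (at \<xi>)" .
      from has_derivative_unique[OF this FD]
      have "(\<lambda>h. 0) = (\<lambda>h. \<Sum>b\<in>Basis. (h \<bullet> b) *\<^sub>R F (b # bs) \<xi>)" .
      then have "F (b # bs) \<xi> = 0" using dir[OF b, of bs \<xi>] by metis
      then show False using Cons.prems by simp
    qed
  qed
  have int: "integrable lborel (F bs)" if "set bs \<subseteq> Basis" for bs
    by (rule continuous_supp_integrable[OF cont supp[OF that]])
  have part: "ft (F (b # bs)) x = - \<i> * complex_of_real (x \<bullet> b) * ft (F bs) x"
    if "b \<in> Basis" "set bs \<subseteq> Basis" for b bs x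
    using that by (intro ft_partial[OF FD dir[OF that(1)] that(1) cont supp[OF that(2)] supp]) auto
  define f' where "f' \<xi> = F [] \<xi> - (\<Sum>b\<in>Basis. F [b, b] \<xi>)" for \<xi>
  have "smooth_fun f'"
    unfolding smooth_fun_def
  \<comment> \<open>The head of a list is the outermost derivative. Appending [b, b] at the end
    applies the Laplacian first, and further derivatives are put in front, so the same family
    \<open>F\<close> serves.\<close>
  proof (intro exI[of _ "\<lambda>bs \<xi>. F bs \<xi> - (\<Sum>b\<in>Basis. F (bs @ [b, b]) \<xi>)"] conjI allI)
    show "(\<lambda>\<xi>. F [] \<xi> - (\<Sum>b\<in>Basis. F ([] @ [b, b]) \<xi>)) = f'" by (simp add: f'_def[abs_def])
    fix bs x
    have "((\<lambda>\<xi>. F bs \<xi> - (\<Sum>b\<in>Basis. F (bs @ [b, b]) \<xi>)) has_derivative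
       (\<lambda>h. (\<Sum>a\<in>Basis. (h \<bullet> a) *\<^sub>R F (a # bs) x)
          - (\<Sum>b\<in>Basis. \<Sum>a\<in>Basis. (h \<bullet> a) *\<^sub>R F (a # (bs @ [b, b])) x))) (at x)"
      by (intro has_derivative_diff has_derivative_sum FD)
    moreover have "(\<Sum>a\<in>Basis. (h \<bullet> a) *\<^sub>R F (a # bs) x)
          - (\<Sum>b\<in>Basis. \<Sum>a\<in>Basis. (h \<bullet> a) *\<^sub>R F (a # (bs @ [b, b])) x)
        = (\<Sum>a\<in>Basis. (h \<bullet> a) *\<^sub>R (F (a # bs) x - (\<Sum>b\<in>Basis. F ((a # bs) @ [b, b]) x)))" for h
      by (subst sum.swap) (simp add: scaleR_diff_right sum_subtractf scaleR_sum_right)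
    ultimately show "((\<lambda>\<xi>. F bs \<xi> - (\<Sum>b\<in>Basis. F (bs @ [b, b]) \<xi>)) has_derivative
       (\<lambda>h. \<Sum>a\<in>Basis. (h \<bullet> a) *\<^sub>R (F (a # bs) x - (\<Sum>b\<in>Basis. F ((a # bs) @ [b, b]) x)))) (at x)"
      by simp
  qed
  moreover have "f' \<xi> \<noteq> 0 \<longrightarrow> near 1 \<xi> 0" for \<xi>
  proof (rule impI, rule ccontr)
    assume "f' \<xi> \<noteq> 0" and n: "\<not> near 1 \<xi> 0"
    have "F [] \<xi> = 0" using supp[of "[]" \<xi>] n by auto
    moreover have "F [b, b] \<xi> = 0" if "b \<in> Basis" for b using supp[of "[b, b]" \<xi>] n that by auto
    ultimately show False using \<open>f' \<xi> \<noteq> 0\<close> by (simp add: f'_def)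
  qed
  moreover have "complex_of_real ((jbr x)\<^sup>2) * ft f x = ft f' x" for x
  proof -
    have "ft f' x = ft (F []) x - (\<Sum>b\<in>Basis. ft (F [b, b]) x)"
      unfolding f'_def[abs_def] by (subst ft_diff) (auto simp: ft_sum int)
    also have "(\<Sum>b\<in>Basis. ft (F [b, b]) x) = (\<Sum>b\<in>Basis. - complex_of_real ((x \<bullet> b)\<^sup>2) * ft (F []) x)"
    proof (intro sum.cong refl)
      fix b :: 'a assume b: "b \<in> Basis"
      have "ft (F [b, b]) x = - \<i> * complex_of_real (x \<bullet> b) * (- \<i> * complex_of_real (x \<bullet> b) * ft (F []) x)"
        using b by (simp only: part[of b "[b]"] part[of b "[]"] list.set empty_subsetI insert_subset simp_thms)
      then show "ft (F [b, b]) x = - complex_of_real ((x \<bullet> b)\<^sup>2) * ft (F []) x"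
        by (simp add: power2_eq_square algebra_simps)
    qed
    also have "\<dots> = - complex_of_real ((norm x)\<^sup>2) * ft (F []) x"
    proof -
      have "(norm x)\<^sup>2 = (\<Sum>b\<in>Basis. (x \<bullet> b)\<^sup>2)"
        unfolding power2_norm_eq_inner by (subst euclidean_inner) (simp add: power2_eq_square)
      then show ?thesis by (simp add: sum_distrib_right sum_negf)
    qed
    finally show ?thesis by (simp add: F0 jbr_def algebra_simps)
  qed
  ultimately show ?thesis unfolding smooth_on_cube_def by blast
qed

lemma smooth_on_cube_continuous: "smooth_on_cube f \<Longrightarrow> continuous_on UNIV f"
  by (simp add: smooth_on_cube_def smooth_fun_continuous)

lemma smooth_on_cube_integrable: "smooth_on_cube f \<Longrightarrow> integrable lborel f"
  by (rule continuous_supp_integrable[of _ 1]) (auto simp: smooth_on_cube_def smooth_fun_continuous)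

text \<open>Smoothness becomes decay: m applications of 1 minus the Laplacian leave a bounded
  transform, so |ft f| is at most a constant times jbr^(-2m).\<close>

lemma integrable_ft_smooth_on_cube:
  fixes f :: "'a::euclidean_space \<Rightarrow> complex"
  assumes f: "smooth_on_cube f"
  shows "integrable lborel (ft f)"
proof -
  have iter: "\<exists>f'. smooth_on_cube f' \<and> (\<forall>x. complex_of_real ((jbr x) ^ (2 * m)) * ft f x = ft f' x)" for m
  proof (induction m)
    case 0 then show ?case using f by auto
  next
    case (Suc m)
    then obtain f1 where f1: "smooth_on_cube f1" "\<And>x. complex_of_real ((jbr x) ^ (2 * m)) * ft f x = ft f1 x" by blast
    obtain f2 where f2: "smooth_on_cube f2" "\<And>x. complex_of_real ((jbr x)\<^sup>2) * ft f1 x = ft f2 x"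
      using smooth_on_cube_laplace[OF f1(1)] by blast
    have "complex_of_real ((jbr x) ^ (2 * Suc m)) * ft f x = ft f2 x" for x
      unfolding f2(2)[symmetric] f1(2)[symmetric] by (simp add: power_add[symmetric] mult.assoc[symmetric] flip: of_real_mult of_real_power)
    then show ?case using f2 by blast
  qed
  \<comment> \<open>The decay then has order 2n > n, which suffices for integrability.\<close>
  define m where "m = DIM('a)"
  obtain f' where f': "smooth_on_cube f'" "\<And>x. complex_of_real ((jbr x) ^ (2 * m)) * ft f x = ft f' x"
    using iter by blast
  define C where "C = (\<integral>\<xi>. cmod (f' \<xi>) \<partial>lborel)"
  have [measurable]: "f \<in> borel_measurable borel" using smooth_on_cube_integrable[OF f] by auto
  have C0: "0 \<le> C" unfolding C_def by (rule Bochner_Integration.integral_nonneg) simp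
  have le: "cmod (ft f x) \<le> C * jbr x powr (- real (2 * m))" for x
  proof -
    have "jbr x ^ (2 * m) * cmod (ft f x) = cmod (ft f' x)"
      unfolding f'(2)[symmetric] by (simp add: norm_mult norm_power)
    also have "\<dots> \<le> C" unfolding C_def by (rule norm_ft_le)
    finally have "cmod (ft f x) \<le> C / jbr x ^ (2 * m)" by (simp add: field_simps)
    also have "jbr x ^ (2 * m) = jbr x powr real (2 * m)" by (rule powr_realpow[symmetric]) simp
    finally show ?thesis by (simp add: powr_minus divide_inverse)
  qed
  show ?thesis
  proof (rule integrableI_bounded)
    have "(\<integral>\<^sup>+x. ennreal (cmod (ft f x)) \<partial>lborel) \<le> (\<integral>\<^sup>+x. ennreal C * ennreal (jbr (x::'a) powr (- real (2 * m))) \<partial>lborel)"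
      using le C0 by (intro nn_integral_mono) (simp add: ennreal_mult[symmetric] ennreal_leI)
    also have "\<dots> < \<infinity>"
      using nn_integral_jbr_powr_finite[where 'a='a, of "real (2 * m)"]
      by (simp add: nn_integral_cmult ennreal_mult_less_top m_def)
    finally show "(\<integral>\<^sup>+x. ennreal (cmod (ft f x)) \<partial>lborel) < \<infinity>" .
  qed measurable
qed

section \<open>The window\<close>

lemma window_smooth_on_cube: "admissible_window \<phi> \<Longrightarrow> smooth_on_cube \<phi>"
  unfolding admissible_window_def smooth_on_cube_def near_def by simp

lemma window_supp: "admissible_window \<phi> \<Longrightarrow> \<phi> (\<xi> - k) \<noteq> 0 \<Longrightarrow> near 1 \<xi> k"
  unfolding admissible_window_def near_def by simp

text \<open>Only windows centred within distance 1 of a point can be nonzero there, so the infinite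
  partition of unity reduces to any finite set of centres containing those.\<close>

lemma window_sum:
  assumes w: "admissible_window \<phi>" and L: "finite L" "L \<subseteq> Zlat"
    and all: "\<And>k. k \<in> Zlat \<Longrightarrow> near 1 \<xi> k \<Longrightarrow> k \<in> L"
  shows "(\<Sum>k\<in>L. \<phi> (\<xi> - k)) = 1"
proof -
  have "((\<lambda>k. \<phi> (\<xi> - k)) has_sum 1) Zlat" using w by (simp add: admissible_window_def)
  also have "((\<lambda>k. \<phi> (\<xi> - k)) has_sum 1) Zlat \<longleftrightarrow> ((\<lambda>k. \<phi> (\<xi> - k)) has_sum 1) L"
    using L window_supp[OF w] all by (intro has_sum_cong_neutral) blast+
  finally show ?thesis using has_sum_finite[OF L(1)] has_sum_unique by blast
qed

text \<open>Unfolding: the integral over the whole space equals the integral over one cell of the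
  sum of all lattice translates, which is 1. So it is the volume of a cell. This permits the
  normalised kernel \<open>\<phi>0\<close> and the use of \<open>\<phi>\<close> in
  \<open>ft_inversion\<close>.\<close>

lemma window_integral_nonzero:
  fixes \<phi> :: "'a::euclidean_space \<Rightarrow> complex"
  assumes w: "admissible_window \<phi>"
  shows "(\<integral>x. \<phi> x \<partial>lborel) \<noteq> 0"
proof -
  \<comment> \<open>Radius 2 is 1 for the support plus 1 for the cell: every cell meeting the
    support of the window is included.\<close>
  define S where "S = {m \<in> Zlat. near 2 m (0::'a)}"
  have S: "finite S" "S \<subseteq> Zlat" using Zlat_near_card[of 2 "0::'a"] by (auto simp: S_def)
  have \<phi>: "integrable lborel \<phi>" by (rule smooth_on_cube_integrable[OF window_smooth_on_cube[OF w]])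
  then have [measurable]: "\<phi> \<in> borel_measurable borel" by auto
  define Q where "Q = {x::'a. floorv x = 0}"
  have [measurable]: "Q \<in> sets borel" unfolding Q_def by measurable
  \<comment> \<open>The part of \<open>\<phi>\<close> on the cell of k, moved to the base cell
    \<open>Q\<close>.\<close>
  define h where "h k \<xi> = indicator Q \<xi> *\<^sub>R \<phi> (\<xi> - (- k))" for k \<xi>
  have hi: "integrable lborel (h k)" for k
    unfolding h_def[abs_def] by (intro integrable_mult_indicator lborel_integrable_shift[OF \<phi>]) auto
  then have [measurable]: "h k \<in> borel_measurable borel" for k by auto
  have "\<phi> \<xi> = (\<Sum>k\<in>S. h k (\<xi> - k))" for \<xi>
  proof -
    have "(\<Sum>k\<in>S. h k (\<xi> - k)) = (\<Sum>k\<in>S. if k = floorv \<xi> then \<phi> \<xi> else 0)"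
      using S by (intro sum.cong refl) (auto simp: h_def Q_def indicator_def floorv_diff)
    also have "\<dots> = (if floorv \<xi> \<in> S then \<phi> \<xi> else 0)" using S by simp
    also have "\<dots> = \<phi> \<xi>"
    proof (cases "\<phi> \<xi> = 0")
      case False
      then have "near 1 \<xi> 0" using window_supp[OF w, of \<xi> 0] by simp
      moreover have "near 1 (floorv \<xi>) \<xi>" using near_floorv near_sym by blast
      ultimately have "near 2 (floorv \<xi>) 0" using near_trans[of 1 "floorv \<xi>" \<xi> 1 0] by simp
      then show ?thesis by (simp add: S_def)
    qed simp
    finally show ?thesis by simp
  qed
  then have "(\<integral>x. \<phi> x \<partial>lborel) = (\<integral>\<xi>. (\<Sum>k\<in>S. h k (\<xi> - k)) \<partial>lborel)" by simp
  also have "\<dots> = (\<Sum>k\<in>S. \<integral>\<xi>. h k (\<xi> - k) \<partial>lborel)"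
    by (intro Bochner_Integration.integral_sum lborel_integrable_shift hi)
  also have "\<dots> = (\<Sum>k\<in>S. \<integral>\<xi>. h k \<xi> \<partial>lborel)"
    by (intro sum.cong refl lborel_integral_shift) auto
  also have "\<dots> = (\<integral>\<xi>. (\<Sum>k\<in>S. h k \<xi>) \<partial>lborel)"
    by (intro Bochner_Integration.integral_sum[symmetric] hi)
  also have "\<dots> = (\<integral>\<xi>. complex_of_real (indicator Q \<xi>) \<partial>lborel)"
  proof (intro Bochner_Integration.integral_cong refl)
    fix \<xi>
    show "(\<Sum>k\<in>S. h k \<xi>) = complex_of_real (indicator Q \<xi>)"
    proof (cases "\<xi> \<in> Q")
      case True
      have n: "near 1 0 \<xi>" using True near_floorv[of \<xi>] near_sym[of 1 \<xi> 0] by (simp add: Q_def)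
      have neg: "near r (- k) 0 \<longleftrightarrow> near r k 0" for r and k :: 'a unfolding near_def by simp
      have negZ: "- k \<in> Zlat \<longleftrightarrow> k \<in> Zlat" for k :: 'a unfolding Zlat_def by simp
      have "(\<Sum>k\<in>S. h k \<xi>) = (\<Sum>k\<in>S. \<phi> (\<xi> - (- k)))" using True by (simp add: h_def)
      \<comment> \<open>\<open>S\<close> is symmetric under k \<mapsto> -k.\<close>
      also have "\<dots> = (\<Sum>k\<in>S. \<phi> (\<xi> - k))"
        by (rule sum.reindex_bij_witness[of _ uminus uminus]) (auto simp: S_def neg negZ)
      also have "\<dots> = 1"
      proof (rule window_sum[OF w S])
        fix k assume k: "k \<in> Zlat" "near 1 \<xi> k"
        then show "k \<in> S" using near_trans[OF n k(2)] near_sym[of 2 k 0] by (simp add: S_def)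
      qed
      finally show ?thesis using True by simp
    qed (simp add: h_def)
  qed
  also have "\<dots> = complex_of_real (measure lborel Q)"
    using emeasure_cell[where 'a='a] by (simp add: Q_def)
  finally have "(\<integral>x. \<phi> x \<partial>lborel) = complex_of_real (measure lborel Q)" .
  moreover have "measure lborel Q \<noteq> 0"
    using emeasure_cell[where 'a='a] unfolding Q_def measure_def
    by (auto simp: enn2real_eq_0_iff)
  ultimately show ?thesis by simp
qed

section \<open>Norm estimates on the Fourier side\<close>

locale window_setup =
  fixes \<phi> :: "'a::euclidean_space \<Rightarrow> complex" and p q s :: real
  assumes win: "admissible_window \<phi>" and p1: "1 \<le> p"
    and qs: "(q = 1 \<and> s \<ge> 0) \<or> (1 < q \<and> s > real DIM('a) / (q / (q - 1)))"
begin

sublocale L: weighted_group "lborel :: 'a measure" q s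
  by (rule weighted_group_instances(1)[OF qs])

sublocale Z: weighted_group "count_space (Zlat :: 'a set)" q s
  by (rule weighted_group_instances(2)[OF qs])

lemma \<phi>_smooth: "smooth_on_cube \<phi>" by (rule window_smooth_on_cube[OF win])

lemma \<phi>_cont: "continuous_on UNIV \<phi>" by (rule smooth_on_cube_continuous[OF \<phi>_smooth])

lemma \<phi>_int: "integrable lborel \<phi>" by (rule smooth_on_cube_integrable[OF \<phi>_smooth])

lemma \<phi>_meas [measurable]: "\<phi> \<in> borel_measurable borel" using \<phi>_int by auto

lemma \<phi>_supp: "\<phi> (\<xi> - k) \<noteq> 0 \<Longrightarrow> near 1 \<xi> k" by (rule window_supp[OF win])

definition B\<phi> :: real where "B\<phi> = (SOME B. \<forall>x. cmod (\<phi> x) \<le> B)"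

lemma B\<phi>: "cmod (\<phi> x) \<le> B\<phi>"
proof -
  have "\<exists>B. \<forall>x. cmod (\<phi> x) \<le> B"
    by (rule continuous_supp_bounded[OF \<phi>_cont, of 1]) (use \<phi>_supp[of _ 0] in auto)
  from someI_ex[OF this] show ?thesis unfolding B\<phi>_def by blast
qed

lemma ft\<phi>_int: "integrable lborel (ft \<phi>)" by (rule integrable_ft_smooth_on_cube[OF \<phi>_smooth])

lemma inversion:
  obtains c where "\<And>g :: 'a \<Rightarrow> complex. integrable lborel g \<Longrightarrow> integrable lborel (ft g) \<Longrightarrow>
     (AE y in lborel. g y = c * ft (\<lambda>\<eta>. ft g (- \<eta>)) y)"
  using ft_inversion[OF \<phi>_int B\<phi> \<phi>_cont ft\<phi>_int window_integral_nonzero[OF win]] by blast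

text \<open>The difference of the two functions has Fourier integral 0, which is integrable; the
  inversion formula therefore applies to it, although \<open>ft g\<close> itself may fail to be
  integrable.\<close>

lemma ft_inj:
  assumes "integrable lborel g" "integrable lborel h" "ft g = ft (h :: 'a \<Rightarrow> complex)"
  shows "AE x in lborel. g x = h x"
proof -
  obtain c where c: "\<And>g :: 'a \<Rightarrow> complex. integrable lborel g \<Longrightarrow> integrable lborel (ft g) \<Longrightarrow>
     (AE y in lborel. g y = c * ft (\<lambda>\<eta>. ft g (- \<eta>)) y)" using inversion by blast
  have z: "ft (\<lambda>x. g x - h x) = (\<lambda>_. 0)" using assms by (intro ext) (simp add: ft_diff)
  have "AE y in lborel. g y - h y = c * ft (\<lambda>\<eta>. ft (\<lambda>x. g x - h x) (- \<eta>)) y"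
    using assms by (intro c) (auto simp: z)
  then show ?thesis unfolding z by eventually_elim (simp add: ft_def)
qed

text \<open>Everything is expressed through the Fourier transform \<open>g\<close> of the function: \<open>bn g k\<close> is the \<open>L\<^sup>p\<close> norm
  of the \<open>k\<close>-th window piece, and \<open>nF g\<close> and \<open>nM g\<close> are the \<open>q\<close>-th powers of the \<open>FL\<close> and \<open>Mod\<close> norms,
  up to powers of \<open>2\<pi>\<close> and with value \<open>\<infinity>\<close> outside the spaces.\<close>

definition loc :: "('a \<Rightarrow> complex) \<Rightarrow> 'a \<Rightarrow> 'a \<Rightarrow> complex" where
  "loc g k \<xi> = \<phi> (\<xi> - k) * g \<xi>"

definition pc :: "('a \<Rightarrow> complex) \<Rightarrow> 'a \<Rightarrow> 'a \<Rightarrow> complex" where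
  "pc g k = ft (loc g k)"

definition P :: "('a \<Rightarrow> complex) \<Rightarrow> 'a \<Rightarrow> ennreal" where
  "P g k = (\<integral>\<^sup>+x. epow (ennreal (cmod (pc g k x))) p \<partial>lborel)"

definition bn :: "('a \<Rightarrow> complex) \<Rightarrow> 'a \<Rightarrow> ennreal" where
  "bn g k = epow (P g k) (1/p)"

definition nF :: "('a \<Rightarrow> complex) \<Rightarrow> ennreal" where
  "nF g = L.wn (\<lambda>\<xi>. ennreal (cmod (g \<xi>)))"

definition nM :: "('a \<Rightarrow> complex) \<Rightarrow> ennreal" where
  "nM g = Z.wn (bn g)"

section \<open>Quasi-norm properties on the Fourier side\<close>

lemma loc_measurable [measurable]: "g \<in> borel_measurable borel \<Longrightarrow> loc g k \<in> borel_measurable borel"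
  unfolding loc_def[abs_def] by simp

lemma loc_int: "integrable lborel g \<Longrightarrow> integrable lborel (loc g k)"
  unfolding loc_def[abs_def] by (rule integrable_mult_bounded(2)[where K="B\<phi>"]) (auto simp: B\<phi>)

lemma pc_measurable [measurable]: "g \<in> borel_measurable borel \<Longrightarrow> pc g k \<in> borel_measurable borel"
  unfolding pc_def by simp

lemma pc_add: "integrable lborel g \<Longrightarrow> integrable lborel h \<Longrightarrow> pc (\<lambda>x. g x + h x) k y = pc g k y + pc h k y"
  using ft_add[OF loc_int[of g k] loc_int[of h k]] by (simp add: pc_def loc_def[abs_def] distrib_left)

lemma pc_cmult: "pc (\<lambda>x. c * g x) k y = c * pc g k y"
  using ft_cmult[of c "loc g k"] by (simp add: pc_def loc_def[abs_def] mult_ac)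

lemma pc_cong_AE:
  assumes [measurable]: "g \<in> borel_measurable borel" "h \<in> borel_measurable borel"
    and "AE x in lborel. g x = h x"
  shows "pc g k = pc h k"
  unfolding pc_def by (rule ft_cong_AE) (use assms(3) in \<open>auto simp: loc_def elim: eventually_mono\<close>)

lemma nF_cong_AE:
  assumes "AE x in lborel. g x = h x"
  shows "nF g = nF h"
  by (rule antisym; unfold nF_def; rule L.wn_mono_AE) (use assms in \<open>auto elim: eventually_mono\<close>)

lemma nF_add_le:
  assumes [measurable]: "g \<in> borel_measurable borel" "h \<in> borel_measurable borel"
  shows "nF (\<lambda>x. g x + h x) \<le> epow 2 q * (nF g + nF h)"
proof -
  have "nF (\<lambda>x. g x + h x) \<le> L.wn (\<lambda>\<xi>. ennreal (cmod (g \<xi>)) + ennreal (cmod (h \<xi>)))"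
    unfolding nF_def by (intro L.wn_mono) (simp flip: ennreal_plus add: ennreal_leI norm_triangle_ineq)
  also have "\<dots> \<le> epow 2 q * (nF g + nF h)" unfolding nF_def by (intro L.wn_add_le) auto
  finally show ?thesis .
qed

lemma nF_cmult:
  assumes [measurable]: "g \<in> borel_measurable borel"
  shows "nF (\<lambda>x. c * g x) = epow (ennreal (cmod c)) q * nF g"
  unfolding nF_def by (simp add: norm_mult ennreal_mult L.wn_cmult)

text \<open>A quasi-triangle inequality: the factor 2 comes from the p-th power of a pointwise sum,
  and 2^(1/p) from the root of a sum of two integrals.\<close>

lemma bn_add_le:
  assumes g: "integrable lborel g" and h: "integrable lborel h"
  shows "bn (\<lambda>x. g x + h x) k \<le> epow 2 (1 + 1/p) * (bn g k + bn h k)"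
proof -
  have [measurable]: "g \<in> borel_measurable borel" "h \<in> borel_measurable borel" using g h by auto
  have p0: "0 \<le> p" "0 \<le> 1/p" "p \<noteq> 0" using p1 by auto
  have "P (\<lambda>x. g x + h x) k \<le> (\<integral>\<^sup>+x. epow 2 p * (epow (ennreal (cmod (pc g k x))) p + epow (ennreal (cmod (pc h k x))) p) \<partial>lborel)"
    unfolding P_def
  proof (rule nn_integral_mono)
    fix x
    have "epow (ennreal (cmod (pc (\<lambda>x. g x + h x) k x))) p \<le> epow (ennreal (cmod (pc g k x)) + ennreal (cmod (pc h k x))) p"
      using p0 unfolding pc_add[OF g h]
      by (intro epow_mono) (auto simp flip: ennreal_plus simp: ennreal_leI norm_triangle_ineq)
    also have "\<dots> \<le> epow 2 p * (epow (ennreal (cmod (pc g k x))) p + epow (ennreal (cmod (pc h k x))) p)"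
      using p0 by (intro epow_add_le)
    finally show "epow (ennreal (cmod (pc (\<lambda>x. g x + h x) k x))) p
       \<le> epow 2 p * (epow (ennreal (cmod (pc g k x))) p + epow (ennreal (cmod (pc h k x))) p)" .
  qed
  also have "\<dots> = epow 2 p * (P g k + P h k)"
    unfolding P_def by (simp add: nn_integral_cmult nn_integral_add)
  finally have "bn (\<lambda>x. g x + h x) k \<le> epow (epow 2 p * (P g k + P h k)) (1/p)"
    unfolding bn_def using p0 by (intro epow_mono)
  also have "\<dots> = 2 * epow (P g k + P h k) (1/p)" using p0 by (simp add: epow_mult epow_epow)
  also have "\<dots> \<le> 2 * (epow 2 (1/p) * (bn g k + bn h k))"
    unfolding bn_def using p0 by (intro mult_left_mono epow_add_le) auto
  also have "\<dots> = epow 2 (1 + 1/p) * (bn g k + bn h k)"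
  proof -
    have "epow 2 (1 + 1/p) = 2 * epow 2 (1/p)"
      using epow_ennreal[of 2 "1 + 1/p"] epow_ennreal[of 2 "1/p"]
      by (simp add: powr_add ennreal_mult)
    then show ?thesis by (simp add: mult.assoc)
  qed
  finally show ?thesis .
qed

lemma bn_cmult:
  assumes [measurable]: "g \<in> borel_measurable borel"
  shows "bn (\<lambda>x. c * g x) k = ennreal (cmod c) * bn g k"
proof -
  have "P (\<lambda>x. c * g x) k = epow (ennreal (cmod c)) p * P g k"
    unfolding P_def pc_cmult by (simp add: norm_mult ennreal_mult epow_mult nn_integral_cmult)
  then show ?thesis using p1 by (simp add: bn_def epow_mult epow_epow)
qed

lemma nM_add_le:
  assumes "integrable lborel g" "integrable lborel h"
  shows "nM (\<lambda>x. g x + h x) \<le> epow (epow 2 (1 + 1/p)) q * (epow 2 q * (nM g + nM h))"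
proof -
  have "nM (\<lambda>x. g x + h x) \<le> Z.wn (\<lambda>k. epow 2 (1 + 1/p) * (bn g k + bn h k))"
    unfolding nM_def by (intro Z.wn_mono bn_add_le assms)
  also have "\<dots> = epow (epow 2 (1 + 1/p)) q * Z.wn (\<lambda>k. bn g k + bn h k)"
    by (rule Z.wn_cmult) simp
  also have "\<dots> \<le> epow (epow 2 (1 + 1/p)) q * (epow 2 q * (nM g + nM h))"
    unfolding nM_def by (intro mult_left_mono Z.wn_add_le) auto
  finally show ?thesis .
qed

lemma nM_cmult:
  assumes "g \<in> borel_measurable borel"
  shows "nM (\<lambda>x. c * g x) = epow (ennreal (cmod c)) q * nM g"
  unfolding nM_def bn_cmult[OF assms] by (rule Z.wn_cmult) simp

section \<open>The convolution algebra and window multipliers\<close>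

lemma nF_conv:
  "\<exists>C<top. \<forall>a\<in>borel_measurable borel. \<forall>g\<in>borel_measurable borel. nF (conv a g) \<le> C * nF a * nF g"
proof -
  obtain C where C: "C < top" "\<And>u v. u \<in> borel_measurable lborel \<Longrightarrow> v \<in> borel_measurable lborel \<Longrightarrow>
      L.wn (\<lambda>x. \<integral>\<^sup>+y. u y * v (x - y) \<partial>lborel) \<le> C * L.wn u * L.wn v"
    using L.conv_wn by blast
  show ?thesis
  proof (intro exI[of _ C] conjI ballI)
    fix a g :: "'a \<Rightarrow> complex"
    assume [measurable]: "a \<in> borel_measurable borel" "g \<in> borel_measurable borel"
    have "nF (conv a g) \<le> L.wn (\<lambda>x. \<integral>\<^sup>+y. ennreal (cmod (a y)) * ennreal (cmod (g (x - y))) \<partial>lborel)"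
      unfolding nF_def by (intro L.wn_mono norm_conv_le)
    also have "\<dots> \<le> C * nF a * nF g" unfolding nF_def by (intro C) auto
    finally show "nF (conv a g) \<le> C * nF a * nF g" .
  qed (rule C)
qed

text \<open>Multiplication by a translate of the window is convolution with the integrable function
  \<open>ft \<phi>\<close> (up to modulation) on the other side, by the inversion formula.\<close>

lemma multiplier_bound:
  "\<exists>C<top. \<forall>h. integrable lborel h \<longrightarrow> (\<forall>k x. ennreal (cmod (pc h k x))
     \<le> C * (\<integral>\<^sup>+\<eta>. ennreal (cmod (ft \<phi> \<eta>)) * ennreal (cmod (ft h (x - \<eta>))) \<partial>lborel))"
proof -
  obtain c where c: "AE y in lborel. \<phi> y = c * ft (\<lambda>\<eta>. ft \<phi> (- \<eta>)) y"
    using inversion[of thesis] \<phi>_int ft\<phi>_int by blast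
  \<comment> \<open>The inversion formula reads \<open>\<phi>\<close> = c ft \<rho> almost
    everywhere, which is enough under an integral.\<close>
  define \<rho> where "\<rho> \<eta> = ft \<phi> (- \<eta>)" for \<eta>
  have \<rho>: "integrable lborel \<rho>"
    using lborel_integrable_affine[OF ft\<phi>_int, of "-1" 0] by (simp add: \<rho>_def[abs_def])
  then have [measurable]: "\<rho> \<in> borel_measurable borel" by auto
  show ?thesis
  proof (intro exI[of _ "ennreal (cmod c)"] conjI allI impI)
    fix h k x assume h: "integrable lborel (h :: 'a \<Rightarrow> complex)"
    then have [measurable]: "h \<in> borel_measurable borel" by auto
    \<comment> \<open>Recentring at 0 changes \<open>ft h\<close> only by a factor of modulus 1, so
      the bound is uniform in k.\<close>
    define h' where "h' \<xi> = h (\<xi> - (- k))" for \<xi>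
    have h': "integrable lborel h'" unfolding h'_def by (rule lborel_integrable_shift[OF h])
    then have [measurable]: "h' \<in> borel_measurable borel" by auto
    have fth': "cmod (ft h' y) = cmod (ft h y)" for y
      unfolding h'_def by (subst ft_translate) (auto simp: norm_mult)
    have "pc h k x = ft (\<lambda>\<xi>. (\<lambda>z. \<phi> z * h' z) (\<xi> - k)) x"
      unfolding pc_def loc_def[abs_def] h'_def by simp
    also have "\<dots> = cis (x \<bullet> k) * ft (\<lambda>z. \<phi> z * h' z) x" by (rule ft_translate) measurable
    also have "ft (\<lambda>z. \<phi> z * h' z) = ft (\<lambda>z. c * (ft \<rho> z * h' z))"
      by (rule ft_cong_AE) (use c in \<open>auto simp: \<rho>_def[abs_def] elim: eventually_mono\<close>)
    also have "ft (\<lambda>z. c * (ft \<rho> z * h' z)) x = c * ft (\<lambda>z. ft \<rho> z * h' z) x" by (rule ft_cmult)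
    also have "ft (\<lambda>z. ft \<rho> z * h' z) x = (\<integral>z. (\<integral>\<eta>. h' z * \<rho> \<eta> * (cis (z \<bullet> \<eta>) * cis (x \<bullet> z)) \<partial>lborel) \<partial>lborel)"
    proof -
      have "(\<integral>\<eta>. h' z * \<rho> \<eta> * (cis (z \<bullet> \<eta>) * cis (x \<bullet> z)) \<partial>lborel) = ft \<rho> z * h' z * cis (x \<bullet> z)" for z
      proof -
        have "(\<integral>\<eta>. h' z * \<rho> \<eta> * (cis (z \<bullet> \<eta>) * cis (x \<bullet> z)) \<partial>lborel)
          = (\<integral>\<eta>. (h' z * cis (x \<bullet> z)) * (\<rho> \<eta> * cis (z \<bullet> \<eta>)) \<partial>lborel)"
          by (intro Bochner_Integration.integral_cong) (auto simp: mult_ac)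
        then show ?thesis unfolding ft_def by simp
      qed
      then show ?thesis unfolding ft_def[of "\<lambda>z. ft \<rho> z * h' z"] by simp
    qed
    also have "\<dots> = (\<integral>\<eta>. (\<integral>z. h' z * \<rho> \<eta> * (cis (z \<bullet> \<eta>) * cis (x \<bullet> z)) \<partial>lborel) \<partial>lborel)"
      by (rule lborel_pair.Fubini_integral[symmetric])
         (use integrable_pair_product[OF h' \<rho>, of "\<lambda>z \<eta>. cis (z \<bullet> \<eta>) * cis (x \<bullet> z)"] in \<open>simp add: norm_mult\<close>)
    also have "\<dots> = (\<integral>\<eta>. \<rho> \<eta> * ft h' (x + \<eta>) \<partial>lborel)"
    proof (intro Bochner_Integration.integral_cong refl)
      fix \<eta>
      have "(\<integral>z. h' z * \<rho> \<eta> * (cis (z \<bullet> \<eta>) * cis (x \<bullet> z)) \<partial>lborel) = (\<integral>z. \<rho> \<eta> * (h' z * cis ((x + \<eta>) \<bullet> z)) \<partial>lborel)"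
      proof (intro Bochner_Integration.integral_cong refl)
        fix z
        have "cis ((x + \<eta>) \<bullet> z) = cis (z \<bullet> \<eta>) * cis (x \<bullet> z)"
          by (simp add: cis_mult inner_add_left inner_commute[of \<eta>] add.commute)
        then show "h' z * \<rho> \<eta> * (cis (z \<bullet> \<eta>) * cis (x \<bullet> z)) = \<rho> \<eta> * (h' z * cis ((x + \<eta>) \<bullet> z))"
          by simp
      qed
      then show "(\<integral>z. h' z * \<rho> \<eta> * (cis (z \<bullet> \<eta>) * cis (x \<bullet> z)) \<partial>lborel) = \<rho> \<eta> * ft h' (x + \<eta>)"
        unfolding ft_def[of h'] by simp
    qed
    finally have e: "cmod (pc h k x) = cmod c * cmod (\<integral>\<eta>. \<rho> \<eta> * ft h' (x + \<eta>) \<partial>lborel)"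
      by (simp add: norm_mult)
    have "ennreal (cmod (pc h k x)) \<le> ennreal (cmod c) * (\<integral>\<^sup>+\<eta>. ennreal (cmod (\<rho> \<eta> * ft h' (x + \<eta>))) \<partial>lborel)"
      unfolding e ennreal_mult[OF norm_ge_zero norm_ge_zero]
      by (intro mult_left_mono norm_integral_le_nn) auto
    also have "(\<integral>\<^sup>+\<eta>. ennreal (cmod (\<rho> \<eta> * ft h' (x + \<eta>))) \<partial>lborel)
       = (\<integral>\<^sup>+\<eta>. (\<lambda>\<eta>. ennreal (cmod (ft \<phi> \<eta>)) * ennreal (cmod (ft h (x - \<eta>)))) (0 - \<eta>) \<partial>lborel)"
      by (simp add: norm_mult ennreal_mult fth' \<rho>_def)
    also have "\<dots> = (\<integral>\<^sup>+\<eta>. ennreal (cmod (ft \<phi> \<eta>)) * ennreal (cmod (ft h (x - \<eta>))) \<partial>lborel)"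
      by (rule nn_integral_lborel_reflect) measurable
    finally show "ennreal (cmod (pc h k x)) \<le> ennreal (cmod c) *
      (\<integral>\<^sup>+\<eta>. ennreal (cmod (ft \<phi> \<eta>)) * ennreal (cmod (ft h (x - \<eta>))) \<partial>lborel)" .
  qed simp
qed

text \<open>The window acts as a multiplier on L^p by convolution with an integrable function, so
  Young's inequality bounds it uniformly in the centre k.\<close>

lemma P_le:
  "\<exists>C<top. \<forall>h. integrable lborel h \<longrightarrow> (\<forall>k. P h k \<le> C * (\<integral>\<^sup>+x. epow (ennreal (cmod (ft h x))) p \<partial>lborel))"
proof -
  obtain C where C: "C < top" "\<And>h k x. integrable lborel h \<Longrightarrow> ennreal (cmod (pc h k x))
     \<le> C * (\<integral>\<^sup>+\<eta>. ennreal (cmod (ft \<phi> \<eta>)) * ennreal (cmod (ft h (x - \<eta>))) \<partial>lborel)"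
    using multiplier_bound by blast
  define A where "A = (\<integral>\<^sup>+\<eta>. ennreal (cmod (ft \<phi> \<eta>)) \<partial>lborel)"
  have A: "A < top" using ft\<phi>_int by (simp add: A_def integrable_iff_bounded)
  show ?thesis
  proof (intro exI[of _ "epow C p * epow A p"] conjI allI impI)
    show "epow C p * epow A p < top" using C A by (simp add: ennreal_mult_less_top)
    fix h k assume h: "integrable lborel (h :: 'a \<Rightarrow> complex)"
    then have [measurable]: "h \<in> borel_measurable borel" by auto
    have "P h k \<le> (\<integral>\<^sup>+x. epow C p * epow (\<integral>\<^sup>+\<eta>. ennreal (cmod (ft \<phi> \<eta>)) * ennreal (cmod (ft h (x - \<eta>))) \<partial>lborel) p \<partial>lborel)"
      unfolding P_def epow_mult[symmetric] using p1 by (intro nn_integral_mono epow_mono C h) auto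
    also have "\<dots> = epow C p * (\<integral>\<^sup>+x. epow (\<integral>\<^sup>+\<eta>. ennreal (cmod (ft \<phi> \<eta>)) * ennreal (cmod (ft h (x - \<eta>))) \<partial>lborel) p \<partial>lborel)"
      by (rule nn_integral_cmult) measurable
    also have "\<dots> \<le> epow C p * (epow A p * (\<integral>\<^sup>+x. epow (ennreal (cmod (ft h x))) p \<partial>lborel))"
      unfolding A_def using p1
      by (intro mult_left_mono L.Young_conv[of "\<lambda>\<eta>. ennreal (cmod (ft \<phi> \<eta>))" "\<lambda>x. ennreal (cmod (ft h x))"]) auto
    finally show "P h k \<le> epow C p * epow A p * (\<integral>\<^sup>+x. epow (ennreal (cmod (ft h x))) p \<partial>lborel)"
      by (simp add: mult.assoc)
  qed
qed

lemma P_sum_le: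
  assumes I: "finite I" and g: "\<And>i. i \<in> I \<Longrightarrow> integrable lborel (g i)"
  shows "P (\<lambda>x. \<Sum>i\<in>I. g i x) k \<le> epow (of_nat (card I)) p * (\<Sum>i\<in>I. P (g i) k)"
proof -
  have [measurable]: "pc (g i) k \<in> borel_measurable borel" if "i \<in> I" for i using g[OF that] by auto
  have "P (\<lambda>x. \<Sum>i\<in>I. g i x) k \<le> (\<integral>\<^sup>+x. epow (of_nat (card I)) p * (\<Sum>i\<in>I. epow (ennreal (cmod (pc (g i) k x))) p) \<partial>lborel)"
    unfolding P_def
  proof (rule nn_integral_mono)
    fix x
    have "pc (\<lambda>x. \<Sum>i\<in>I. g i x) k x = (\<Sum>i\<in>I. pc (g i) k x)"
      unfolding pc_def using ft_sum[of I "\<lambda>i. loc (g i) k" x] loc_int[OF g]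
      by (simp add: loc_def[abs_def] sum_distrib_left)
    then have "ennreal (cmod (pc (\<lambda>x. \<Sum>i\<in>I. g i x) k x)) \<le> (\<Sum>i\<in>I. ennreal (cmod (pc (g i) k x)))"
      by (simp add: ennreal_leI norm_sum)
    then have "epow (ennreal (cmod (pc (\<lambda>x. \<Sum>i\<in>I. g i x) k x))) p \<le> epow (\<Sum>i\<in>I. ennreal (cmod (pc (g i) k x))) p"
      using p1 by (intro epow_mono) auto
    also have "\<dots> \<le> epow (of_nat (card I)) p * (\<Sum>i\<in>I. epow (ennreal (cmod (pc (g i) k x))) p)"
      using p1 I by (intro epow_sum_le) auto
    finally show "epow (ennreal (cmod (pc (\<lambda>x. \<Sum>i\<in>I. g i x) k x))) p
      \<le> epow (of_nat (card I)) p * (\<Sum>i\<in>I. epow (ennreal (cmod (pc (g i) k x))) p)" .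
  qed
  also have "\<dots> = epow (of_nat (card I)) p * (\<Sum>i\<in>I. P (g i) k)"
    unfolding P_def by (subst nn_integral_cmult) (auto simp: nn_integral_sum)
  finally show ?thesis .
qed

abbreviation NZ :: "real \<Rightarrow> 'a \<Rightarrow> 'a set" where
  "NZ r y \<equiv> {l \<in> Zlat. near r l y}"

text \<open>The centre k is arbitrary, not only a lattice point, because convolution produces
  centres k - \<eta>. On the support of the window at k the lattice windows within distance 2 sum to
  1, so \<open>loc g k\<close> is cut out of finitely many lattice pieces, and \<open>P_le\<close>
  removes the extra window.\<close>

lemma bn_le_near:
  "\<exists>C<top. \<forall>g. integrable lborel g \<longrightarrow> (\<forall>k. bn g k \<le> C * (\<Sum>l\<in>NZ 2 k. bn g l))"
proof -
  obtain C where C: "C < top" "\<And>h k. integrable lborel h \<Longrightarrow> P h k \<le> C * (\<integral>\<^sup>+x. epow (ennreal (cmod (ft h x))) p \<partial>lborel)"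
    using P_le by blast
  have p0: "0 \<le> p" "0 \<le> 1/p" "p \<noteq> 0" using p1 by auto
  define N where "N = (of_nat (Zcount TYPE('a) 2) :: ennreal)"
  define D where "D = epow (epow N p * C) (1/p) * epow N (1/p)"
  have N: "N < top" by (simp add: N_def of_nat_less_top)
  show ?thesis
  proof (intro exI[of _ D] conjI allI impI)
    show "D < top" unfolding D_def using C N by (simp add: ennreal_mult_less_top)
    fix g k assume g: "integrable lborel (g :: 'a \<Rightarrow> complex)"
    have fin: "finite (NZ 2 k)" and card: "card (NZ 2 k) \<le> Zcount TYPE('a) 2"
      using Zlat_near_card[of 2 k] by auto
    have card: "of_nat (card (NZ 2 k)) \<le> N" unfolding N_def using card by simp
    have "loc g k \<xi> = loc (\<lambda>x. \<Sum>l\<in>NZ 2 k. loc g l x) k \<xi>" for \<xi>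
    proof (cases "\<phi> (\<xi> - k) = 0")
      case False
      then have n: "near 1 k \<xi>" using \<phi>_supp near_sym by blast
      have "(\<Sum>l\<in>NZ 2 k. \<phi> (\<xi> - l)) = 1"
      proof (rule window_sum[OF win fin])
        fix l assume "l \<in> Zlat" "near 1 \<xi> l"
        then show "l \<in> NZ 2 k" using near_trans[OF n, of 1 l] near_sym[of 2 k l] by simp
      qed auto
      then show ?thesis by (simp add: loc_def sum_distrib_right[symmetric])
    qed (simp add: loc_def)
    then have "P g k = P (\<lambda>x. \<Sum>l\<in>NZ 2 k. loc g l x) k" unfolding P_def pc_def by presburger
    also have "\<dots> \<le> epow (of_nat (card (NZ 2 k))) p * (\<Sum>l\<in>NZ 2 k. P (loc g l) k)"
      by (intro P_sum_le fin loc_int g)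
    also have "\<dots> \<le> epow N p * (\<Sum>l\<in>NZ 2 k. C * P g l)"
    proof (intro mult_mono sum_mono epow_mono card)
      fix l
      show "P (loc g l) k \<le> C * P g l"
        using C(2)[OF loc_int[OF g, of l], of k] by (simp add: P_def[of g] pc_def)
    qed (use p0 in auto)
    also have "\<dots> = epow N p * C * (\<Sum>l\<in>NZ 2 k. P g l)" by (simp add: sum_distrib_left mult.assoc)
    finally have "bn g k \<le> epow (epow N p * C * (\<Sum>l\<in>NZ 2 k. P g l)) (1/p)"
      unfolding bn_def using p0 by (intro epow_mono)
    also have "\<dots> = epow (epow N p * C) (1/p) * epow (\<Sum>l\<in>NZ 2 k. P g l) (1/p)" by (rule epow_mult)
    also have "\<dots> \<le> epow (epow N p * C) (1/p) * (epow (of_nat (card (NZ 2 k))) (1/p) * (\<Sum>l\<in>NZ 2 k. bn g l))"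
      unfolding bn_def using p0 fin by (intro mult_left_mono epow_sum_le) auto
    also have "\<dots> \<le> epow (epow N p * C) (1/p) * (epow N (1/p) * (\<Sum>l\<in>NZ 2 k. bn g l))"
      using p0 card by (intro mult_left_mono mult_right_mono epow_mono) auto
    finally show "bn g k \<le> D * (\<Sum>l\<in>NZ 2 k. bn g l)" by (simp add: D_def mult.assoc)
  qed
qed

section \<open>Window pieces of a convolution\<close>

lemma nn_sum_near:
  fixes u :: "'a \<Rightarrow> ennreal"
  shows "(\<integral>\<^sup>+l. u l * indicator {l. near r l y} l \<partial>count_space Zlat) = (\<Sum>l\<in>NZ r y. u l)"
proof -
  have fin: "finite (NZ r y)" using Zlat_near_card by blast
  have "(\<integral>\<^sup>+l. u l * indicator {l. near r l y} l \<partial>count_space Zlat)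
     = (\<Sum>l\<in>NZ r y. u l * indicator {l. near r l y} l)"
    using fin by (intro nn_integral_count_space') (auto simp: indicator_def)
  also have "\<dots> = (\<Sum>l\<in>NZ r y. u l)" by (intro sum.cong) (auto simp: indicator_def)
  finally show ?thesis .
qed

text \<open>Local L^1 mass of \<open>a\<close>, which replaces a function by a lattice sequence. The
  overlapping cubes of radius 2 match \<open>bn_le_near\<close>.\<close>

definition An :: "('a \<Rightarrow> complex) \<Rightarrow> 'a \<Rightarrow> ennreal" where
  "An a m = (\<integral>\<^sup>+\<eta>. ennreal (cmod (a \<eta>)) * indicator {\<eta>. near 2 \<eta> m} \<eta> \<partial>lborel)"

text \<open>The window at k applied to the translate of \<open>g\<close> by \<eta> is, up to
  modulation, the piece of \<open>g\<close> at k - \<eta>. By Fubini a piece of the convolution is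
  thus an average of pieces of \<open>g\<close> with weight \<open>a\<close>.\<close>

lemma norm_pc_conv_le:
  assumes a: "integrable lborel a" and g: "integrable lborel g"
  shows "ennreal (cmod (pc (conv a g) k x)) \<le> (\<integral>\<^sup>+\<eta>. ennreal (cmod (a \<eta>)) * ennreal (cmod (pc g (k - \<eta>) x)) \<partial>lborel)"
proof -
  have [measurable]: "a \<in> borel_measurable borel" "g \<in> borel_measurable borel" using a g by auto
  have "pc (conv a g) k x = (\<integral>\<xi>. (\<integral>\<eta>. a \<eta> * g (\<xi> - \<eta>) * (\<phi> (\<xi> - k) * cis (x \<bullet> \<xi>)) \<partial>lborel) \<partial>lborel)"
  proof -
    have "(\<integral>\<eta>. a \<eta> * g (\<xi> - \<eta>) * (\<phi> (\<xi> - k) * cis (x \<bullet> \<xi>)) \<partial>lborel)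
       = loc (conv a g) k \<xi> * cis (x \<bullet> \<xi>)" for \<xi>
      unfolding loc_def conv_def by simp
    then show ?thesis unfolding pc_def ft_def by (simp only:)
  qed
  also have "\<dots> = (\<integral>\<eta>. (\<integral>\<xi>. a \<eta> * g (\<xi> - \<eta>) * (\<phi> (\<xi> - k) * cis (x \<bullet> \<xi>)) \<partial>lborel) \<partial>lborel)"
    by (rule lborel_pair.Fubini_integral[symmetric])
       (use integrable_conv_pair[OF a g, of "\<lambda>\<xi> \<eta>. \<phi> (\<xi> - k) * cis (x \<bullet> \<xi>)" B\<phi>] B\<phi> in \<open>simp add: norm_mult\<close>)
  also have "\<dots> = (\<integral>\<eta>. a \<eta> * (cis (x \<bullet> \<eta>) * pc g (k - \<eta>) x) \<partial>lborel)"
  proof (intro Bochner_Integration.integral_cong refl)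
    fix \<eta>
    have "(\<integral>\<xi>. a \<eta> * g (\<xi> - \<eta>) * (\<phi> (\<xi> - k) * cis (x \<bullet> \<xi>)) \<partial>lborel)
       = (\<integral>\<xi>. a \<eta> * (loc g (k - \<eta>) (\<xi> - \<eta>) * cis (x \<bullet> \<xi>)) \<partial>lborel)"
      by (intro Bochner_Integration.integral_cong) (auto simp: loc_def algebra_simps)
    also have "\<dots> = a \<eta> * ft (\<lambda>\<xi>. loc g (k - \<eta>) (\<xi> - \<eta>)) x" unfolding ft_def by simp
    also have "ft (\<lambda>\<xi>. loc g (k - \<eta>) (\<xi> - \<eta>)) x = cis (x \<bullet> \<eta>) * pc g (k - \<eta>) x"
      unfolding pc_def by (rule ft_translate) measurable
    finally show "(\<integral>\<xi>. a \<eta> * g (\<xi> - \<eta>) * (\<phi> (\<xi> - k) * cis (x \<bullet> \<xi>)) \<partial>lborel)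
      = a \<eta> * (cis (x \<bullet> \<eta>) * pc g (k - \<eta>) x)" .
  qed
  finally show ?thesis
    using norm_integral_le_nn[of lborel "\<lambda>\<eta>. a \<eta> * (cis (x \<bullet> \<eta>) * pc g (k - \<eta>) x)"]
    by (simp add: norm_mult ennreal_mult)
qed

lemma pc_measurable2 [measurable]:
  assumes [measurable]: "g \<in> borel_measurable borel"
  shows "(\<lambda>(x, \<eta>). pc g (k - \<eta>) x) \<in> borel_measurable (borel \<Otimes>\<^sub>M borel)"
  unfolding pc_def ft_def loc_def by measurable

text \<open>Minkowski's inequality takes the L^p norm inside the \<eta>-integral,
  \<open>bn_le_near\<close> returns to lattice centres, and interchanging sum and integral collects
  the \<eta> near k - l into \<open>An a (k - l)\<close>. A convolution on R^n is thereby bounded by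
  one on the lattice.\<close>

lemma bn_conv_le:
  "\<exists>C<top. \<forall>a g. integrable lborel a \<longrightarrow> integrable lborel g \<longrightarrow> (\<forall>l\<in>Zlat. bn g l < top) \<longrightarrow>
     (\<forall>k. bn (conv a g) k \<le> C * (\<integral>\<^sup>+l. bn g l * An a (k - l) \<partial>count_space Zlat))"
proof -
  obtain C where C: "C < top" "\<And>g k. integrable lborel g \<Longrightarrow> bn g k \<le> C * (\<Sum>l\<in>NZ 2 k. bn g l)"
    using bn_le_near by blast
  have p0: "0 \<le> p" "0 \<le> 1/p" "p \<noteq> 0" using p1 by auto
  show ?thesis
  proof (intro exI[of _ C] conjI allI impI)
    fix a g :: "'a \<Rightarrow> complex" and k :: 'a
    assume a: "integrable lborel a" and g: "integrable lborel g" and fin: "\<forall>l\<in>Zlat. bn g l < top"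
    have [measurable]: "a \<in> borel_measurable borel" "g \<in> borel_measurable borel" using a g by auto
    \<comment> \<open>Written over the whole lattice with an indicator: this form gives
      measurability in \<eta> and the later interchange, whereas the index set of the finite sum in
      \<open>S_eq\<close> moves with \<eta>.\<close>
    define S where "S \<eta> = (\<integral>\<^sup>+l. bn g l * indicator {\<eta>. near 2 \<eta> (k - l)} \<eta> \<partial>count_space Zlat)" for \<eta>
    have nn: "near 2 l (k - \<eta>) \<longleftrightarrow> near 2 \<eta> (k - l)" for l \<eta> :: 'a
      unfolding near_def by (simp add: algebra_simps)
    have S_eq: "S \<eta> = (\<Sum>l\<in>NZ 2 (k - \<eta>). bn g l)" for \<eta>
      unfolding S_def nn_sum_near[symmetric] by (intro nn_integral_cong) (simp add: indicator_def nn)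
    have S_meas [measurable]: "S \<in> borel_measurable borel"
    proof -
      have "(\<lambda>z. bn g (fst z) * indicator {\<eta>. near 2 \<eta> (k - fst z)} (snd z)) \<in> borel_measurable (count_space Zlat \<Otimes>\<^sub>M borel)"
        by (rule measurable_pair_measure_countable1[OF countable_Zlat]) simp
      from measurable_compose[OF measurable_pair_swap' this]
      have "(\<lambda>(\<eta>, l). bn g l * indicator {\<eta>. near 2 \<eta> (k - l)} \<eta>) \<in> borel_measurable (borel \<Otimes>\<^sub>M count_space Zlat)"
        by (simp add: case_prod_beta')
      then show ?thesis unfolding S_def by (rule Z.borel_measurable_nn_integral)
    qed
    have "P (conv a g) k \<le> (\<integral>\<^sup>+x. epow (\<integral>\<^sup>+\<eta>. ennreal (cmod (a \<eta>)) * ennreal (cmod (pc g (k - \<eta>) x)) \<partial>lborel) p \<partial>lborel)"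
      unfolding P_def using p0 by (intro nn_integral_mono epow_mono norm_pc_conv_le a g)
    also have "\<dots> \<le> epow (\<integral>\<^sup>+\<eta>. ennreal (cmod (a \<eta>)) * (C * S \<eta>) \<partial>lborel) p"
    proof (rule nn_integral_Minkowski)
      \<comment> \<open>Here finiteness of the lattice pieces of \<open>g\<close> enters: the proof
        of Minkowski's inequality divides by this bound.\<close>
      show "C * S \<eta> < top" for \<eta>
        using C fin Zlat_near_card[of 2 "k - \<eta>"] unfolding S_eq
        by (auto simp: ennreal_mult_less_top intro!: ennreal_sum_less_top)
      show "(\<integral>\<^sup>+x. epow (ennreal (cmod (pc g (k - \<eta>) x))) p \<partial>lborel) \<le> epow (C * S \<eta>) p" for \<eta>
      proof -
        have "epow (bn g (k - \<eta>)) p \<le> epow (C * S \<eta>) p"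
          unfolding S_eq using p0 by (intro epow_mono C g)
        then show ?thesis using p0 by (simp add: bn_def epow_epow P_def)
      qed
    qed (use p1 in \<open>auto intro: sigma_finite_lborel\<close>)
    finally have "bn (conv a g) k \<le> epow (epow (\<integral>\<^sup>+\<eta>. ennreal (cmod (a \<eta>)) * (C * S \<eta>) \<partial>lborel) p) (1/p)"
      unfolding bn_def using p0 by (intro epow_mono)
    also have "\<dots> = (\<integral>\<^sup>+\<eta>. C * (ennreal (cmod (a \<eta>)) * S \<eta>) \<partial>lborel)"
      using p0 by (simp add: epow_epow mult_ac)
    also have "\<dots> = C * (\<integral>\<^sup>+\<eta>. ennreal (cmod (a \<eta>)) * S \<eta> \<partial>lborel)"
      by (rule nn_integral_cmult) measurable
    also have "(\<integral>\<^sup>+\<eta>. ennreal (cmod (a \<eta>)) * S \<eta> \<partial>lborel)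
       = (\<integral>\<^sup>+\<eta>. (\<integral>\<^sup>+l. ennreal (cmod (a \<eta>)) * (bn g l * indicator {\<eta>. near 2 \<eta> (k - l)} \<eta>) \<partial>count_space Zlat) \<partial>lborel)"
      unfolding S_def by (intro nn_integral_cong nn_integral_cmult[symmetric]) simp
    also have "\<dots> = (\<integral>\<^sup>+l. (\<integral>\<^sup>+\<eta>. ennreal (cmod (a \<eta>)) * (bn g l * indicator {\<eta>. near 2 \<eta> (k - l)} \<eta>) \<partial>lborel) \<partial>count_space Zlat)"
      by (rule nn_integral_count_space_nn_integral[OF countable_Zlat]) measurable
    also have "\<dots> = (\<integral>\<^sup>+l. bn g l * An a (k - l) \<partial>count_space Zlat)"
    proof (intro nn_integral_cong)
      fix l
      have "(\<integral>\<^sup>+\<eta>. ennreal (cmod (a \<eta>)) * (bn g l * indicator {\<eta>. near 2 \<eta> (k - l)} \<eta>) \<partial>lborel)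
        = (\<integral>\<^sup>+\<eta>. bn g l * (ennreal (cmod (a \<eta>)) * indicator {\<eta>. near 2 \<eta> (k - l)} \<eta>) \<partial>lborel)"
        by (simp add: mult_ac)
      also have "\<dots> = bn g l * An a (k - l)"
        unfolding An_def by (rule nn_integral_cmult) measurable
      finally show "(\<integral>\<^sup>+\<eta>. ennreal (cmod (a \<eta>)) * (bn g l * indicator {\<eta>. near 2 \<eta> (k - l)} \<eta>) \<partial>lborel)
        = bn g l * An a (k - l)" .
    qed
    finally show "bn (conv a g) k \<le> C * (\<integral>\<^sup>+l. bn g l * An a (k - l) \<partial>count_space Zlat)" .
  qed (rule C)
qed

lemma near_jbr_powr:
  assumes "near r x y" "0 \<le> r"
  shows "ennreal (jbr x powr s) \<le> ennreal ((1 + r * real DIM('a)) powr s) * ennreal (jbr (y::'a) powr s)"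
proof -
  have "jbr x powr s \<le> ((1 + r * real DIM('a)) * jbr y) powr s"
    using near_jbr[OF assms] L.s0 by (intro powr_mono2) auto
  also have "\<dots> = (1 + r * real DIM('a)) powr s * jbr y powr s"
    by (rule powr_mult)
  finally show ?thesis by (simp add: ennreal_mult[symmetric] ennreal_leI)
qed

text \<open>On a cube of volume V Jensen's inequality turns local L^1 mass into local L^q mass, the
  weight varies there by a bounded factor, and each point lies in at most N of the cubes.\<close>

lemma wn_An_le: "\<exists>C<top. \<forall>a\<in>borel_measurable borel. Z.wn (An a) \<le> C * nF a"
proof -
  define V where "V = emeasure lborel {\<eta>::'a. near 2 \<eta> 0}"
  have V: "V < top" unfolding V_def by (rule emeasure_near)
  define c where "c = ennreal ((1 + 2 * real DIM('a)) powr s)"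
  define N where "N = (of_nat (Zcount TYPE('a) 2) :: ennreal)"
  have N: "N < top" by (simp add: N_def of_nat_less_top)
  show ?thesis
  proof (intro exI[of _ "epow V (q - 1) * (epow c q * N)"] conjI ballI)
    show "epow V (q - 1) * (epow c q * N) < top" using V N by (simp add: c_def ennreal_mult_less_top)
    fix a :: "'a \<Rightarrow> complex" assume [measurable]: "a \<in> borel_measurable borel"
    define F where "F \<eta> = ennreal (jbr \<eta> powr s) * ennreal (cmod (a \<eta>))" for \<eta>
    have [measurable]: "F \<in> borel_measurable borel" unfolding F_def[abs_def] by measurable
    have le: "epow (ennreal (jbr m powr s) * An a m) q
       \<le> epow V (q - 1) * (epow c q * (\<integral>\<^sup>+\<eta>. indicator {\<eta>. near 2 \<eta> m} \<eta> * epow (F \<eta>) q \<partial>lborel))" for m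
    proof -
      have "ennreal (jbr m powr s) * An a m
         = (\<integral>\<^sup>+\<eta>. ennreal (jbr m powr s) * (ennreal (cmod (a \<eta>)) * indicator {\<eta>. near 2 \<eta> m} \<eta>) \<partial>lborel)"
        unfolding An_def by (rule nn_integral_cmult[symmetric]) measurable
      also have "\<dots> \<le> (\<integral>\<^sup>+\<eta>. indicator {\<eta>. near 2 \<eta> m} \<eta> * (c * F \<eta>) \<partial>lborel)"
      proof (rule nn_integral_mono)
        fix \<eta>
        show "ennreal (jbr m powr s) * (ennreal (cmod (a \<eta>)) * indicator {\<eta>. near 2 \<eta> m} \<eta>)
           \<le> indicator {\<eta>. near 2 \<eta> m} \<eta> * (c * F \<eta>)"
        proof (cases "near 2 \<eta> m")
          case True
          then have "near 2 m \<eta>" using near_sym by blast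
          from mult_right_mono[OF near_jbr_powr[OF this], of "ennreal (cmod (a \<eta>))"] True
          show ?thesis by (simp add: c_def F_def mult.assoc)
        qed simp
      qed
      finally have "epow (ennreal (jbr m powr s) * An a m) q \<le> epow (\<integral>\<^sup>+\<eta>. indicator {\<eta>. near 2 \<eta> m} \<eta> * (c * F \<eta>) \<partial>lborel) q"
        using L.q1 by (intro epow_mono) auto
      also have "\<dots> \<le> epow (\<integral>\<^sup>+\<eta>. indicator {\<eta>. near 2 \<eta> m} \<eta> \<partial>lborel) (q - 1) *
          (\<integral>\<^sup>+\<eta>. indicator {\<eta>. near 2 \<eta> m} \<eta> * epow (c * F \<eta>) q \<partial>lborel)"
        using L.q1 by (intro nn_integral_Jensen) auto
      also have "(\<integral>\<^sup>+\<eta>. indicator {\<eta>. near 2 \<eta> m} \<eta> \<partial>lborel) = V"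
        unfolding V_def using emeasure_near_shift[of 2 m] by simp
      also have "(\<integral>\<^sup>+\<eta>. indicator {\<eta>. near 2 \<eta> m} \<eta> * epow (c * F \<eta>) q \<partial>lborel)
         = (\<integral>\<^sup>+\<eta>. epow c q * (indicator {\<eta>. near 2 \<eta> m} \<eta> * epow (F \<eta>) q) \<partial>lborel)"
        by (simp add: epow_mult mult_ac)
      also have "\<dots> = epow c q * (\<integral>\<^sup>+\<eta>. indicator {\<eta>. near 2 \<eta> m} \<eta> * epow (F \<eta>) q \<partial>lborel)"
        by (rule nn_integral_cmult) measurable
      finally show ?thesis .
    qed
    have "Z.wn (An a) \<le> (\<integral>\<^sup>+m. epow V (q - 1) * (epow c q * (\<integral>\<^sup>+\<eta>. indicator {\<eta>. near 2 \<eta> m} \<eta> * epow (F \<eta>) q \<partial>lborel)) \<partial>count_space Zlat)"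
      unfolding Z.wn_def by (intro nn_integral_mono le)
    also have "\<dots> = epow V (q - 1) * (epow c q * (\<integral>\<^sup>+m. (\<integral>\<^sup>+\<eta>. indicator {\<eta>. near 2 \<eta> m} \<eta> * epow (F \<eta>) q \<partial>lborel) \<partial>count_space Zlat))"
      by (simp add: nn_integral_cmult)
    also have "(\<integral>\<^sup>+m. (\<integral>\<^sup>+\<eta>. indicator {\<eta>. near 2 \<eta> m} \<eta> * epow (F \<eta>) q \<partial>lborel) \<partial>count_space Zlat)
       = (\<integral>\<^sup>+\<eta>. (\<integral>\<^sup>+m. indicator {\<eta>. near 2 \<eta> m} \<eta> * epow (F \<eta>) q \<partial>count_space Zlat) \<partial>lborel)"
      by (rule nn_integral_count_space_nn_integral[OF countable_Zlat, symmetric]) measurable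
    also have "\<dots> \<le> (\<integral>\<^sup>+\<eta>. N * epow (F \<eta>) q \<partial>lborel)"
    proof (rule nn_integral_mono)
      fix \<eta> :: 'a
      have "(\<integral>\<^sup>+m. indicator {\<eta>. near 2 \<eta> m} \<eta> * epow (F \<eta>) q \<partial>count_space Zlat)
         = (\<integral>\<^sup>+m. epow (F \<eta>) q * indicator {m. near 2 m \<eta>} m \<partial>count_space Zlat)"
        by (intro nn_integral_cong) (auto simp: indicator_def near_sym[of 2 \<eta>])
      also have "\<dots> = (\<Sum>l\<in>NZ 2 \<eta>. epow (F \<eta>) q)" by (rule nn_sum_near)
      also have "\<dots> \<le> N * epow (F \<eta>) q"
        unfolding N_def using Zlat_near_card[of 2 \<eta>] by (auto intro!: mult_right_mono)
      finally show "(\<integral>\<^sup>+m. indicator {\<eta>. near 2 \<eta> m} \<eta> * epow (F \<eta>) q \<partial>count_space Zlat) \<le> N * epow (F \<eta>) q" .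
    qed
    also have "\<dots> = N * nF a" unfolding nF_def L.wn_def F_def by (rule nn_integral_cmult) measurable
    finally show "Z.wn (An a) \<le> epow V (q - 1) * (epow c q * N) * nF a"
      by (simp add: mult_left_mono mult.assoc)
  qed
qed

lemma nM_finite_bn:
  assumes "nM g < top" "l \<in> Zlat"
  shows "bn g l < top"
proof -
  have "epow (ennreal (jbr l powr s) * bn g l) q = (\<integral>\<^sup>+k. epow (ennreal (jbr k powr s) * bn g k) q * indicator {l} k \<partial>count_space Zlat)"
    using assms(2) by (subst nn_integral_indicator_singleton) auto
  also have "\<dots> \<le> nM g" unfolding nM_def Z.wn_def
    by (intro nn_integral_mono) (auto simp: indicator_def)
  also have "\<dots> < top" by (rule assms(1))
  finally have "ennreal (jbr l powr s) * bn g l < top" by (simp only: epow_less_top_iff)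
  moreover have "bn g l \<le> ennreal (jbr l powr s) * bn g l" by (rule Z.le_weighted)
  ultimately show ?thesis by (rule le_less_trans[rotated])
qed

text \<open>The lattice algebra property is applied to \<open>bn g\<close> and \<open>An a\<close>,
  after which \<open>wn_An_le\<close> returns from \<open>An a\<close> to \<open>nF a\<close>.
  Finiteness of \<open>nM g\<close> supplies the finite pieces that \<open>bn_conv_le\<close> asks
  for.\<close>

lemma nM_conv:
  "\<exists>C<top. \<forall>a g. integrable lborel a \<longrightarrow> integrable lborel g \<longrightarrow> nM g < top \<longrightarrow>
     nM (conv a g) \<le> C * nM g * nF a"
proof -
  obtain C1 where C1: "C1 < top" and H: "\<forall>a g. integrable lborel a \<longrightarrow> integrable lborel g \<longrightarrow> (\<forall>l\<in>Zlat. bn g l < top) \<longrightarrow>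
     (\<forall>k. bn (conv a g) k \<le> C1 * (\<integral>\<^sup>+l. bn g l * An a (k - l) \<partial>count_space Zlat))"
    using bn_conv_le by (elim exE conjE)
  obtain C2 where C2: "C2 < top" "\<And>u v. Z.wn (\<lambda>x. \<integral>\<^sup>+y. u y * v (x - y) \<partial>count_space Zlat) \<le> C2 * Z.wn u * Z.wn v"
    using Z.conv_wn by auto
  obtain C3 where C3: "C3 < top" "\<And>a. a \<in> borel_measurable borel \<Longrightarrow> Z.wn (An a) \<le> C3 * nF a"
    using wn_An_le by blast
  show ?thesis
  proof (intro exI[of _ "epow C1 q * C2 * C3"] conjI allI impI)
    show "epow C1 q * C2 * C3 < top" using C1 C2 C3 by (simp add: ennreal_mult_less_top)
    fix a g :: "'a \<Rightarrow> complex" assume a: "integrable lborel a" and g: "integrable lborel g" and fin: "nM g < top"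
    have [measurable]: "a \<in> borel_measurable borel" using a by auto
    have "nM (conv a g) \<le> Z.wn (\<lambda>k. C1 * (\<integral>\<^sup>+l. bn g l * An a (k - l) \<partial>count_space Zlat))"
      unfolding nM_def using nM_finite_bn[OF fin] by (intro Z.wn_mono H[rule_format] a g)
    also have "\<dots> = epow C1 q * Z.wn (\<lambda>k. \<integral>\<^sup>+l. bn g l * An a (k - l) \<partial>count_space Zlat)"
      by (rule Z.wn_cmult) simp
    also have "\<dots> \<le> epow C1 q * (C2 * nM g * Z.wn (An a))"
      unfolding nM_def by (intro mult_left_mono C2) auto
    also have "\<dots> \<le> epow C1 q * (C2 * nM g * (C3 * nF a))"
      by (intro mult_left_mono C3) auto
    finally show "nM (conv a g) \<le> epow C1 q * C2 * C3 * nM g * nF a" by (simp add: mult_ac)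
  qed
qed

section \<open>The approximate unit on the Fourier side\<close>

definition \<phi>0 :: "'a \<Rightarrow> complex" where
  "\<phi>0 \<xi> = inverse (\<integral>x. \<phi> x \<partial>lborel) * \<phi> \<xi>"

text \<open>The dilation factor j + 1 is at least 1, so all kernels keep their support in the unit
  cube.\<close>

definition rho :: "nat \<Rightarrow> 'a \<Rightarrow> complex" where
  "rho j = dilate (real (Suc j)) \<phi>0"

definition K0 :: real where "K0 = (\<integral>x. cmod (\<phi>0 x) \<partial>lborel)"

lemma \<phi>0_int: "integrable lborel \<phi>0"
  unfolding \<phi>0_def[abs_def] using \<phi>_int by simp

lemma \<phi>0_meas [measurable]: "\<phi>0 \<in> borel_measurable borel" using \<phi>0_int by auto

lemma \<phi>0_integral: "(\<integral>x. \<phi>0 x \<partial>lborel) = 1"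
  unfolding \<phi>0_def using window_integral_nonzero[OF win] by simp

lemma K0_nonneg: "0 \<le> K0" unfolding K0_def by (rule Bochner_Integration.integral_nonneg) simp

lemma rho_int: "integrable lborel (rho j)"
  unfolding rho_def by (rule integrable_dilate[OF \<phi>0_int]) simp

lemma rho_meas [measurable]: "rho j \<in> borel_measurable borel" using rho_int by auto

lemma rho_supp: "rho j \<xi> \<noteq> 0 \<Longrightarrow> near 1 \<xi> 0"
proof -
  assume "rho j \<xi> \<noteq> 0"
  then have n: "near 1 (real (Suc j) *\<^sub>R \<xi>) 0"
    using \<phi>_supp[of "real (Suc j) *\<^sub>R \<xi>" 0] by (auto simp: rho_def dilate_def \<phi>0_def)
  show ?thesis unfolding near_def
  proof
    fix b :: 'a assume b: "b \<in> Basis"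
    have "real (Suc j) * \<bar>\<xi> \<bullet> b\<bar> \<le> 1" using n b by (auto simp: near_def abs_mult)
    moreover have "1 * \<bar>\<xi> \<bullet> b\<bar> \<le> real (Suc j) * \<bar>\<xi> \<bullet> b\<bar>" by (intro mult_right_mono) auto
    ultimately show "\<bar>(\<xi> - 0) \<bullet> b\<bar> \<le> 1" by simp
  qed
qed

lemma rho_norm_integral: "(\<integral>x. cmod (rho j x) \<partial>lborel) = K0"
proof -
  have "K0 = \<bar>real (Suc j)\<bar> ^ DIM('a) *\<^sub>R (\<integral>x. cmod (\<phi>0 (0 + real (Suc j) *\<^sub>R x)) \<partial>lborel)"
    unfolding K0_def by (rule lborel_integral_affine) auto
  also have "\<dots> = (\<integral>x. cmod (rho j x) \<partial>lborel)"
    by (simp add: rho_def dilate_def norm_mult norm_power del: of_nat_Suc)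
  finally show ?thesis by simp
qed

lemma rho_nn_integral: "(\<integral>\<^sup>+x. ennreal (cmod (rho j x)) \<partial>lborel) = ennreal K0"
  unfolding rho_norm_integral[of j, symmetric]
  by (rule nn_integral_eq_integral) (use rho_int in auto)

lemma ft_rho: "ft (rho j) x = ft \<phi>0 (x /\<^sub>R real (Suc j))"
proof -
  have "ft (rho j) x = (\<integral>z. \<phi>0 z * cis (x \<bullet> (z /\<^sub>R real (Suc j))) \<partial>lborel)"
    unfolding ft_def rho_def by (rule integral_dilate) auto
  then show ?thesis by (simp add: ft_def)
qed

lemma ft_rho_le: "cmod (ft (rho j) x) \<le> K0"
  using norm_ft_le[of "rho j" x] by (simp add: rho_norm_integral)

lemma ft_rho_int: "integrable lborel (ft (rho j))"
proof -
  have "ft \<phi>0 = (\<lambda>x. inverse (\<integral>x. \<phi> x \<partial>lborel) * ft \<phi> x)"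
    unfolding \<phi>0_def[abs_def] by (intro ext ft_cmult)
  then have "integrable lborel (ft \<phi>0)" using ft\<phi>_int by simp
  from lborel_integrable_affine[OF this, of "inverse (real (Suc j))" 0]
  show ?thesis by (simp add: ft_rho[abs_def] del: of_nat_Suc)
qed

lemma ft_rho_tendsto: "(\<lambda>j. ft (rho j) x) \<longlonglongrightarrow> 1"
proof -
  have "(\<lambda>j. inverse (real (Suc j)) *\<^sub>R x) \<longlonglongrightarrow> 0 *\<^sub>R x"
    by (intro tendsto_intros LIMSEQ_inverse_real_of_nat)
  then have "(\<lambda>j. x /\<^sub>R real (Suc j)) \<longlonglongrightarrow> 0" by simp
  from isCont_tendsto_compose[OF isCont_ft[OF \<phi>0_int] this]
  have "(\<lambda>j. ft \<phi>0 (x /\<^sub>R real (Suc j))) \<longlonglongrightarrow> ft \<phi>0 0" .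
  moreover have "ft \<phi>0 0 = 1" using \<phi>0_integral by (simp add: ft_def)
  ultimately show ?thesis by (simp add: ft_rho del: of_nat_Suc)
qed

lemma rho_bounded: "\<exists>B. \<forall>x. cmod (rho j x) \<le> B"
proof (intro exI allI)
  fix x
  have "cmod (\<phi> y) \<le> B\<phi>" for y by (rule B\<phi>)
  then show "cmod (rho j x) \<le> real (Suc j) ^ DIM('a) * (cmod (inverse (\<integral>x. \<phi> x \<partial>lborel)) * B\<phi>)"
    unfolding rho_def dilate_def \<phi>0_def
    by (simp add: norm_mult norm_power mult_left_mono del: of_nat_Suc)
qed

text \<open>Multiplication by a band-limited integrable function maps \<open>M\<close> continuously into \<open>FL\<close>:
  on each unit cube the transform is bounded by the \<open>L\<^sup>p\<close> norms of nearby pieces. This replaces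
  the Hausdorff--Young embedding \<open>M \<subseteq> FL\<close>.\<close>

lemma norm_conv_le_ft:
  fixes a :: "'a \<Rightarrow> complex"
  assumes a: "integrable lborel a" and fa: "integrable lborel (ft a)"
  shows "\<exists>C<top. \<forall>h. integrable lborel h \<longrightarrow>
     (AE \<xi> in lborel. ennreal (cmod (conv a h \<xi>)) \<le> C * epow (\<integral>\<^sup>+x. epow (ennreal (cmod (ft h x))) p \<partial>lborel) (1/p))"
proof -
  obtain c where c: "\<And>g :: 'a \<Rightarrow> complex. integrable lborel g \<Longrightarrow> integrable lborel (ft g) \<Longrightarrow>
     (AE y in lborel. g y = c * ft (\<lambda>\<eta>. ft g (- \<eta>)) y)" using inversion by blast
  have [measurable]: "a \<in> borel_measurable borel" using a by auto
  define A where "A = (\<integral>\<^sup>+x. ennreal (cmod (ft a x)) \<partial>lborel)"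
  have A: "A < top" using fa by (simp add: A_def integrable_iff_bounded)
  define N where "N = (\<integral>x. cmod (a x) \<partial>lborel)"
  define C where "C = ennreal (cmod c) * epow (epow A (p - 1) * ennreal N) (1/p)"
  have p0: "p \<noteq> 0" "0 \<le> p" "0 \<le> 1/p" using p1 by auto
  show ?thesis
  proof (intro exI[of _ C] conjI allI impI)
    show "C < top" unfolding C_def using A by (simp add: ennreal_mult_less_top)
    fix h :: "'a \<Rightarrow> complex" assume h: "integrable lborel h"
    then have [measurable]: "h \<in> borel_measurable borel" by auto
    define u where "u = conv a h"
    have u: "integrable lborel u" unfolding u_def by (rule integrable_conv[OF a h])
    have ftu: "ft u x = ft a x * ft h x" for x unfolding u_def by (rule ft_conv[OF a h])
    have fu: "integrable lborel (ft u)" unfolding ftu[abs_def]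
      by (rule integrable_mult_bounded[OF fa, of _ "\<integral>x. cmod (h x) \<partial>lborel"]) (auto simp: norm_ft_le)
    then have [measurable]: "ft u \<in> borel_measurable borel" by auto
    define X where "X = (\<integral>\<^sup>+x. epow (ennreal (cmod (ft h x))) p \<partial>lborel)"
    define I where "I = (\<integral>\<^sup>+x. ennreal (cmod (ft a x)) * ennreal (cmod (ft h x)) \<partial>lborel)"
    \<comment> \<open>Jensen with weight |ft a|, whose remaining copy is then bounded by N. Being
      bounded and integrable, \<open>ft a\<close> thus plays the role of an L^(p') factor in
      Hoelder's inequality.\<close>
    have "epow I p \<le> epow A (p - 1) * (\<integral>\<^sup>+x. ennreal (cmod (ft a x)) * epow (ennreal (cmod (ft h x))) p \<partial>lborel)"
      unfolding I_def A_def using p1 by (intro nn_integral_Jensen) auto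
    also have "\<dots> \<le> epow A (p - 1) * (\<integral>\<^sup>+x. ennreal N * epow (ennreal (cmod (ft h x))) p \<partial>lborel)"
      unfolding N_def by (intro mult_left_mono nn_integral_mono mult_right_mono ennreal_leI norm_ft_le) auto
    also have "\<dots> = epow A (p - 1) * ennreal N * X" by (simp add: X_def nn_integral_cmult mult.assoc)
    finally have "epow (epow I p) (1/p) \<le> epow (epow A (p - 1) * ennreal N * X) (1/p)"
      using p0 by (intro epow_mono)
    then have I: "I \<le> epow (epow A (p - 1) * ennreal N) (1/p) * epow X (1/p)"
      using p0 by (simp add: epow_epow epow_mult)
    \<comment> \<open>Inversion bounds |u| almost everywhere by |c| times the L^1 norm of ft u = ft
      a ft h, which is \<open>I\<close>.\<close>
    have "AE \<xi> in lborel. u \<xi> = c * ft (\<lambda>\<eta>. ft u (- \<eta>)) \<xi>" by (rule c[OF u fu])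
    then show "AE \<xi> in lborel. ennreal (cmod (conv a h \<xi>)) \<le> C * epow (\<integral>\<^sup>+x. epow (ennreal (cmod (ft h x))) p \<partial>lborel) (1/p)"
    proof eventually_elim
      case (elim \<xi>)
      have "ennreal (cmod (ft (\<lambda>\<eta>. ft u (- \<eta>)) \<xi>)) \<le> (\<integral>\<^sup>+\<eta>. (\<lambda>\<eta>. ennreal (cmod (ft u \<eta>))) (0 - \<eta>) \<partial>lborel)"
        unfolding ft_def[of "\<lambda>\<eta>. ft u (- \<eta>)"]
        by (rule order_trans[OF norm_integral_le_nn]) (simp add: norm_mult)
      also have "\<dots> = (\<integral>\<^sup>+\<eta>. ennreal (cmod (ft u \<eta>)) \<partial>lborel)"
        by (rule nn_integral_lborel_reflect) measurable
      also have "\<dots> = I" unfolding I_def ftu by (simp add: norm_mult ennreal_mult)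
      finally have "ennreal (cmod c) * ennreal (cmod (ft (\<lambda>\<eta>. ft u (- \<eta>)) \<xi>)) \<le> ennreal (cmod c) * I"
        by (rule mult_left_mono) simp
      then have "ennreal (cmod (u \<xi>)) \<le> ennreal (cmod c) * I"
        using elim by (simp add: norm_mult ennreal_mult)
      also have "\<dots> \<le> ennreal (cmod c) * (epow (epow A (p - 1) * ennreal N) (1/p) * epow X (1/p))"
        by (intro mult_left_mono I) simp
      finally show ?case by (simp add: u_def C_def X_def mult.assoc)
    qed
  qed
qed

lemma nF_conv_nM:
  fixes a :: "'a \<Rightarrow> complex"
  assumes a: "integrable lborel a" and fa: "integrable lborel (ft a)"
    and supp: "\<And>\<xi>. a \<xi> \<noteq> 0 \<Longrightarrow> near 1 \<xi> 0"
  shows "\<exists>C<top. \<forall>g. integrable lborel g \<longrightarrow> nF (conv a g) \<le> C * nM g"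
proof -
  obtain C1 where C1: "C1 < top" and H: "\<forall>h. integrable lborel h \<longrightarrow>
     (AE \<xi> in lborel. ennreal (cmod (conv a h \<xi>)) \<le> C1 * epow (\<integral>\<^sup>+x. epow (ennreal (cmod (ft h x))) p \<partial>lborel) (1/p))"
    using norm_conv_le_ft[OF a fa] by (elim exE conjE)
  define N where "N = (of_nat (Zcount TYPE('a) 2) :: ennreal)"
  have N: "N < top" by (simp add: N_def of_nat_less_top)
  define c2 where "c2 = ennreal ((1 + 2 * real DIM('a)) powr s)"
  define V where "V = emeasure lborel {x::'a. near 2 x 0}"
  have V: "V < top" unfolding V_def by (rule emeasure_near)
  define D where "D = epow N q * epow (C1 * c2) q"
  have D: "D < top" using N C1 by (simp add: D_def c2_def ennreal_mult_less_top)
  show ?thesis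
  proof (intro exI[of _ "D * V"] conjI allI impI)
    show "D * V < top" using D V by (simp add: ennreal_mult_less_top)
    fix g :: "'a \<Rightarrow> complex" assume g: "integrable lborel g"
    then have [measurable]: "g \<in> borel_measurable borel" by auto
    have [measurable]: "a \<in> borel_measurable borel" using a by auto
    define v where "v l = ennreal (jbr l powr s) * bn g l" for l
    have "AE \<xi> in lborel. ennreal (cmod (conv a (loc g l) \<xi>)) \<le> C1 * bn g l" for l
      using H[rule_format, OF loc_int[OF g, of l]] by (simp add: bn_def P_def pc_def)
    then have "AE \<xi> in lborel. \<forall>l\<in>Zlat. ennreal (cmod (conv a (loc g l) \<xi>)) \<le> C1 * bn g l"
      by (subst AE_ball_countable[OF countable_Zlat]) auto
    then have ae: "AE \<xi> in lborel. epow (ennreal (jbr \<xi> powr s) * ennreal (cmod (conv a g \<xi>))) q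
        \<le> D * (\<Sum>l\<in>NZ 2 \<xi>. epow (v l) q)"
      using AE_integrable_conv[OF a g]
    proof eventually_elim
      case (elim \<xi>)
      have fin: "finite (NZ 2 \<xi>)" and card: "card (NZ 2 \<xi>) \<le> Zcount TYPE('a) 2"
        using Zlat_near_card[of 2 \<xi>] by auto
      \<comment> \<open>Only arguments \<xi> - y within distance 1 of \<xi> matter, because
        \<open>a\<close> is supported in the unit cube; for these the windows within distance 2 of
        \<xi> sum to 1.\<close>
      have "conv a g \<xi> = (\<integral>y. (\<Sum>l\<in>NZ 2 \<xi>. a y * loc g l (\<xi> - y)) \<partial>lborel)"
        unfolding conv_def
      proof (intro Bochner_Integration.integral_cong refl)
        fix y
        show "a y * g (\<xi> - y) = (\<Sum>l\<in>NZ 2 \<xi>. a y * loc g l (\<xi> - y))"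
        proof (cases "a y = 0")
          case False
          then have n: "near 1 \<xi> (\<xi> - y)" using supp[of y] by (simp add: near_def)
          have "(\<Sum>l\<in>NZ 2 \<xi>. \<phi> (\<xi> - y - l)) = 1"
          proof (rule window_sum[OF win fin])
            fix l assume "l \<in> Zlat" "near 1 (\<xi> - y) l"
            then show "l \<in> NZ 2 \<xi>" using near_trans[OF n, of 1 l] near_sym[of 2 \<xi> l] by simp
          qed auto
          then have "(\<Sum>l\<in>NZ 2 \<xi>. loc g l (\<xi> - y)) = g (\<xi> - y)"
            by (simp add: loc_def sum_distrib_right[symmetric])
          then show ?thesis by (simp add: sum_distrib_left[symmetric])
        qed simp
      qed
      also have "\<dots> = (\<Sum>l\<in>NZ 2 \<xi>. conv a (loc g l) \<xi>)"
        unfolding conv_def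
      proof (rule Bochner_Integration.integral_sum)
        fix l
        have "integrable lborel (\<lambda>y. (a y * g (\<xi> - y)) * \<phi> (\<xi> - y - l))"
          by (rule integrable_mult_bounded[OF elim(2), of _ B\<phi>]) (auto simp: B\<phi>)
        then show "integrable lborel (\<lambda>y. a y * loc g l (\<xi> - y))" by (simp add: loc_def mult_ac)
      qed
      finally have "ennreal (cmod (conv a g \<xi>)) \<le> (\<Sum>l\<in>NZ 2 \<xi>. ennreal (cmod (conv a (loc g l) \<xi>)))"
        by (simp add: ennreal_leI norm_sum)
      also have "\<dots> \<le> (\<Sum>l\<in>NZ 2 \<xi>. C1 * bn g l)" using elim(1) by (intro sum_mono) auto
      finally have "ennreal (jbr \<xi> powr s) * ennreal (cmod (conv a g \<xi>))
        \<le> ennreal (jbr \<xi> powr s) * (\<Sum>l\<in>NZ 2 \<xi>. C1 * bn g l)" by (rule mult_left_mono) simp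
      also have "\<dots> \<le> (\<Sum>l\<in>NZ 2 \<xi>. C1 * c2 * v l)"
        unfolding sum_distrib_left
      proof (rule sum_mono)
        fix l assume "l \<in> NZ 2 \<xi>"
        then have "near 2 \<xi> l" using near_sym[of 2 \<xi> l] by simp
        from mult_right_mono[OF near_jbr_powr[OF this], of "C1 * bn g l"]
        show "ennreal (jbr \<xi> powr s) * (C1 * bn g l) \<le> C1 * c2 * v l"
          by (simp add: c2_def v_def mult_ac)
      qed
      finally have "epow (ennreal (jbr \<xi> powr s) * ennreal (cmod (conv a g \<xi>))) q \<le> epow (\<Sum>l\<in>NZ 2 \<xi>. C1 * c2 * v l) q"
        using L.q1 by (intro epow_mono) auto
      also have "\<dots> \<le> epow (of_nat (card (NZ 2 \<xi>))) q * (\<Sum>l\<in>NZ 2 \<xi>. epow (C1 * c2 * v l) q)"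
        using L.q1 fin by (intro epow_sum_le) auto
      also have "\<dots> \<le> epow N q * (\<Sum>l\<in>NZ 2 \<xi>. epow (C1 * c2 * v l) q)"
        unfolding N_def using L.q1 card by (intro mult_right_mono epow_mono) auto
      also have "\<dots> = D * (\<Sum>l\<in>NZ 2 \<xi>. epow (v l) q)"
        by (simp add: D_def epow_mult sum_distrib_left mult_ac)
      finally show ?case .
    qed
    \<comment> \<open>The finite sum is written over the whole lattice so that Fubini applies; each
      l then contributes on a cube of volume V.\<close>
    have "nF (conv a g) \<le> (\<integral>\<^sup>+\<xi>. D * (\<integral>\<^sup>+l. epow (v l) q * indicator {\<xi>. near 2 \<xi> l} \<xi> \<partial>count_space Zlat) \<partial>lborel)"
      unfolding nF_def L.wn_def
    proof (rule nn_integral_mono_AE, use ae in eventually_elim)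
      case (elim \<xi>)
      have "(\<integral>\<^sup>+l. epow (v l) q * indicator {\<xi>. near 2 \<xi> l} \<xi> \<partial>count_space Zlat)
        = (\<integral>\<^sup>+l. epow (v l) q * indicator {l. near 2 l \<xi>} l \<partial>count_space Zlat)"
        by (intro nn_integral_cong) (simp add: indicator_def near_sym[of 2 \<xi>])
      then show ?case using elim by (simp add: nn_sum_near)
    qed
    also have "\<dots> = (\<integral>\<^sup>+\<xi>. (\<integral>\<^sup>+l. D * (epow (v l) q * indicator {\<xi>. near 2 \<xi> l} \<xi>) \<partial>count_space Zlat) \<partial>lborel)"
      by (intro nn_integral_cong nn_integral_cmult[symmetric]) simp
    also have "\<dots> = (\<integral>\<^sup>+l. (\<integral>\<^sup>+\<xi>. D * (epow (v l) q * indicator {\<xi>. near 2 \<xi> l} \<xi>) \<partial>lborel) \<partial>count_space Zlat)"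
      by (rule nn_integral_count_space_nn_integral[OF countable_Zlat]) measurable
    also have "\<dots> = (\<integral>\<^sup>+l. D * V * epow (v l) q \<partial>count_space Zlat)"
    proof (intro nn_integral_cong)
      fix l
      have "(\<integral>\<^sup>+\<xi>. D * (epow (v l) q * indicator {\<xi>. near 2 \<xi> l} \<xi>) \<partial>lborel)
        = (\<integral>\<^sup>+\<xi>. D * epow (v l) q * indicator {\<xi>. near 2 \<xi> l} \<xi> \<partial>lborel)"
        by (simp only: mult.assoc)
      also have "\<dots> = D * epow (v l) q * emeasure lborel {\<xi>::'a. near 2 \<xi> l}"
        by (rule nn_integral_cmult_indicator) measurable
      finally show "(\<integral>\<^sup>+\<xi>. D * (epow (v l) q * indicator {\<xi>. near 2 \<xi> l} \<xi>) \<partial>lborel) = D * V * epow (v l) q"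
        unfolding V_def emeasure_near_shift[of 2 l] by (simp only: mult_ac)
    qed
    also have "\<dots> = D * V * nM g" unfolding nM_def Z.wn_def v_def by (rule nn_integral_cmult) simp
    finally show "nF (conv a g) \<le> D * V * nM g" .
  qed
qed

text \<open>For functions with a common bound and a common support, L^1 convergence implies weighted
  L^q convergence: the weight is bounded on the support, and the q-th power is at most B^(q-1) times
  the first power.\<close>

lemma nF_bounded_supp:
  assumes r: "0 \<le> r"
  shows "\<exists>C<top. \<forall>g\<in>borel_measurable borel. (\<forall>x. ennreal (cmod (g x)) \<le> ennreal B) \<longrightarrow> (\<forall>x. g x \<noteq> 0 \<longrightarrow> near r x 0) \<longrightarrow>
     nF g \<le> C * (\<integral>\<^sup>+x. ennreal (cmod (g x)) \<partial>lborel)"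
proof -
  define c where "c = ennreal ((1 + r * real DIM('a)) powr s)"
  show ?thesis
  proof (intro exI[of _ "epow c q * epow (ennreal B) (q - 1)"] conjI ballI impI)
    show "epow c q * epow (ennreal B) (q - 1) < top" by (simp add: c_def ennreal_mult_less_top)
    fix g :: "'a \<Rightarrow> complex" assume [measurable]: "g \<in> borel_measurable borel"
      and B: "\<forall>x. ennreal (cmod (g x)) \<le> ennreal B" and supp: "\<forall>x. g x \<noteq> 0 \<longrightarrow> near r x 0"
    have "nF g \<le> (\<integral>\<^sup>+x. epow c q * epow (ennreal B) (q - 1) * ennreal (cmod (g x)) \<partial>lborel)"
      unfolding nF_def L.wn_def
    proof (rule nn_integral_mono)
      fix x
      have "ennreal (jbr x powr s) * ennreal (cmod (g x)) \<le> c * ennreal (cmod (g x))"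
      proof (cases "g x = 0")
        case False
        then have "near r x 0" using supp by auto
        from near_jbr_powr[OF this r] show ?thesis
          by (intro mult_right_mono) (auto simp: c_def jbr_def)
      qed simp
      then have "epow (ennreal (jbr x powr s) * ennreal (cmod (g x))) q \<le> epow c q * epow (ennreal (cmod (g x))) q"
        unfolding epow_mult[of c, symmetric] using L.q1 by (intro epow_mono) auto
      also have "\<dots> \<le> epow c q * (epow (ennreal B) (q - 1) * ennreal (cmod (g x)))"
        using L.q1 B by (intro mult_left_mono epow_le_bound) auto
      finally show "epow (ennreal (jbr x powr s) * ennreal (cmod (g x))) q
        \<le> epow c q * epow (ennreal B) (q - 1) * ennreal (cmod (g x))" by (simp add: mult.assoc)
    qed
    then show "nF g \<le> epow c q * epow (ennreal B) (q - 1) * (\<integral>\<^sup>+x. ennreal (cmod (g x)) \<partial>lborel)"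
      by (simp add: nn_integral_cmult)
  qed
qed

section \<open>Bounds for the approximate unit in both norms\<close>

lemma nF_rho_finite: "nF (rho j) < top"
proof -
  obtain B where B: "\<And>x. cmod (rho j x) \<le> B" using rho_bounded by blast
  obtain C where C: "C < top" and H: "\<forall>g\<in>borel_measurable borel. (\<forall>x. ennreal (cmod (g x)) \<le> ennreal B) \<longrightarrow> (\<forall>x. g x \<noteq> 0 \<longrightarrow> near 1 x 0) \<longrightarrow>
     nF g \<le> C * (\<integral>\<^sup>+x. ennreal (cmod (g x)) \<partial>lborel)"
    using nF_bounded_supp[of 1 B] by auto
  have "nF (rho j) \<le> C * (\<integral>\<^sup>+x. ennreal (cmod (rho j x)) \<partial>lborel)"
    using B rho_supp by (intro H[rule_format]) (auto simp: ennreal_leI)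
  also have "\<dots> < top" using C by (simp add: rho_nn_integral ennreal_mult_less_top)
  finally show ?thesis .
qed

text \<open>Only windows centred within distance 2 of 0 meet the support of \<open>rho j\<close>,
  and each piece is in L^p because \<open>ft (rho j)\<close> is bounded and integrable.\<close>

lemma nM_rho_finite: "nM (rho j) < top"
proof -
  obtain C where C: "C < top" "\<And>h k. integrable lborel h \<Longrightarrow> P h k \<le> C * (\<integral>\<^sup>+x. epow (ennreal (cmod (ft h x))) p \<partial>lborel)"
    using P_le by blast
  define X where "X = (\<integral>\<^sup>+x. epow (ennreal (cmod (ft (rho j) x))) p \<partial>lborel)"
  have "X \<le> (\<integral>\<^sup>+x. epow (ennreal K0) (p - 1) * ennreal (cmod (ft (rho j) x)) \<partial>lborel)"
    unfolding X_def by (intro nn_integral_mono epow_le_bound ennreal_leI ft_rho_le p1)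
  also have "\<dots> < top" using ft_rho_int[of j]
    by (simp add: nn_integral_cmult ennreal_mult_less_top integrable_iff_bounded)
  finally have X: "X < top" .
  define D where "D = epow (C * X) (1/p)"
  have D: "D < top" using C X by (simp add: D_def ennreal_mult_less_top)
  have le: "bn (rho j) k \<le> D * indicator {k. near 2 k 0} k" for k
  proof (cases "near 2 k 0")
    case True
    have "bn (rho j) k \<le> D" unfolding bn_def D_def X_def using p1
      by (intro epow_mono C rho_int) auto
    then show ?thesis using True by simp
  next
    case False
    have "loc (rho j) k = (\<lambda>_. 0)"
    proof
      fix \<xi>
      have "\<not> (near 1 k \<xi> \<and> near 1 \<xi> 0)" using near_trans[of 1 k \<xi> 1 0] False by auto
      then show "loc (rho j) k \<xi> = 0"
        using \<phi>_supp[of \<xi> k] rho_supp[of j \<xi>] near_sym[of 1 k \<xi>] by (auto simp: loc_def)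
    qed
    then show ?thesis by (simp add: bn_def P_def pc_def ft_def)
  qed
  have "nM (rho j) \<le> (\<integral>\<^sup>+(k::'a). epow (ennreal (jbr k powr s) * D) q * indicator {k. near 2 k 0} k \<partial>count_space Zlat)"
    unfolding nM_def Z.wn_def
  proof (rule nn_integral_mono)
    fix k
    have "epow (ennreal (jbr k powr s) * bn (rho j) k) q \<le> epow (ennreal (jbr k powr s) * (D * indicator {k. near 2 k 0} k)) q"
      using L.q1 by (intro epow_mono mult_left_mono le) auto
    also have "\<dots> = epow (ennreal (jbr k powr s) * D) q * indicator {k. near 2 k 0} k"
      by (simp add: indicator_def)
    finally show "epow (ennreal (jbr k powr s) * bn (rho j) k) q
      \<le> epow (ennreal (jbr k powr s) * D) q * indicator {k. near 2 k 0} k" .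
  qed
  also have "\<dots> < top" unfolding nn_sum_near using D Zlat_near_card[of 2 "0::'a"]
    by (intro ennreal_sum_less_top) (auto simp: ennreal_mult_less_top)
  finally show ?thesis .
qed

text \<open>The constant must not depend on j. The bound \<open>nF_conv\<close> would contain
  \<open>nF (rho j)\<close>, which grows with j when q > 1. Instead the common support makes the
  weights at x and x - y comparable, and Young's inequality sees only the common L^1 norm
  \<open>K0\<close>.\<close>

lemma nF_conv_rho_le:
  "\<exists>C<top. \<forall>j. \<forall>h\<in>borel_measurable borel. nF (conv (rho j) h) \<le> C * nF h"
proof -
  define c where "c = ennreal ((1 + 1 * real DIM('a)) powr s)"
  show ?thesis
  proof (intro exI[of _ "epow (ennreal K0) q * epow c q"] conjI allI ballI)
    show "epow (ennreal K0) q * epow c q < top" by (simp add: c_def ennreal_mult_less_top)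
    fix j and h :: "'a \<Rightarrow> complex" assume [measurable]: "h \<in> borel_measurable borel"
    define v where "v x = c * (ennreal (jbr x powr s) * ennreal (cmod (h x)))" for x
    have [measurable]: "v \<in> borel_measurable borel" unfolding v_def[abs_def] by measurable
    have "nF (conv (rho j) h) \<le> (\<integral>\<^sup>+x. epow (\<integral>\<^sup>+y. ennreal (cmod (rho j y)) * v (x - y) \<partial>lborel) q \<partial>lborel)"
      unfolding nF_def L.wn_def
    proof (intro nn_integral_mono epow_mono)
      fix x
      have "ennreal (jbr x powr s) * ennreal (cmod (conv (rho j) h x))
        \<le> ennreal (jbr x powr s) * (\<integral>\<^sup>+y. ennreal (cmod (rho j y)) * ennreal (cmod (h (x - y))) \<partial>lborel)"
        by (intro mult_left_mono norm_conv_le) simp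
      also have "\<dots> = (\<integral>\<^sup>+y. ennreal (jbr x powr s) * (ennreal (cmod (rho j y)) * ennreal (cmod (h (x - y)))) \<partial>lborel)"
        by (rule nn_integral_cmult[symmetric]) measurable
      also have "\<dots> \<le> (\<integral>\<^sup>+y. ennreal (cmod (rho j y)) * v (x - y) \<partial>lborel)"
      proof (rule nn_integral_mono)
        fix y
        show "ennreal (jbr x powr s) * (ennreal (cmod (rho j y)) * ennreal (cmod (h (x - y)))) \<le> ennreal (cmod (rho j y)) * v (x - y)"
        proof (cases "rho j y = 0")
          case False
          then have "near 1 x (x - y)" using rho_supp[of j y] by (simp add: near_def)
          from mult_right_mono[OF near_jbr_powr[OF this], of "ennreal (cmod (rho j y)) * ennreal (cmod (h (x - y)))"]
          show ?thesis by (simp add: v_def c_def mult_ac)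
        qed simp
      qed
      finally show "ennreal (jbr x powr s) * ennreal (cmod (conv (rho j) h x)) \<le> (\<integral>\<^sup>+y. ennreal (cmod (rho j y)) * v (x - y) \<partial>lborel)" .
    qed (use L.q1 in auto)
    also have "\<dots> \<le> epow (\<integral>\<^sup>+x. ennreal (cmod (rho j x)) \<partial>lborel) q * (\<integral>\<^sup>+x. epow (v x) q \<partial>lborel)"
      using L.q1 by (intro L.Young_conv) auto
    also have "(\<integral>\<^sup>+x. epow (v x) q \<partial>lborel) = epow c q * nF h"
      unfolding v_def nF_def L.wn_def epow_mult[of c] by (rule nn_integral_cmult) measurable
    finally show "nF (conv (rho j) h) \<le> epow (ennreal K0) q * epow c q * nF h"
      by (simp add: rho_nn_integral mult.assoc)
  qed
qed

section \<open>Convergence of the approximate unit in both norms\<close>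

lemma nF_minus:
  assumes "g \<in> borel_measurable borel" "h \<in> borel_measurable borel"
  shows "nF (\<lambda>x. g x - h x) \<le> epow 2 q * (nF g + nF h)"
  using nF_add_le[of g "\<lambda>x. (- 1) * h x"] nF_cmult[of h "- 1"] assms by simp

text \<open>A density argument: for truncations the L^1 approximate identity suffices by
  \<open>nF_bounded_supp\<close>, and the uniform bound \<open>nF_conv_rho_le\<close> controls what
  truncation leaves out.\<close>

lemma nF_conv_rho_tendsto:
  assumes g: "integrable lborel g" and fin: "nF g < top"
  shows "(\<lambda>j. nF (\<lambda>\<xi>. conv (rho j) g \<xi> - g \<xi>)) \<longlonglongrightarrow> 0"
proof -
  have [measurable]: "g \<in> borel_measurable borel" using g by auto
  define T where "T n \<xi> = (if cmod (g \<xi>) \<le> real n \<and> near (real n) \<xi> 0 then g \<xi> else 0)" for n :: nat and \<xi>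
  have [measurable]: "T n \<in> borel_measurable borel" for n unfolding T_def[abs_def] by measurable
  have T_int: "integrable lborel (T n)" for n
    by (rule Bochner_Integration.integrable_bound[OF g]) (auto simp: T_def)
  have T_lim: "(\<lambda>n. nF (\<lambda>\<xi>. g \<xi> - T n \<xi>)) \<longlonglongrightarrow> 0"
  proof -
    have "(\<lambda>n. nF (\<lambda>\<xi>. g \<xi> - T n \<xi>)) \<longlonglongrightarrow> (\<integral>\<^sup>+x. 0 \<partial>(lborel :: 'a measure))"
      unfolding nF_def L.wn_def
    proof (rule nn_integral_dominated_convergence[where w="\<lambda>x. epow (ennreal (jbr x powr s) * ennreal (cmod (g x))) q"])
      show "AE x in lborel. (\<lambda>n. epow (ennreal (jbr x powr s) * ennreal (cmod (g x - T n x))) q) \<longlonglongrightarrow> 0"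
      proof (rule AE_I2)
        fix x :: 'a
        obtain N :: nat where N: "max (cmod (g x)) (norm x) \<le> real N" using real_arch_simple by blast
        have "T n x = g x" if "n \<ge> N" for n
          using that N norm_near[of x 0 "real n"] by (auto simp: T_def)
        then have "eventually (\<lambda>n. epow (ennreal (jbr x powr s) * ennreal (cmod (g x - T n x))) q = 0) sequentially"
          unfolding eventually_sequentially by (intro exI[of _ N]) simp
        then show "(\<lambda>n. epow (ennreal (jbr x powr s) * ennreal (cmod (g x - T n x))) q) \<longlonglongrightarrow> 0"
          by (rule tendsto_eventually)
      qed
      show "(\<integral>\<^sup>+x. epow (ennreal (jbr x powr s) * ennreal (cmod (g x))) q \<partial>lborel) < \<infinity>"
        using fin by (simp add: nF_def L.wn_def)
      show "AE x in lborel. epow (ennreal (jbr x powr s) * ennreal (cmod (g x - T j x))) q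
         \<le> epow (ennreal (jbr x powr s) * ennreal (cmod (g x))) q" for j
        using L.q1 by (intro AE_I2 epow_mono mult_left_mono ennreal_leI) (auto simp: T_def)
    qed measurable
    then show ?thesis by simp
  qed
  have conv_lim: "(\<lambda>j. nF (\<lambda>\<xi>. conv (rho j) (T n) \<xi> - T n \<xi>)) \<longlonglongrightarrow> 0" for n
  proof -
    \<comment> \<open>The two terms bound \<open>conv (rho j) (T n)\<close> and \<open>T n\<close>;
      the radius 1 + n below allows for the support of \<open>rho j\<close>. Neither depends on
      j.\<close>
    define B where "B = K0 * real n + real n"
    obtain C where C: "C < top" and H: "\<forall>g\<in>borel_measurable borel. (\<forall>x. ennreal (cmod (g x)) \<le> ennreal B) \<longrightarrow> (\<forall>x. g x \<noteq> 0 \<longrightarrow> near (1 + real n) x 0) \<longrightarrow>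
       nF g \<le> C * (\<integral>\<^sup>+x. ennreal (cmod (g x)) \<partial>lborel)"
      using nF_bounded_supp[of "1 + real n" B] by auto
    have le: "nF (\<lambda>\<xi>. conv (rho j) (T n) \<xi> - T n \<xi>) \<le> C * (\<integral>\<^sup>+x. ennreal (cmod (conv (rho j) (T n) x - T n x)) \<partial>lborel)" for j
    proof (rule H[rule_format])
      fix x
      have "ennreal (cmod (conv (rho j) (T n) x)) \<le> (\<integral>\<^sup>+y. ennreal (cmod (rho j y)) * ennreal (real n) \<partial>lborel)"
        by (rule order_trans[OF norm_conv_le]) (auto intro!: nn_integral_mono mult_left_mono ennreal_leI simp: T_def)
      also have "\<dots> = ennreal (K0 * real n)"
        using K0_nonneg by (simp add: nn_integral_multc rho_nn_integral ennreal_mult)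
      finally have "cmod (conv (rho j) (T n) x) \<le> K0 * real n" using K0_nonneg by (simp add: ennreal_le_iff)
      moreover have "cmod (T n x) \<le> real n" by (simp add: T_def)
      ultimately have "cmod (conv (rho j) (T n) x - T n x) \<le> B"
        unfolding B_def by (intro order_trans[OF norm_triangle_ineq4] add_mono)
      then show "ennreal (cmod (conv (rho j) (T n) x - T n x)) \<le> ennreal B" by (rule ennreal_leI)
    next
      fix x assume nz: "conv (rho j) (T n) x - T n x \<noteq> 0"
      show "near (1 + real n) x 0"
      proof (rule ccontr)
        assume far: "\<not> near (1 + real n) x 0"
        have z: "rho j y * T n (x - y) = 0" for y
        proof (rule ccontr)
          assume "rho j y * T n (x - y) \<noteq> 0"
          then have "near 1 x (x - y)" "near (real n) (x - y) 0"
            using rho_supp[of j y] by (auto simp: near_def T_def split: if_splits)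
          then show False using far near_trans by blast
        qed
        have "conv (rho j) (T n) x = 0" unfolding conv_def z by simp
        moreover have "T n x = 0" using far near_mono[of "real n" x 0 "1 + real n"] by (auto simp: T_def)
        ultimately show False using nz by simp
      qed
    qed measurable
    have "(\<lambda>j. \<integral>\<^sup>+x. ennreal (cmod (conv (rho j) (T n) x - T n x)) \<partial>lborel) \<longlonglongrightarrow> 0"
      using approximate_identity[OF \<phi>0_int T_int, of n] by (simp add: rho_def \<phi>0_integral del: of_nat_Suc)
    then have "(\<lambda>j. C * (\<integral>\<^sup>+x. ennreal (cmod (conv (rho j) (T n) x - T n x)) \<partial>lborel)) \<longlonglongrightarrow> C * 0"
      using C by (intro ennreal_tendsto_cmult)
    then have "(\<lambda>j. C * (\<integral>\<^sup>+x. ennreal (cmod (conv (rho j) (T n) x - T n x)) \<partial>lborel)) \<longlonglongrightarrow> 0" by simp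
    then show ?thesis by (rule tendsto_0_ennreal_le) (rule le)
  qed
  obtain C where C: "C < top" and H: "\<forall>j. \<forall>h\<in>borel_measurable borel. nF (conv (rho j) h) \<le> C * nF h"
    using nF_conv_rho_le by (elim exE conjE)
  define E where "E = epow 2 q"
  have E: "E < top" by (simp add: E_def)
  \<comment> \<open>Splitting off the truncation leaves conv (rho j) R - R for the remainder R,
    controlled by \<open>R\<close> uniformly in j; hence n can be fixed before j tends to
    infinity.\<close>
  have split: "nF (\<lambda>\<xi>. conv (rho j) g \<xi> - g \<xi>)
    \<le> E * nF (\<lambda>\<xi>. conv (rho j) (T n) \<xi> - T n \<xi>) + E * (E * (C + 1)) * nF (\<lambda>\<xi>. g \<xi> - T n \<xi>)" for j n
  proof -
    define R where "R \<xi> = g \<xi> - T n \<xi>" for \<xi>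
    have [measurable]: "R \<in> borel_measurable borel" unfolding R_def[abs_def] by measurable
    have "AE \<xi> in lborel. conv (rho j) g \<xi> - g \<xi> = (conv (rho j) (T n) \<xi> - T n \<xi>) + (conv (rho j) R \<xi> - R \<xi>)"
      using conv_diff_right[OF rho_int g T_int, of j n] by eventually_elim (simp add: R_def[abs_def])
    then have "nF (\<lambda>\<xi>. conv (rho j) g \<xi> - g \<xi>) = nF (\<lambda>\<xi>. (conv (rho j) (T n) \<xi> - T n \<xi>) + (conv (rho j) R \<xi> - R \<xi>))"
      by (rule nF_cong_AE)
    also have "\<dots> \<le> E * (nF (\<lambda>\<xi>. conv (rho j) (T n) \<xi> - T n \<xi>) + nF (\<lambda>\<xi>. conv (rho j) R \<xi> - R \<xi>))"
      unfolding E_def by (rule nF_add_le) measurable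
    also have "\<dots> \<le> E * (nF (\<lambda>\<xi>. conv (rho j) (T n) \<xi> - T n \<xi>) + E * (C * nF R + nF R))"
    proof (intro mult_left_mono add_left_mono)
      have "nF (\<lambda>\<xi>. conv (rho j) R \<xi> - R \<xi>) \<le> E * (nF (conv (rho j) R) + nF R)"
        unfolding E_def by (rule nF_minus) measurable
      also have "\<dots> \<le> E * (C * nF R + nF R)"
        by (intro mult_left_mono add_right_mono H[rule_format]) auto
      finally show "nF (\<lambda>\<xi>. conv (rho j) R \<xi> - R \<xi>) \<le> E * (C * nF R + nF R)" .
    qed auto
    also have "\<dots> = E * nF (\<lambda>\<xi>. conv (rho j) (T n) \<xi> - T n \<xi>) + E * (E * (C + 1)) * nF R"
      by (simp add: distrib_left distrib_right mult.assoc)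
    finally show ?thesis by (simp add: R_def[abs_def])
  qed
  show ?thesis
  proof (rule tendsto_0_ennreal_approx)
    fix e :: real assume e: "0 < e"
    have "(\<lambda>n. E * (E * (C + 1)) * nF (\<lambda>\<xi>. g \<xi> - T n \<xi>)) \<longlonglongrightarrow> E * (E * (C + 1)) * 0"
      using E C by (intro ennreal_tendsto_cmult T_lim) (simp add: ennreal_mult_less_top)
    then have "(\<lambda>n. E * (E * (C + 1)) * nF (\<lambda>\<xi>. g \<xi> - T n \<xi>)) \<longlonglongrightarrow> 0" by simp
    then have "eventually (\<lambda>n. E * (E * (C + 1)) * nF (\<lambda>\<xi>. g \<xi> - T n \<xi>) < ennreal e) sequentially"
      using e by (intro order_tendstoD) auto
    then obtain n where n: "E * (E * (C + 1)) * nF (\<lambda>\<xi>. g \<xi> - T n \<xi>) < ennreal e"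
      by (auto simp: eventually_sequentially)
    have "(\<lambda>j. E * nF (\<lambda>\<xi>. conv (rho j) (T n) \<xi> - T n \<xi>)) \<longlonglongrightarrow> E * 0"
      using E by (intro ennreal_tendsto_cmult conv_lim)
    moreover have "nF (\<lambda>\<xi>. conv (rho j) g \<xi> - g \<xi>) \<le> E * nF (\<lambda>\<xi>. conv (rho j) (T n) \<xi> - T n \<xi>) + ennreal e" for j
      by (rule order_trans[OF split[of j n]], rule add_left_mono, rule less_imp_le, rule n)
    ultimately show "\<exists>f. f \<longlonglongrightarrow> 0 \<and> (\<forall>j. nF (\<lambda>\<xi>. conv (rho j) g \<xi> - g \<xi>) \<le> f j + ennreal e)"
      by (intro exI[of _ "\<lambda>j. E * nF (\<lambda>\<xi>. conv (rho j) (T n) \<xi> - T n \<xi>)"]) simp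
  qed
qed

text \<open>Near k the function \<open>g\<close> can be replaced by the sum \<open>G\<close> of
  finitely many pieces. Then \<open>ft G\<close> lies in L^p, and convolution with
  \<open>rho j\<close> multiplies it by \<open>ft (rho j)\<close>, which is bounded by
  \<open>K0\<close> and tends to 1, so dominated convergence applies.\<close>

lemma P_conv_rho_tendsto:
  assumes g: "integrable lborel g" and fin: "\<And>l. l \<in> Zlat \<Longrightarrow> bn g l < top"
  shows "(\<lambda>j. P (\<lambda>\<xi>. conv (rho j) g \<xi> - g \<xi>) k) \<longlonglongrightarrow> 0"
proof -
  have [measurable]: "g \<in> borel_measurable borel" using g by auto
  \<comment> \<open>Radius 3: one for the window at k, one for the support of \<open>rho j\<close>,
    one for the windows that must sum to 1 on the enlarged cube.\<close>
  define G where "G \<xi> = (\<Sum>l\<in>NZ 3 k. loc g l \<xi>)" for \<xi>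
  have finZ: "finite (NZ 3 k)" using Zlat_near_card[of 3 k] by auto
  have G: "integrable lborel G" unfolding G_def[abs_def] by (intro Bochner_Integration.integrable_sum loc_int g)
  then have [measurable]: "G \<in> borel_measurable borel" by auto
  have Gg: "G z = g z" if z: "near 2 z k" for z
  proof -
    have "(\<Sum>l\<in>NZ 3 k. \<phi> (z - l)) = 1"
    proof (rule window_sum[OF win finZ])
      fix l assume l: "l \<in> Zlat" "near 1 z l"
      then have "near 1 l z" using near_sym by blast
      from near_trans[OF this z] l show "l \<in> NZ 3 k" by simp
    qed auto
    then show ?thesis by (simp add: G_def loc_def sum_distrib_right[symmetric])
  qed
  have "loc (\<lambda>\<xi>. conv (rho j) g \<xi> - g \<xi>) k = loc (\<lambda>\<xi>. conv (rho j) G \<xi> - G \<xi>) k" for j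
  proof
    fix \<xi>
    show "loc (\<lambda>\<xi>. conv (rho j) g \<xi> - g \<xi>) k \<xi> = loc (\<lambda>\<xi>. conv (rho j) G \<xi> - G \<xi>) k \<xi>"
    proof (cases "\<phi> (\<xi> - k) = 0")
      case False
      then have n: "near 1 \<xi> k" by (rule \<phi>_supp)
      have "conv (rho j) g \<xi> = conv (rho j) G \<xi>"
        unfolding conv_def
      proof (intro Bochner_Integration.integral_cong refl)
        fix y
        show "rho j y * g (\<xi> - y) = rho j y * G (\<xi> - y)"
        proof (cases "rho j y = 0")
          case False
          then have "near 1 (\<xi> - y) \<xi>" using rho_supp[of j y] by (simp add: near_def)
          from near_trans[OF this n] show ?thesis by (simp add: Gg)
        qed simp
      qed
      moreover have "G \<xi> = g \<xi>" by (rule Gg) (rule near_mono[OF n], simp)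
      ultimately show ?thesis by (simp add: loc_def)
    qed (simp add: loc_def)
  qed
  then have P_eq: "P (\<lambda>\<xi>. conv (rho j) g \<xi> - g \<xi>) k = P (\<lambda>\<xi>. conv (rho j) G \<xi> - G \<xi>) k" for j
    unfolding P_def pc_def by simp
  obtain C where C: "C < top" "\<And>h k. integrable lborel h \<Longrightarrow> P h k \<le> C * (\<integral>\<^sup>+x. epow (ennreal (cmod (ft h x))) p \<partial>lborel)"
    using P_le by blast
  have ftG: "(\<integral>\<^sup>+x. epow (ennreal (cmod (ft G x))) p \<partial>lborel) < top"
  proof -
    have "ft G x = (\<Sum>l\<in>NZ 3 k. pc g l x)" for x
      unfolding G_def[abs_def] pc_def by (intro ft_sum loc_int g)
    then have "(\<integral>\<^sup>+x. epow (ennreal (cmod (ft G x))) p \<partial>lborel)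
      \<le> (\<integral>\<^sup>+x. epow (of_nat (card (NZ 3 k))) p * (\<Sum>l\<in>NZ 3 k. epow (ennreal (cmod (pc g l x))) p) \<partial>lborel)"
      using p1 finZ by (intro nn_integral_mono order_trans[OF _ epow_sum_le] epow_mono)
        (auto simp: ennreal_leI norm_sum)
    also have "\<dots> = epow (of_nat (card (NZ 3 k))) p * (\<Sum>l\<in>NZ 3 k. P g l)"
      unfolding P_def by (simp add: nn_integral_cmult nn_integral_sum)
    also have "\<dots> < top"
    proof -
      have "P g l < top" if "l \<in> NZ 3 k" for l using fin[of l] that by (simp add: bn_def)
      then have "(\<Sum>l\<in>NZ 3 k. P g l) < top" using finZ by (intro ennreal_sum_less_top)
      then show ?thesis by (simp add: ennreal_mult_less_top of_nat_less_top)
    qed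
    finally show ?thesis .
  qed
  have le: "P (\<lambda>\<xi>. conv (rho j) G \<xi> - G \<xi>) k
    \<le> C * (\<integral>\<^sup>+x. epow (ennreal (cmod (ft (rho j) x - 1)) * ennreal (cmod (ft G x))) p \<partial>lborel)" for j
  proof -
    have i: "integrable lborel (conv (rho j) G)" by (rule integrable_conv[OF rho_int G])
    have "ft (\<lambda>\<xi>. conv (rho j) G \<xi> - G \<xi>) x = (ft (rho j) x - 1) * ft G x" for x
      using ft_diff[OF i G] ft_conv[OF rho_int G] by (simp add: left_diff_distrib)
    then show ?thesis using C(2)[of "\<lambda>\<xi>. conv (rho j) G \<xi> - G \<xi>" k] i G
      by (simp add: norm_mult ennreal_mult)
  qed
  have "(\<lambda>j. \<integral>\<^sup>+x. epow (ennreal (cmod (ft (rho j) x - 1)) * ennreal (cmod (ft G x))) p \<partial>lborel) \<longlonglongrightarrow> (\<integral>\<^sup>+x. 0 \<partial>(lborel :: 'a measure))"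
  proof (rule nn_integral_dominated_convergence[where w="\<lambda>x. epow (ennreal (K0 + 1)) p * epow (ennreal (cmod (ft G x))) p"])
    show "(\<integral>\<^sup>+x. epow (ennreal (K0 + 1)) p * epow (ennreal (cmod (ft G x))) p \<partial>lborel) < \<infinity>"
      using ftG by (simp add: nn_integral_cmult ennreal_mult_less_top)
    show "AE x in lborel. epow (ennreal (cmod (ft (rho j) x - 1)) * ennreal (cmod (ft G x))) p
      \<le> epow (ennreal (K0 + 1)) p * epow (ennreal (cmod (ft G x))) p" for j
    proof (rule AE_I2)
      fix x
      have "cmod (ft (rho j) x - 1) \<le> K0 + 1"
        using norm_triangle_ineq4[of "ft (rho j) x" 1] ft_rho_le[of j x] by simp
      then show "epow (ennreal (cmod (ft (rho j) x - 1)) * ennreal (cmod (ft G x))) p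
        \<le> epow (ennreal (K0 + 1)) p * epow (ennreal (cmod (ft G x))) p"
        unfolding epow_mult using p1 by (intro mult_right_mono epow_mono ennreal_leI) auto
    qed
    show "AE x in lborel. (\<lambda>j. epow (ennreal (cmod (ft (rho j) x - 1)) * ennreal (cmod (ft G x))) p) \<longlonglongrightarrow> 0"
    proof (rule AE_I2)
      fix x
      have "(\<lambda>j. cmod (ft (rho j) x - 1) * cmod (ft G x)) \<longlonglongrightarrow> cmod (1 - 1) * cmod (ft G x)"
        by (intro tendsto_intros ft_rho_tendsto)
      then have "(\<lambda>j. ennreal (cmod (ft (rho j) x - 1) * cmod (ft G x))) \<longlonglongrightarrow> ennreal (cmod (1 - 1) * cmod (ft G x))"
        by (rule tendsto_ennrealI)
      then have "(\<lambda>j. ennreal (cmod (ft (rho j) x - 1)) * ennreal (cmod (ft G x))) \<longlonglongrightarrow> 0"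
        by (simp add: ennreal_mult)
      then show "(\<lambda>j. epow (ennreal (cmod (ft (rho j) x - 1)) * ennreal (cmod (ft G x))) p) \<longlonglongrightarrow> 0"
        using p1 by (intro tendsto_0_epow) auto
    qed
  qed measurable
  then have "(\<lambda>j. C * (\<integral>\<^sup>+x. epow (ennreal (cmod (ft (rho j) x - 1)) * ennreal (cmod (ft G x))) p \<partial>lborel)) \<longlonglongrightarrow> C * 0"
    using C by (intro ennreal_tendsto_cmult) auto
  then have "(\<lambda>j. C * (\<integral>\<^sup>+x. epow (ennreal (cmod (ft (rho j) x - 1)) * ennreal (cmod (ft G x))) p \<partial>lborel)) \<longlonglongrightarrow> 0" by simp
  then show ?thesis unfolding P_eq by (rule tendsto_0_ennreal_le) (rule le)
qed

text \<open>Each piece converges by \<open>P_conv_rho_tendsto\<close>. Dominated convergence over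
  the lattice needs a majorant \<open>w\<close> independent of j and of finite weighted norm; it
  comes from \<open>bn_conv_le\<close> once \<open>An (rho j)\<close> is bounded by a fixed finitely
  supported sequence.\<close>

lemma nM_conv_rho_tendsto:
  assumes g: "integrable lborel g" and fin: "nM g < top"
  shows "(\<lambda>j. nM (\<lambda>\<xi>. conv (rho j) g \<xi> - g \<xi>)) \<longlonglongrightarrow> 0"
proof -
  have [measurable]: "g \<in> borel_measurable borel" using g by auto
  have fin': "bn g l < top" if "l \<in> Zlat" for l by (rule nM_finite_bn[OF fin that])
  obtain C where C: "C < top" and H: "\<forall>a g. integrable lborel a \<longrightarrow> integrable lborel g \<longrightarrow> (\<forall>l\<in>Zlat. bn g l < top) \<longrightarrow>
     (\<forall>k. bn (conv a g) k \<le> C * (\<integral>\<^sup>+l. bn g l * An a (k - l) \<partial>count_space Zlat))"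
    using bn_conv_le by (elim exE conjE)
  \<comment> \<open>Radius 3 is 2 for the cubes of \<open>An\<close> plus 1 for the support of
    \<open>rho j\<close>; \<open>K0\<close> is the common L^1 norm.\<close>
  define A where "A m = ennreal K0 * indicator {m. near 3 m 0} m" for m :: 'a
  have An_le: "An (rho j) m \<le> A m" for j m
  proof (cases "near 3 m 0")
    case True
    have "An (rho j) m \<le> (\<integral>\<^sup>+\<eta>. ennreal (cmod (rho j \<eta>)) \<partial>lborel)"
      unfolding An_def by (intro nn_integral_mono) (auto simp: indicator_def)
    then show ?thesis using True by (simp add: A_def rho_nn_integral)
  next
    case False
    have z: "ennreal (cmod (rho j \<eta>)) * indicator {\<eta>. near 2 \<eta> m} \<eta> = 0" for \<eta>
    proof (rule ccontr)
      assume "ennreal (cmod (rho j \<eta>)) * indicator {\<eta>. near 2 \<eta> m} \<eta> \<noteq> 0"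
      then have "near 2 m \<eta>" "near 1 \<eta> 0"
        using rho_supp[of j \<eta>] near_sym[of 2 m \<eta>] by (auto simp: indicator_def split: if_splits)
      from near_trans[OF this] False show False by simp
    qed
    show ?thesis unfolding An_def z by simp
  qed
  have A_fin: "Z.wn A < top"
  proof -
    have "Z.wn A = (\<integral>\<^sup>+(m::'a). epow (ennreal (jbr m powr s) * ennreal K0) q * indicator {m. near 3 m 0} m \<partial>count_space Zlat)"
      unfolding Z.wn_def A_def by (intro nn_integral_cong) (simp add: indicator_def)
    also have "\<dots> < top" unfolding nn_sum_near using Zlat_near_card[of 3 "0::'a"]
      by (intro ennreal_sum_less_top) (auto simp: ennreal_mult_less_top)
    finally show ?thesis .
  qed
  define E where "E = epow 2 (1 + 1/p)"
  have E: "E < top" by (simp add: E_def)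
  define cv where "cv k = (\<integral>\<^sup>+l. bn g l * A (k - l) \<partial>count_space Zlat)" for k
  define w where "w k = E * (C * cv k + bn g k)" for k
  have le: "bn (\<lambda>\<xi>. conv (rho j) g \<xi> - g \<xi>) k \<le> w k" for j k
  proof -
    have "bn (\<lambda>\<xi>. conv (rho j) g \<xi> + (- 1) * g \<xi>) k \<le> E * (bn (conv (rho j) g) k + bn (\<lambda>\<xi>. (- 1) * g \<xi>) k)"
      unfolding E_def using g by (intro bn_add_le integrable_conv rho_int) auto
    moreover have "bn (\<lambda>\<xi>. (- 1) * g \<xi>) k = bn g k" by (subst bn_cmult) auto
    ultimately have "bn (\<lambda>\<xi>. conv (rho j) g \<xi> - g \<xi>) k \<le> E * (bn (conv (rho j) g) k + bn g k)" by simp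
    also have "\<dots> \<le> w k" unfolding w_def
    proof (intro mult_left_mono add_right_mono)
      have "bn (conv (rho j) g) k \<le> C * (\<integral>\<^sup>+l. bn g l * An (rho j) (k - l) \<partial>count_space Zlat)"
        using fin' by (intro H[rule_format] rho_int g) auto
      also have "\<dots> \<le> C * cv k" unfolding cv_def
        by (intro mult_left_mono nn_integral_mono An_le) auto
      finally show "bn (conv (rho j) g) k \<le> C * cv k" .
    qed auto
    finally show ?thesis .
  qed
  have w_fin: "Z.wn w < top"
  proof -
    obtain C2 where C2: "C2 < top" "\<And>u v. Z.wn (\<lambda>x. \<integral>\<^sup>+y. u y * v (x - y) \<partial>count_space Zlat) \<le> C2 * Z.wn u * Z.wn v"
      using Z.conv_wn by auto
    have cv: "Z.wn cv < top"
    proof -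
      have "Z.wn cv \<le> C2 * Z.wn (bn g) * Z.wn A" unfolding cv_def by (rule C2)
      also have "\<dots> < top" using C2 A_fin fin by (simp add: nM_def ennreal_mult_less_top)
      finally show ?thesis .
    qed
    have "Z.wn w = epow E q * Z.wn (\<lambda>k. C * cv k + bn g k)" unfolding w_def by (rule Z.wn_cmult) simp
    also have "\<dots> \<le> epow E q * (epow 2 q * (Z.wn (\<lambda>k. C * cv k) + Z.wn (bn g)))"
      by (intro mult_left_mono Z.wn_add_le) auto
    also have "Z.wn (\<lambda>k. C * cv k) = epow C q * Z.wn cv" by (rule Z.wn_cmult) simp
    also have "epow E q * (epow 2 q * (epow C q * Z.wn cv + Z.wn (bn g))) < top"
      using E C cv fin by (simp add: nM_def ennreal_mult_less_top)
    finally show ?thesis .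
  qed
  have "(\<lambda>j. nM (\<lambda>\<xi>. conv (rho j) g \<xi> - g \<xi>)) \<longlonglongrightarrow> (\<integral>\<^sup>+k. 0 \<partial>count_space (Zlat :: 'a set))"
    unfolding nM_def Z.wn_def
  proof (rule nn_integral_dominated_convergence[where w="\<lambda>k. epow (ennreal (jbr k powr s) * w k) q"])
    show "(\<integral>\<^sup>+k. epow (ennreal (jbr k powr s) * w k) q \<partial>count_space Zlat) < \<infinity>"
      using w_fin by (simp add: Z.wn_def)
    show "AE k in count_space Zlat. epow (ennreal (jbr k powr s) * bn (\<lambda>\<xi>. conv (rho j) g \<xi> - g \<xi>) k) q
      \<le> epow (ennreal (jbr k powr s) * w k) q" for j
      using L.q1 by (intro AE_I2 epow_mono mult_left_mono le) auto
    show "AE k in count_space Zlat. (\<lambda>j. epow (ennreal (jbr k powr s) * bn (\<lambda>\<xi>. conv (rho j) g \<xi> - g \<xi>) k) q) \<longlonglongrightarrow> 0"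
    proof (rule AE_I2)
      fix k
      have "(\<lambda>j. bn (\<lambda>\<xi>. conv (rho j) g \<xi> - g \<xi>) k) \<longlonglongrightarrow> 0"
        unfolding bn_def using p1 by (intro tendsto_0_epow P_conv_rho_tendsto g fin') auto
      then have "(\<lambda>j. ennreal (jbr k powr s) * bn (\<lambda>\<xi>. conv (rho j) g \<xi> - g \<xi>) k) \<longlonglongrightarrow> ennreal (jbr k powr s) * 0"
        by (intro ennreal_tendsto_cmult) auto
      then show "(\<lambda>j. epow (ennreal (jbr k powr s) * bn (\<lambda>\<xi>. conv (rho j) g \<xi> - g \<xi>) k) q) \<longlonglongrightarrow> 0"
        using L.q1 by (intro tendsto_0_epow) auto
    qed
  qed auto
  then show ?thesis by simp
qed

end

section \<open>Closed ideals of abstract Segal algebras\<close>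

text \<open>A Segal algebra argument: \<open>Y\<close> is an ideal of \<open>X\<close>, and \<open>U\<close> is an approximate unit in \<open>Y\<close> for
  both norms. Instead of continuity of the inclusion \<open>Y \<subseteq> X\<close>, only multiplication by each \<open>U n\<close> is
  assumed to be continuous from \<open>Y\<close> to \<open>X\<close>.\<close>

locale segal =
  fixes X Y :: "('b \<Rightarrow> complex) set" and NX NY :: "('b \<Rightarrow> complex) \<Rightarrow> real"
    and U :: "nat \<Rightarrow> 'b \<Rightarrow> complex"
  assumes idX: "is_ideal X X" and idY: "is_ideal X Y"
    and NX0: "NX (\<lambda>_. 0) = 0" and NY0: "NY (\<lambda>_. 0) = 0"
    and tri: "\<And>a b :: nat \<Rightarrow> 'b \<Rightarrow> complex. (\<And>j. a j \<in> X) \<Longrightarrow> (\<And>j. b j \<in> X) \<Longrightarrow> (\<lambda>j. NX (a j)) \<longlonglongrightarrow> 0 \<Longrightarrow>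
      (\<lambda>j. NX (b j)) \<longlonglongrightarrow> 0 \<Longrightarrow> (\<lambda>j. NX (\<lambda>x. a j x + b j x)) \<longlonglongrightarrow> 0"
    and smul: "\<And>c (a :: nat \<Rightarrow> 'b \<Rightarrow> complex). (\<And>j. a j \<in> X) \<Longrightarrow> (\<lambda>j. NX (a j)) \<longlonglongrightarrow> 0 \<Longrightarrow> (\<lambda>j. NX (\<lambda>x. c * a j x)) \<longlonglongrightarrow> 0"
    and mulX: "\<And>f (a :: nat \<Rightarrow> 'b \<Rightarrow> complex). f \<in> X \<Longrightarrow> (\<And>j. a j \<in> X) \<Longrightarrow> (\<lambda>j. NX (a j)) \<longlonglongrightarrow> 0 \<Longrightarrow>
      (\<lambda>j. NX (\<lambda>x. f x * a j x)) \<longlonglongrightarrow> 0"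
    and mulY: "\<And>f (a :: nat \<Rightarrow> 'b \<Rightarrow> complex). f \<in> Y \<Longrightarrow> (\<And>j. a j \<in> X) \<Longrightarrow> (\<lambda>j. NX (a j)) \<longlonglongrightarrow> 0 \<Longrightarrow>
      (\<lambda>j. NY (\<lambda>x. f x * a j x)) \<longlonglongrightarrow> 0"
    and UinY: "\<And>n. U n \<in> Y"
    and UX: "\<And>f. f \<in> X \<Longrightarrow> (\<lambda>n. NX (\<lambda>x. U n x * f x - f x)) \<longlonglongrightarrow> 0"
    and UY: "\<And>f. f \<in> Y \<Longrightarrow> (\<lambda>n. NY (\<lambda>x. U n x * f x - f x)) \<longlonglongrightarrow> 0"
    and UYX: "\<And>n (a :: nat \<Rightarrow> 'b \<Rightarrow> complex). (\<And>j. a j \<in> Y) \<Longrightarrow> (\<lambda>j. NY (a j)) \<longlonglongrightarrow> 0 \<Longrightarrow>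
      (\<lambda>j. NX (\<lambda>x. U n x * a j x)) \<longlonglongrightarrow> 0"
begin

lemma YX: "Y \<subseteq> X" using idY by (simp add: is_ideal_def)

lemma ideal_add:
  assumes "is_ideal Z I" "f \<in> I" "g \<in> I" shows "(\<lambda>x. f x + g x) \<in> I"
proof -
  have "\<forall>f\<in>I. \<forall>g\<in>I. (\<lambda>x. f x + g x) \<in> I" using assms(1) unfolding is_ideal_def by (elim conjE)
  from this[rule_format, OF assms(2,3)] show ?thesis .
qed

lemma ideal_scale:
  assumes "is_ideal Z I" "f \<in> I" shows "(\<lambda>x. c * f x) \<in> I"
proof -
  have "\<forall>c::complex. \<forall>f\<in>I. (\<lambda>x. c * f x) \<in> I" using assms(1) unfolding is_ideal_def by (elim conjE)
  from this[rule_format, OF assms(2)] show ?thesis .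
qed

lemma ideal_mult:
  assumes "is_ideal Z I" "f \<in> Z" "g \<in> I" shows "(\<lambda>x. f x * g x) \<in> I"
proof -
  have "\<forall>f\<in>Z. \<forall>g\<in>I. (\<lambda>x. f x * g x) \<in> I" using assms(1) unfolding is_ideal_def by (elim conjE)
  from this[rule_format, OF assms(2,3)] show ?thesis .
qed

lemma ideal_diff: "is_ideal Z I \<Longrightarrow> f \<in> I \<Longrightarrow> g \<in> I \<Longrightarrow> (\<lambda>x. f x - g x) \<in> I"
  using ideal_add[of Z I f "\<lambda>x. - 1 * g x"] ideal_scale[of Z I g "- 1"] by simp

lemma X_diff: "f \<in> X \<Longrightarrow> g \<in> X \<Longrightarrow> (\<lambda>x. f x - g x) \<in> X" by (rule ideal_diff[OF idX])

lemma UinX: "U n \<in> X" using UinY YX by blast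

lemma nclosureI: "f \<in> Z \<Longrightarrow> (\<And>j. u j \<in> A) \<Longrightarrow> (\<lambda>j. N (\<lambda>x. u j x - f x)) \<longlonglongrightarrow> 0 \<Longrightarrow> f \<in> nclosure Z N A"
  unfolding nclosure_def by blast

lemma nclosureE:
  assumes "f \<in> nclosure Z N A"
  obtains u where "f \<in> Z" "\<And>j. u j \<in> A" "(\<lambda>j. N (\<lambda>x. u j x - f x)) \<longlonglongrightarrow> 0"
  using assms unfolding nclosure_def by blast

lemma subset_nclosure: "N (\<lambda>_. 0) = 0 \<Longrightarrow> A \<subseteq> Z \<Longrightarrow> A \<subseteq> nclosure Z N A"
  by (rule subsetI, rule nclosureI[where u="\<lambda>_. _"]) auto

text \<open>If elements of \<open>I\<close> tend to f in the norm of \<open>Y\<close>,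
  multiplication by \<open>U n\<close> turns this into convergence in \<open>X\<close>, so U n f
  lies in the closed ideal \<open>I\<close>. As n tends to infinity, closedness is used a second
  time to obtain f itself.\<close>

lemma trace_closed_ideal:
  assumes I: "I \<in> closed_ideals X NX"
  shows "I \<inter> Y \<in> closed_ideals Y NY"
proof -
  have id: "is_ideal X I" and cl: "nclosure X NX I = I" using I by (auto simp: closed_ideals_def)
  have "is_ideal Y (I \<inter> Y)"
    unfolding is_ideal_def
  proof (intro conjI ballI allI IntI)
    show "(\<lambda>_. 0) \<in> I" "(\<lambda>_. 0) \<in> Y" using id idY by (simp_all add: is_ideal_def)
  qed (use YX in \<open>auto intro: ideal_add[OF id] ideal_add[OF idY] ideal_scale[OF id] ideal_scale[OF idY]
      ideal_mult[OF id] ideal_mult[OF idY]\<close>)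
  moreover have "nclosure Y NY (I \<inter> Y) \<subseteq> I \<inter> Y"
  proof
    fix f assume "f \<in> nclosure Y NY (I \<inter> Y)"
    then obtain u where f: "f \<in> Y" and u: "\<And>j. u j \<in> I \<inter> Y" and lim: "(\<lambda>j. NY (\<lambda>x. u j x - f x)) \<longlonglongrightarrow> 0"
      by (rule nclosureE) (rule that)
    have fX: "f \<in> X" using f YX by blast
    have d: "(\<lambda>x. u j x - f x) \<in> Y" for j using u f by (intro ideal_diff[OF idY]) auto
    have "(\<lambda>x. U n x * f x) \<in> I" for n
    proof -
      have "(\<lambda>j. NX (\<lambda>x. U n x * u j x - U n x * f x)) \<longlonglongrightarrow> 0"
        using UYX[OF d lim, of n] by (simp add: right_diff_distrib)
      moreover have "(\<lambda>x. U n x * u j x) \<in> I" for j using u by (intro ideal_mult[OF id UinX]) auto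
      ultimately have "(\<lambda>x. U n x * f x) \<in> nclosure X NX I"
        using ideal_mult[OF idX UinX fX] by (intro nclosureI)
      then show ?thesis using cl by simp
    qed
    then have "f \<in> nclosure X NX I" by (intro nclosureI[OF fX _ UX[OF fX]])
    then show "f \<in> I \<inter> Y" using cl f by simp
  qed
  moreover have "I \<inter> Y \<subseteq> nclosure Y NY (I \<inter> Y)" by (rule subset_nclosure[of NY "I \<inter> Y" Y, OF NY0]) blast
  ultimately show ?thesis by (auto simp: closed_ideals_def)
qed

text \<open>A closed ideal of \<open>Y\<close> absorbs factors from the larger algebra: U n (f g) =
  (f U n) g with f U n in \<open>Y\<close>, and these products tend to f g in \<open>Y\<close>. This
  makes the closure in \<open>X\<close> an ideal of \<open>X\<close>.\<close>

lemma closed_ideal_X_mult: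
  assumes J: "J \<in> closed_ideals Y NY" and f: "f \<in> X" and g: "g \<in> J"
  shows "(\<lambda>x. f x * g x) \<in> J"
proof -
  have id: "is_ideal Y J" and cl: "nclosure Y NY J = J" using J by (auto simp: closed_ideals_def)
  have gY: "g \<in> Y" using id g by (auto simp: is_ideal_def)
  have fg: "(\<lambda>x. f x * g x) \<in> Y" by (rule ideal_mult[OF idY f gY])
  have "(\<lambda>x. U n x * (f x * g x)) \<in> J" for n
  proof -
    have "(\<lambda>x. f x * U n x) \<in> Y" by (rule ideal_mult[OF idY f UinY])
    from ideal_mult[OF id this g] show ?thesis by (simp add: mult_ac)
  qed
  then have "(\<lambda>x. f x * g x) \<in> nclosure Y NY J" by (rule nclosureI[OF fg _ UY[OF fg]])
  then show ?thesis using cl by simp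
qed

lemma closure_closed_ideal:
  assumes J: "J \<in> closed_ideals Y NY"
  shows "nclosure X NX J \<in> closed_ideals X NX"
proof -
  define K where "K = nclosure X NX J"
  have id: "is_ideal Y J" using J by (auto simp: closed_ideals_def)
  have JX: "J \<subseteq> X" using id YX by (auto simp: is_ideal_def)
  have JK: "J \<subseteq> K" unfolding K_def by (rule subset_nclosure[of NX J X, OF NX0 JX])
  have KX: "K \<subseteq> X" unfolding K_def nclosure_def by blast
  have "is_ideal X K"
    unfolding is_ideal_def
  proof (intro conjI ballI allI)
    show "K \<subseteq> X" by (rule KX)
    show "(\<lambda>_. 0) \<in> K" using JK id by (auto simp: is_ideal_def)
  next
    fix f g assume f: "f \<in> K" and g: "g \<in> K"
    obtain u where u: "f \<in> X" "\<And>j. u j \<in> J" "(\<lambda>j. NX (\<lambda>x. u j x - f x)) \<longlonglongrightarrow> 0"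
      using f unfolding K_def by (rule nclosureE) (rule that)
    obtain v where v: "g \<in> X" "\<And>j. v j \<in> J" "(\<lambda>j. NX (\<lambda>x. v j x - g x)) \<longlonglongrightarrow> 0"
      using g unfolding K_def by (rule nclosureE) (rule that)
    have "(\<lambda>j. NX (\<lambda>x. (u j x - f x) + (v j x - g x))) \<longlonglongrightarrow> 0"
      using u v JX by (intro tri X_diff) auto
    then have "(\<lambda>j. NX (\<lambda>x. (u j x + v j x) - (f x + g x))) \<longlonglongrightarrow> 0" by (simp add: algebra_simps)
    moreover have "(\<lambda>x. u j x + v j x) \<in> J" for j by (rule ideal_add[OF id u(2) v(2)])
    moreover have "(\<lambda>x. f x + g x) \<in> X" by (rule ideal_add[OF idX u(1) v(1)])
    ultimately show "(\<lambda>x. f x + g x) \<in> K" unfolding K_def by (intro nclosureI)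
  next
    fix c f assume f: "f \<in> K"
    obtain u where u: "f \<in> X" "\<And>j. u j \<in> J" "(\<lambda>j. NX (\<lambda>x. u j x - f x)) \<longlonglongrightarrow> 0"
      using f unfolding K_def by (rule nclosureE) (rule that)
    have "(\<lambda>j. NX (\<lambda>x. c * (u j x - f x))) \<longlonglongrightarrow> 0"
      using u JX by (intro smul X_diff) auto
    then have "(\<lambda>j. NX (\<lambda>x. c * u j x - c * f x)) \<longlonglongrightarrow> 0" by (simp add: right_diff_distrib)
    moreover have "(\<lambda>x. c * u j x) \<in> J" for j by (rule ideal_scale[OF id u(2)])
    moreover have "(\<lambda>x. c * f x) \<in> X" by (rule ideal_scale[OF idX u(1)])
    ultimately show "(\<lambda>x. c * f x) \<in> K" unfolding K_def by (intro nclosureI)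
  next
    fix f g assume f: "f \<in> X" and g: "g \<in> K"
    obtain u where u: "g \<in> X" "\<And>j. u j \<in> J" "(\<lambda>j. NX (\<lambda>x. u j x - g x)) \<longlonglongrightarrow> 0"
      using g unfolding K_def by (rule nclosureE) (rule that)
    have "(\<lambda>j. NX (\<lambda>x. f x * (u j x - g x))) \<longlonglongrightarrow> 0"
      using f u JX by (intro mulX X_diff) auto
    then have "(\<lambda>j. NX (\<lambda>x. f x * u j x - f x * g x)) \<longlonglongrightarrow> 0" by (simp add: right_diff_distrib)
    then show "(\<lambda>x. f x * g x) \<in> K" unfolding K_def
      by (intro nclosureI[where u="\<lambda>j x. f x * u j x"] ideal_mult[OF idX f u(1)] closed_ideal_X_mult[OF J f] u(2))
  qed
  moreover have "nclosure X NX K \<subseteq> K"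
  proof
    fix f assume "f \<in> nclosure X NX K"
    then obtain v where f: "f \<in> X" and v: "\<And>j. v j \<in> K" and lim: "(\<lambda>j. NX (\<lambda>x. v j x - f x)) \<longlonglongrightarrow> 0"
      by (rule nclosureE) (rule that)
    \<comment> \<open>Diagonal choice of an element of \<open>J\<close> within 1/(j+1) of v j. The
      absolute value appears because the locale does not require \<open>NX\<close> to be
      nonnegative.\<close>
    have "\<exists>u. u \<in> J \<and> \<bar>NX (\<lambda>x. u x - v j x)\<bar> < inverse (real (Suc j))" for j
    proof -
      obtain u where u: "\<And>i. u i \<in> J" "(\<lambda>i. NX (\<lambda>x. u i x - v j x)) \<longlonglongrightarrow> 0"
        using v[of j] unfolding K_def by (rule nclosureE) (rule that)
      have "eventually (\<lambda>i. dist (NX (\<lambda>x. u i x - v j x)) 0 < inverse (real (Suc j))) sequentially"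
        by (rule tendstoD[OF u(2)]) simp
      then show ?thesis using u(1) by (auto simp: eventually_sequentially)
    qed
    then obtain u where u: "\<And>j. u j \<in> J" "\<And>j. \<bar>NX (\<lambda>x. u j x - v j x)\<bar> < inverse (real (Suc j))" by metis
    have "(\<lambda>j. NX (\<lambda>x. u j x - v j x)) \<longlonglongrightarrow> 0"
    proof (rule tendsto_rabs_zero_cancel, rule tendsto_sandwich[OF _ _ tendsto_const LIMSEQ_inverse_real_of_nat])
      show "eventually (\<lambda>j. \<bar>NX (\<lambda>x. u j x - v j x)\<bar> \<le> inverse (real (Suc j))) sequentially"
        by (intro always_eventually allI less_imp_le u(2))
    qed simp
    then have "(\<lambda>j. NX (\<lambda>x. (u j x - v j x) + (v j x - f x))) \<longlonglongrightarrow> 0"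
      using u v f JX KX by (intro tri X_diff lim) auto
    then have "(\<lambda>j. NX (\<lambda>x. u j x - f x)) \<longlonglongrightarrow> 0" by simp
    then show "f \<in> K" unfolding K_def using f u(1) by (intro nclosureI)
  qed
  moreover have "K \<subseteq> nclosure X NX K" by (rule subset_nclosure[of NX K X, OF NX0 KX])
  ultimately show ?thesis unfolding K_def closed_ideals_def by blast
qed

lemma trace_closure:
  assumes J: "J \<in> closed_ideals Y NY"
  shows "nclosure X NX J \<inter> Y = J"
proof
  have id: "is_ideal Y J" and cl: "nclosure Y NY J = J" using J by (auto simp: closed_ideals_def)
  have JY: "J \<subseteq> Y" using id by (auto simp: is_ideal_def)
  show "J \<subseteq> nclosure X NX J \<inter> Y"
    using subset_nclosure[of NX J X, OF NX0] JY YX by blast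
  show "nclosure X NX J \<inter> Y \<subseteq> J"
  proof safe
    fix f assume fc: "f \<in> nclosure X NX J" and f: "f \<in> Y"
    obtain u where fX: "f \<in> X" and u: "\<And>j. u j \<in> J" and lim: "(\<lambda>j. NX (\<lambda>x. u j x - f x)) \<longlonglongrightarrow> 0"
      using fc by (rule nclosureE) (rule that)
    have d: "(\<lambda>x. u j x - f x) \<in> X" for j using u JY YX fX by (intro X_diff) auto
    have "(\<lambda>x. U n x * f x) \<in> J" for n
    proof -
      have "(\<lambda>j. NY (\<lambda>x. U n x * u j x - U n x * f x)) \<longlonglongrightarrow> 0"
        using mulY[OF UinY d lim, of n] by (simp add: right_diff_distrib)
      moreover have "(\<lambda>x. U n x * u j x) \<in> J" for j by (rule ideal_mult[OF id UinY u])
      ultimately have "(\<lambda>x. U n x * f x) \<in> nclosure Y NY J"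
        using ideal_mult[OF idY UinX f] by (intro nclosureI)
      then show ?thesis using cl by simp
    qed
    then have "f \<in> nclosure Y NY J" by (intro nclosureI[OF f _ UY[OF f]])
    then show "f \<in> J" using cl by simp
  qed
qed

text \<open>U n f lies in \<open>I\<close> because \<open>I\<close> absorbs \<open>U n\<close>, and
  in \<open>Y\<close> because \<open>Y\<close> absorbs f; it tends to f in \<open>X\<close>. So the
  trace on \<open>Y\<close> determines the closed ideal.\<close>

lemma closure_trace:
  assumes I: "I \<in> closed_ideals X NX"
  shows "nclosure X NX (I \<inter> Y) = I"
proof
  have id: "is_ideal X I" and cl: "nclosure X NX I = I" using I by (auto simp: closed_ideals_def)
  have "nclosure X NX (I \<inter> Y) \<subseteq> nclosure X NX I" unfolding nclosure_def by blast
  then show "nclosure X NX (I \<inter> Y) \<subseteq> I" using cl by simp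
  show "I \<subseteq> nclosure X NX (I \<inter> Y)"
  proof
    fix f assume f: "f \<in> I"
    then have fX: "f \<in> X" using id by (auto simp: is_ideal_def)
    have "(\<lambda>x. U n x * f x) \<in> Y" for n
      using ideal_mult[OF idY fX UinY, of n] by (simp add: mult.commute)
    moreover have "(\<lambda>x. U n x * f x) \<in> I" for n by (rule ideal_mult[OF id UinX f])
    ultimately show "f \<in> nclosure X NX (I \<inter> Y)"
      by (intro nclosureI[OF fX _ UX[OF fX]]) blast
  qed
qed

theorem closed_ideals_correspondence:
  "(\<forall>I\<in>closed_ideals X NX. I \<inter> Y \<in> closed_ideals Y NY)
    \<and> bij_betw (\<lambda>I. I \<inter> Y) (closed_ideals X NX) (closed_ideals Y NY)
    \<and> (\<forall>J\<in>closed_ideals Y NY. nclosure X NX J \<in> closed_ideals X NX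
         \<and> the_inv_into (closed_ideals X NX) (\<lambda>I. I \<inter> Y) J = nclosure X NX J)
    \<and> (\<forall>J\<in>closed_ideals Y NY. nclosure X NX J \<inter> Y = J)"
proof -
  have bij: "bij_betw (\<lambda>I. I \<inter> Y) (closed_ideals X NX) (closed_ideals Y NY)"
    by (rule bij_betwI[where g="nclosure X NX"])
       (auto simp: trace_closed_ideal closure_closed_ideal trace_closure closure_trace)
  have "the_inv_into (closed_ideals X NX) (\<lambda>I. I \<inter> Y) J = nclosure X NX J"
    if "J \<in> closed_ideals Y NY" for J
    using that by (intro the_inv_into_f_eq bij_betw_imp_inj_on[OF bij])
      (auto simp: closure_closed_ideal trace_closure)
  then show ?thesis
    using bij trace_closed_ideal closure_closed_ideal trace_closure by blast
qed

end

section \<open>The spaces of the theorem in terms of Fourier transforms\<close>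

text \<open>In the divergent case both sides of the second equation are 0: the infinite sum by
  convention, the right side because \<open>enn2real\<close> sends infinity to 0.\<close>

lemma summable_on_iff_nn_integral:
  fixes r :: "'b \<Rightarrow> real"
  assumes r: "\<And>k. k \<in> A \<Longrightarrow> 0 \<le> r k"
  shows "r summable_on A \<longleftrightarrow> (\<integral>\<^sup>+k. ennreal (r k) \<partial>count_space A) < top" (is "?S \<longleftrightarrow> ?I")
    and "infsum r A = enn2real (\<integral>\<^sup>+k. ennreal (r k) \<partial>count_space A)"
proof -
  have nn: "(\<integral>\<^sup>+k. ennreal (norm (r k)) \<partial>count_space A) = (\<integral>\<^sup>+k. ennreal (r k) \<partial>count_space A)"
    using r by (intro nn_integral_cong) simp
  have abs: "r summable_on A \<longleftrightarrow> integrable (count_space A) r"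
    using abs_summable_equivalent[of r A] summable_on_iff_abs_summable_on_real[of r A]
    by (simp add: abs_summable_on_def)
  show iff: "?S \<longleftrightarrow> ?I" unfolding abs by (simp add: integrable_iff_bounded nn[unfolded real_norm_def])
  show "infsum r A = enn2real (\<integral>\<^sup>+k. ennreal (r k) \<partial>count_space A)"
  proof (cases ?S)
    case True
    then have "Infinite_Set_Sum.abs_summable_on r A" using abs by (simp add: abs_summable_on_def)
    from infsetsum_infsum[OF this] have "infsum r A = integral\<^sup>L (count_space A) r"
      by (simp add: infsetsum_def)
    also have "\<dots> = enn2real (\<integral>\<^sup>+k. ennreal (r k) \<partial>count_space A)"
      by (rule integral_eq_nn_integral) (auto intro!: AE_I2 r)
    finally show ?thesis .
  next
    case False
    then show ?thesis using iff by (simp add: infsum_not_exists less_top[symmetric])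
  qed
qed

text \<open>The bridge between real norms and their powers in \<open>ennreal\<close>. Finiteness is
  essential: \<open>enn2real\<close> sends infinity to 0, so divergent values would count as
  small.\<close>

lemma tendsto_powr_enn2real_iff:
  fixes x :: "nat \<Rightarrow> ennreal"
  assumes c: "0 < c" and q: "0 < q" and fin: "\<And>j. x j < top"
  shows "(\<lambda>j. (c * enn2real (x j)) powr (1/q)) \<longlonglongrightarrow> 0 \<longleftrightarrow> x \<longlonglongrightarrow> 0"
proof
  assume "(\<lambda>j. (c * enn2real (x j)) powr (1/q)) \<longlonglongrightarrow> 0"
  then have "(\<lambda>j. ((c * enn2real (x j)) powr (1/q)) powr q) \<longlonglongrightarrow> 0"
    by (rule tendsto_zero_powrI[where b=q]) (use q in auto)
  then have "(\<lambda>j. c * enn2real (x j)) \<longlonglongrightarrow> 0" using c q by (simp add: powr_powr)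
  then have "(\<lambda>j. inverse c * (c * enn2real (x j))) \<longlonglongrightarrow> inverse c * 0" by (rule tendsto_mult_left)
  then have "(\<lambda>j. enn2real (x j)) \<longlonglongrightarrow> 0" using c by simp
  then have "(\<lambda>j. ennreal (enn2real (x j))) \<longlonglongrightarrow> ennreal 0" by (rule tendsto_ennrealI)
  then show "x \<longlonglongrightarrow> 0" using fin by (simp add: less_top)
next
  assume "x \<longlonglongrightarrow> 0"
  then have "x \<longlonglongrightarrow> ennreal 0" by simp
  then have "(\<lambda>j. enn2real (x j)) \<longlonglongrightarrow> 0" by (rule tendsto_enn2real) simp
  then have "(\<lambda>j. c * enn2real (x j)) \<longlonglongrightarrow> c * 0" by (rule tendsto_mult_left)
  then have "(\<lambda>j. c * enn2real (x j)) \<longlonglongrightarrow> 0" by simp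
  then show "(\<lambda>j. (c * enn2real (x j)) powr (1/q)) \<longlonglongrightarrow> 0"
    by (rule tendsto_zero_powrI[where b="1/q"]) (use c q in auto)
qed

context window_setup begin

section \<open>Membership and norms through an arbitrary Fourier representative\<close>

definition kap :: complex where
  "kap = complex_of_real ((2 * pi) powr (- real DIM('a)))"

lemma kap_nonzero: "kap \<noteq> 0" by (simp add: kap_def)

lemma inv_fourier_eq: "inv_fourier g = (\<lambda>x::'a. kap * ft g x)"
  by (simp add: inv_fourier_def ft_def kap_def fun_eq_iff)

lemma fourier_rep_iff: "fourier_rep f g \<longleftrightarrow> integrable lborel g \<and> f = (\<lambda>x::'a. kap * ft g x)"
  by (simp add: fourier_rep_def inv_fourier_eq)

lemma rep_int: "fourier_rep f (g :: 'a \<Rightarrow> complex) \<Longrightarrow> integrable lborel g"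
  by (simp add: fourier_rep_iff)

text \<open>Injectivity of \<open>ft\<close> fixes the representative up to a null set. Hence the
  choice \<open>fhat f\<close> can be exchanged for any representative at hand, as in
  \<open>FL_iff\<close>, \<open>FL_norm_eq\<close> and \<open>loc_piece_eq\<close>.\<close>

lemma rep_unique:
  assumes "fourier_rep f g" "fourier_rep f (h :: 'a \<Rightarrow> complex)"
  shows "AE x in lborel. g x = h x"
proof -
  have "(\<lambda>x. kap * ft g x) = (\<lambda>x. kap * ft h x)" using assms by (simp add: fourier_rep_iff)
  then have "ft g = ft h" using kap_nonzero by (auto simp: fun_eq_iff)
  then show ?thesis using assms by (intro ft_inj rep_int)
qed

lemma rep_fhat: "fourier_rep f (g :: 'a \<Rightarrow> complex) \<Longrightarrow> fourier_rep f (fhat f)"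
  unfolding fhat_def by (rule someI[of "fourier_rep f"])

lemma nF_eq: "nF g = (\<integral>\<^sup>+\<xi>. ennreal ((jbr \<xi> powr s * cmod (g \<xi>)) powr q) \<partial>lborel)"
  unfolding nF_def L.wn_def by (simp add: ennreal_mult[symmetric] epow_ennreal)

lemma FL_iff:
  assumes g: "fourier_rep f (g :: 'a \<Rightarrow> complex)"
  shows "f \<in> FL q s \<longleftrightarrow> nF g < top"
proof -
  have i: "integrable lborel (\<lambda>\<xi>. (jbr \<xi> powr s * cmod (h \<xi>)) powr q) \<longleftrightarrow> nF h < top"
    if h: "fourier_rep f h" for h :: "'a \<Rightarrow> complex"
  proof -
    have [measurable]: "h \<in> borel_measurable borel" using rep_int[OF h] by auto
    show ?thesis unfolding nF_eq by (simp add: integrable_iff_bounded)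
  qed
  have e: "nF h = nF g" if "fourier_rep f h" for h :: "'a \<Rightarrow> complex"
    by (rule nF_cong_AE[OF rep_unique[OF that g]])
  show ?thesis
  proof
    assume "f \<in> FL q s"
    then obtain h :: "'a \<Rightarrow> complex" where h: "fourier_rep f h"
      "integrable lborel (\<lambda>\<xi>. (jbr \<xi> powr s * cmod (h \<xi>)) powr q)" unfolding FL_def by blast
    show "nF g < top" using h(2) unfolding i[OF h(1)] e[OF h(1)] .
  next
    assume "nF g < top"
    then have "integrable lborel (\<lambda>\<xi>. (jbr \<xi> powr s * cmod (g \<xi>)) powr q)" unfolding i[OF g] .
    then show "f \<in> FL q s" using g unfolding FL_def by blast
  qed
qed

lemma FL_rep: "f \<in> FL q s \<Longrightarrow> fourier_rep f (fhat f) \<and> nF (fhat f :: 'a \<Rightarrow> complex) < top"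
proof -
  assume f: "f \<in> FL q s"
  then obtain g :: "'a \<Rightarrow> complex" where "fourier_rep f g" unfolding FL_def by blast
  then have r: "fourier_rep f (fhat f)" by (rule rep_fhat)
  then show ?thesis using f FL_iff[OF r] by simp
qed

lemma FL_norm_eq:
  assumes g: "fourier_rep f (g :: 'a \<Rightarrow> complex)"
  shows "FL_norm q s f = enn2real (nF g) powr (1/q)"
proof -
  have [measurable]: "fhat f \<in> borel_measurable borel" using rep_int[OF rep_fhat[OF g]] by auto
  have "(\<integral>\<xi>. (jbr \<xi> powr s * cmod (fhat f \<xi>)) powr q \<partial>lborel) = enn2real (nF (fhat f))"
    unfolding nF_eq by (rule integral_eq_nn_integral) auto
  also have "nF (fhat f) = nF g" by (rule nF_cong_AE[OF rep_unique[OF rep_fhat[OF g] g]])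
  finally show ?thesis by (simp add: FL_norm_def)
qed

lemma loc_piece_eq:
  assumes g: "fourier_rep f (g :: 'a \<Rightarrow> complex)"
  shows "loc_piece \<phi> k f = (\<lambda>x. kap * pc g k x)"
proof -
  have m: "fhat f \<in> borel_measurable borel" "g \<in> borel_measurable borel"
    using rep_int[OF rep_fhat[OF g]] rep_int[OF g] by auto
  have "pc (fhat f) k = pc g k" by (rule pc_cong_AE[OF m rep_unique[OF rep_fhat[OF g] g]])
  then show ?thesis unfolding loc_piece_def inv_fourier_eq pc_def loc_def[abs_def] by simp
qed

lemma piece_norm:
  assumes g: "integrable lborel (g :: 'a \<Rightarrow> complex)"
  shows "integrable lborel (\<lambda>x. cmod (kap * pc g k x) powr p) \<longleftrightarrow> bn g k < top"
    and "Lp_norm p (\<lambda>x. kap * pc g k x) = cmod kap * enn2real (bn g k)"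
proof -
  have [measurable]: "g \<in> borel_measurable borel" using g by auto
  have "(\<integral>\<^sup>+x. ennreal (cmod (kap * pc g k x) powr p) \<partial>lborel)
    = (\<integral>\<^sup>+x. ennreal (cmod kap powr p) * epow (ennreal (cmod (pc g k x))) p \<partial>lborel)"
    by (intro nn_integral_cong) (simp add: norm_mult powr_mult epow_ennreal ennreal_mult)
  also have "\<dots> = ennreal (cmod kap powr p) * P g k" unfolding P_def by (rule nn_integral_cmult) measurable
  finally have e: "(\<integral>\<^sup>+x. ennreal (cmod (kap * pc g k x) powr p) \<partial>lborel) = ennreal (cmod kap powr p) * P g k" .
  show "integrable lborel (\<lambda>x. cmod (kap * pc g k x) powr p) \<longleftrightarrow> bn g k < top"
    using kap_nonzero by (auto simp: integrable_iff_bounded e bn_def ennreal_mult_less_top ennreal_eq_0_iff)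
  have "(\<integral>x. cmod (kap * pc g k x) powr p \<partial>lborel) = enn2real (ennreal (cmod kap powr p) * P g k)"
    unfolding e[symmetric] by (rule integral_eq_nn_integral) auto
  also have "\<dots> = cmod kap powr p * enn2real (P g k)" by (simp add: enn2real_mult)
  finally have "Lp_norm p (\<lambda>x. kap * pc g k x) = cmod kap * enn2real (P g k) powr (1/p)"
    using p1 by (simp add: Lp_norm_def powr_mult powr_powr)
  also have "enn2real (P g k) powr (1/p) = enn2real (bn g k)" by (simp add: bn_def epow_def)
  finally show "Lp_norm p (\<lambda>x. kap * pc g k x) = cmod kap * enn2real (bn g k)" .
qed

lemma nn_sum_pieces:
  assumes fin: "\<And>k. k \<in> Zlat \<Longrightarrow> bn g k < top"
  shows "(\<integral>\<^sup>+k. ennreal (jbr k powr (s * q) * (cmod kap * enn2real (bn g k)) powr q) \<partial>count_space Zlat)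
    = ennreal (cmod kap powr q) * nM g"
proof -
  have "(\<integral>\<^sup>+k. ennreal (jbr k powr (s * q) * (cmod kap * enn2real (bn g k)) powr q) \<partial>count_space Zlat)
    = (\<integral>\<^sup>+k. ennreal (cmod kap powr q) * epow (ennreal (jbr k powr s) * bn g k) q \<partial>count_space Zlat)"
  proof (intro nn_integral_cong)
    fix k :: 'a assume "k \<in> space (count_space Zlat)"
    then obtain r where r: "bn g k = ennreal r" "0 \<le> r" using fin[of k] by (cases "bn g k") auto
    then show "ennreal (jbr k powr (s * q) * (cmod kap * enn2real (bn g k)) powr q)
      = ennreal (cmod kap powr q) * epow (ennreal (jbr k powr s) * bn g k) q"
      by (simp add: ennreal_mult[symmetric] epow_ennreal powr_mult powr_powr mult_ac)
  qed
  also have "\<dots> = ennreal (cmod kap powr q) * nM g"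
    unfolding nM_def Z.wn_def by (rule nn_integral_cmult) simp
  finally show ?thesis .
qed

text \<open>The sum in \<open>Mod\<close> uses real L^p norms, which are 0 for pieces outside L^p,
  so it matches \<open>nM\<close> only together with the integrability clause. Conversely,
  finiteness of \<open>nM\<close> forces every lattice piece into L^p.\<close>

lemma Mod_iff:
  assumes g: "fourier_rep f (g :: 'a \<Rightarrow> complex)"
  shows "f \<in> Mod \<phi> p q s \<longleftrightarrow> nF g < top \<and> nM g < top"
proof -
  have kq: "0 < cmod kap powr q" using kap_nonzero by simp
  have 1: "(\<forall>k\<in>Zlat. integrable lborel (\<lambda>x. cmod (loc_piece \<phi> k f x) powr p)) \<longleftrightarrow> (\<forall>k\<in>Zlat. bn g k < top)"
    unfolding loc_piece_eq[OF g] piece_norm[OF rep_int[OF g]] ..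
  have 2: "(\<lambda>k. jbr k powr (s*q) * Lp_norm p (loc_piece \<phi> k f) powr q) summable_on Zlat \<longleftrightarrow> nM g < top"
    if "\<forall>k\<in>Zlat. bn g k < top"
  proof -
    have "(\<lambda>k. jbr k powr (s*q) * Lp_norm p (loc_piece \<phi> k f) powr q) summable_on Zlat
      \<longleftrightarrow> ennreal (cmod kap powr q) * nM g < top"
      unfolding loc_piece_eq[OF g] piece_norm[OF rep_int[OF g]]
      by (subst summable_on_iff_nn_integral(1)) (use that in \<open>auto simp: nn_sum_pieces\<close>)
    then show ?thesis using kq by (auto simp: ennreal_mult_less_top ennreal_eq_0_iff)
  qed
  have "nM g < top \<Longrightarrow> \<forall>k\<in>Zlat. bn g k < top" using nM_finite_bn by blast
  then show ?thesis unfolding Mod_def mem_Collect_eq FL_iff[OF g] 1 using 2 by blast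
qed

lemma Mod_norm_eq:
  assumes g: "fourier_rep f (g :: 'a \<Rightarrow> complex)" and fin: "nM g < top"
  shows "Mod_norm \<phi> p q s f = (cmod kap powr q * enn2real (nM g)) powr (1/q)"
proof -
  have "(\<Sum>\<^sub>\<infinity>k\<in>Zlat. jbr k powr (s*q) * Lp_norm p (loc_piece \<phi> k f) powr q)
     = enn2real (ennreal (cmod kap powr q) * nM g)"
    unfolding loc_piece_eq[OF g] piece_norm[OF rep_int[OF g]]
    by (subst summable_on_iff_nn_integral(2)) (auto simp: nn_sum_pieces nM_finite_bn[OF fin])
  then show ?thesis by (simp add: Mod_norm_def enn2real_mult)
qed

lemma Mod_rep: "f \<in> Mod \<phi> p q s \<Longrightarrow> fourier_rep f (fhat f) \<and> nF (fhat f) < top \<and> nM (fhat f) < top"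
proof -
  assume f: "f \<in> Mod \<phi> p q s"
  then have "f \<in> FL q s" by (simp add: Mod_def)
  then have r: "fourier_rep f (fhat f)" using FL_rep by simp
  then show ?thesis using f Mod_iff[OF r] by simp
qed

lemma FL_norm_tendsto:
  assumes "\<And>j. fourier_rep (a j) (h j :: 'a \<Rightarrow> complex)" "\<And>j. nF (h j) < top"
  shows "(\<lambda>j. FL_norm q s (a j)) \<longlonglongrightarrow> 0 \<longleftrightarrow> (\<lambda>j. nF (h j)) \<longlonglongrightarrow> 0"
  unfolding FL_norm_eq[OF assms(1)]
  using tendsto_powr_enn2real_iff[of 1 q "\<lambda>j. nF (h j)"] L.q1 assms(2) by simp

lemma Mod_norm_tendsto:
  assumes "\<And>j. fourier_rep (a j) (h j :: 'a \<Rightarrow> complex)" "\<And>j. nM (h j) < top"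
  shows "(\<lambda>j. Mod_norm \<phi> p q s (a j)) \<longlonglongrightarrow> 0 \<longleftrightarrow> (\<lambda>j. nM (h j)) \<longlonglongrightarrow> 0"
  unfolding Mod_norm_eq[OF assms]
  using tendsto_powr_enn2real_iff[of "cmod kap powr q" q "\<lambda>j. nM (h j)"] L.q1 assms(2) kap_nonzero
  by simp

section \<open>Representatives of sums, products and the approximate unit\<close>

lemma rep_zero: "fourier_rep (\<lambda>_. 0) (\<lambda>_::'a. 0)"
  by (simp add: fourier_rep_iff ft_def)

lemma rep_add: "fourier_rep f g \<Longrightarrow> fourier_rep f' (g' :: 'a \<Rightarrow> complex) \<Longrightarrow>
    fourier_rep (\<lambda>x. f x + f' x) (\<lambda>\<xi>. g \<xi> + g' \<xi>)"
  by (auto simp: fourier_rep_iff ft_add distrib_left)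

lemma rep_diff: "fourier_rep f g \<Longrightarrow> fourier_rep f' (g' :: 'a \<Rightarrow> complex) \<Longrightarrow>
    fourier_rep (\<lambda>x. f x - f' x) (\<lambda>\<xi>. g \<xi> - g' \<xi>)"
  by (auto simp: fourier_rep_iff ft_diff right_diff_distrib)

lemma rep_scale: "fourier_rep f (g :: 'a \<Rightarrow> complex) \<Longrightarrow> fourier_rep (\<lambda>x. c * f x) (\<lambda>\<xi>. c * g \<xi>)"
  by (auto simp: fourier_rep_iff ft_cmult)

text \<open>The product contains two factors \<open>kap\<close>; one belongs to the representation,
  the other stays with the convolution.\<close>

lemma rep_mult: "fourier_rep f g \<Longrightarrow> fourier_rep f' (g' :: 'a \<Rightarrow> complex) \<Longrightarrow>
    fourier_rep (\<lambda>x. f x * f' x) (\<lambda>\<xi>. kap * conv g g' \<xi>)"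
  by (auto simp: fourier_rep_iff ft_cmult ft_conv integrable_conv mult_ac)

text \<open>The unit is \<open>ft (rho n)\<close> without the factor \<open>kap\<close>: it tends to
  1, and multiplication by it is plain convolution with \<open>rho n\<close>, as in
  \<open>rep_unit_mult\<close>.\<close>

lemma rep_unit: "fourier_rep (ft (rho n)) (\<lambda>\<xi>. inverse kap * rho n \<xi>)"
  using kap_nonzero rho_int[of n] by (simp add: fourier_rep_iff ft_cmult fun_eq_iff)

lemma rep_unit_mult: "fourier_rep f (g :: 'a \<Rightarrow> complex) \<Longrightarrow> fourier_rep (\<lambda>x. ft (rho n) x * f x) (conv (rho n) g)"
  by (auto simp: fourier_rep_iff ft_conv rho_int integrable_conv mult_ac)

lemma nF_zero: "nF (\<lambda>_. 0) = 0" and nM_zero: "nM (\<lambda>_. 0) = 0"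
  using nF_cmult[of "\<lambda>_. 0" 0] nM_cmult[of "\<lambda>_. 0" 0] by simp_all

lemma tendsto_0_cmult_le:
  fixes x y :: "nat \<Rightarrow> ennreal"
  assumes "x \<longlonglongrightarrow> 0" "C < top" "\<And>j. y j \<le> C * x j"
  shows "y \<longlonglongrightarrow> 0"
proof -
  have "(\<lambda>j. C * x j) \<longlonglongrightarrow> C * 0" using assms by (intro ennreal_tendsto_cmult)
  then have "(\<lambda>j. C * x j) \<longlonglongrightarrow> 0" by simp
  then show ?thesis by (rule tendsto_0_ennreal_le) (rule assms)
qed

section \<open>Stability of finite norms under the algebra operations\<close>

lemma nF_add_finite: "integrable lborel g \<Longrightarrow> integrable lborel h \<Longrightarrow> nF g < top \<Longrightarrow> nF h < top \<Longrightarrow> nF (\<lambda>x. g x + h x) < top"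
  by (rule le_less_trans[OF nF_add_le]) (auto simp: ennreal_mult_less_top)

lemma nM_add_finite: "integrable lborel g \<Longrightarrow> integrable lborel h \<Longrightarrow> nM g < top \<Longrightarrow> nM h < top \<Longrightarrow> nM (\<lambda>x. g x + h x) < top"
  by (rule le_less_trans[OF nM_add_le]) (auto simp: ennreal_mult_less_top)

lemma nF_cmult_finite: "integrable lborel g \<Longrightarrow> nF g < top \<Longrightarrow> nF (\<lambda>x. c * g x) < top"
  by (subst nF_cmult) (auto simp: ennreal_mult_less_top)

lemma nM_cmult_finite: "integrable lborel g \<Longrightarrow> nM g < top \<Longrightarrow> nM (\<lambda>x. c * g x) < top"
  by (subst nM_cmult) (auto simp: ennreal_mult_less_top)

lemma nF_diff_finite: "integrable lborel g \<Longrightarrow> integrable lborel h \<Longrightarrow> nF g < top \<Longrightarrow> nF h < top \<Longrightarrow> nF (\<lambda>x. g x - h x) < top"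
  using nF_add_finite[of g "\<lambda>x. - 1 * h x"] nF_cmult_finite[of h "- 1"] by simp

lemma nM_diff_finite: "integrable lborel g \<Longrightarrow> integrable lborel h \<Longrightarrow> nM g < top \<Longrightarrow> nM h < top \<Longrightarrow> nM (\<lambda>x. g x - h x) < top"
  using nM_add_finite[of g "\<lambda>x. - 1 * h x"] nM_cmult_finite[of h "- 1"] by simp

lemma nF_conv_finite:
  assumes "integrable lborel a" "integrable lborel g" "nF a < top" "nF g < top"
  shows "nF (conv a g) < top"
proof -
  obtain C where C: "C < top" and H: "\<forall>a\<in>borel_measurable borel. \<forall>g\<in>borel_measurable borel. nF (conv a g) \<le> C * nF a * nF g"
    using nF_conv by (elim exE conjE)
  have "nF (conv a g) \<le> C * nF a * nF g" using assms by (intro H[rule_format]) auto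
  also have "\<dots> < top" using C assms by (simp add: ennreal_mult_less_top)
  finally show ?thesis .
qed

lemma nM_conv_finite:
  assumes "integrable lborel a" "integrable lborel g" "nF a < top" "nM g < top"
  shows "nM (conv a g) < top"
proof -
  obtain C where C: "C < top" and H: "\<forall>a g. integrable lborel a \<longrightarrow> integrable lborel g \<longrightarrow> nM g < top \<longrightarrow>
     nM (conv a g) \<le> C * nM g * nF a"
    using nM_conv by (elim exE conjE)
  have "nM (conv a g) \<le> C * nM g * nF a" using assms by (intro H[rule_format])
  also have "\<dots> < top" using C assms by (simp add: ennreal_mult_less_top)
  finally show ?thesis .
qed

lemma is_ideal_FL: "is_ideal (FL q s) (FL q s :: ('a \<Rightarrow> complex) set)"
  unfolding is_ideal_def
proof (intro conjI ballI allI subset_refl)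
  show "(\<lambda>_::'a. 0) \<in> FL q s" using FL_iff[OF rep_zero] by (simp add: nF_zero)
next
  fix f g :: "'a \<Rightarrow> complex" assume "f \<in> FL q s" "g \<in> FL q s"
  then have f: "fourier_rep f (fhat f)" "nF (fhat f) < top" and g: "fourier_rep g (fhat g)" "nF (fhat g) < top"
    using FL_rep by blast+
  show "(\<lambda>x. f x + g x) \<in> FL q s"
    unfolding FL_iff[OF rep_add[OF f(1) g(1)]] using f g rep_int by (intro nF_add_finite)
  show "(\<lambda>x. f x * g x) \<in> FL q s"
    unfolding FL_iff[OF rep_mult[OF f(1) g(1)]]
    using f g rep_int by (intro nF_cmult_finite nF_conv_finite integrable_conv)
next
  fix c and f :: "'a \<Rightarrow> complex" assume "f \<in> FL q s"
  then have f: "fourier_rep f (fhat f)" "nF (fhat f) < top" using FL_rep by blast+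
  show "(\<lambda>x. c * f x) \<in> FL q s"
    unfolding FL_iff[OF rep_scale[OF f(1)]] using f rep_int by (intro nF_cmult_finite)
qed

lemma is_ideal_Mod: "is_ideal (FL q s) (Mod \<phi> p q s)"
  unfolding is_ideal_def
proof (intro conjI ballI allI)
  show "Mod \<phi> p q s \<subseteq> FL q s" by (auto simp: Mod_def)
  show "(\<lambda>_. 0) \<in> Mod \<phi> p q s" using Mod_iff[OF rep_zero] by (simp add: nF_zero nM_zero)
next
  fix f g assume "f \<in> Mod \<phi> p q s" "g \<in> Mod \<phi> p q s"
  then have f: "fourier_rep f (fhat f)" "nF (fhat f) < top" "nM (fhat f) < top"
    and g: "fourier_rep g (fhat g)" "nF (fhat g) < top" "nM (fhat g) < top"
    using Mod_rep by blast+
  show "(\<lambda>x. f x + g x) \<in> Mod \<phi> p q s"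
    unfolding Mod_iff[OF rep_add[OF f(1) g(1)]] using f g rep_int by (intro conjI nF_add_finite nM_add_finite)
next
  fix c f assume "f \<in> Mod \<phi> p q s"
  then have f: "fourier_rep f (fhat f)" "nF (fhat f) < top" "nM (fhat f) < top" using Mod_rep by blast+
  show "(\<lambda>x. c * f x) \<in> Mod \<phi> p q s"
    unfolding Mod_iff[OF rep_scale[OF f(1)]] using f rep_int by (intro conjI nF_cmult_finite nM_cmult_finite)
next
  fix f g :: "'a \<Rightarrow> complex" assume "f \<in> FL q s" "g \<in> Mod \<phi> p q s"
  then have f: "fourier_rep f (fhat f)" "nF (fhat f) < top"
    and g: "fourier_rep g (fhat g)" "nF (fhat g) < top" "nM (fhat g) < top"
    using FL_rep Mod_rep by blast+
  show "(\<lambda>x. f x * g x) \<in> Mod \<phi> p q s"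
    unfolding Mod_iff[OF rep_mult[OF f(1) g(1)]] using f g rep_int
    by (intro conjI nF_cmult_finite nM_cmult_finite nF_conv_finite nM_conv_finite integrable_conv)
qed

text \<open>Membership makes the quantities of the representatives finite, so
  \<open>FL_norm_tendsto\<close> and \<open>Mod_norm_tendsto\<close> translate each condition on
  real norms into one on \<open>nF\<close> or \<open>nM\<close>, where the convolution bounds and
  the limits for \<open>rho\<close> apply.\<close>

lemma segal_FL_Mod: "segal (FL q s) (Mod \<phi> p q s) (FL_norm q s) (Mod_norm \<phi> p q s) (\<lambda>n. ft (rho n))"
proof (rule segal.intro)
  show "is_ideal (FL q s) (FL q s :: ('a \<Rightarrow> complex) set)" by (rule is_ideal_FL)
  show "is_ideal (FL q s) (Mod \<phi> p q s)" by (rule is_ideal_Mod)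
  show "FL_norm q s (\<lambda>_::'a. 0) = 0" using FL_norm_eq[OF rep_zero] by (simp add: nF_zero)
  show "Mod_norm \<phi> p q s (\<lambda>_::'a. 0) = 0" using Mod_norm_eq[OF rep_zero] by (simp add: nM_zero)
next
  fix a b :: "nat \<Rightarrow> 'a \<Rightarrow> complex"
  assume a: "\<And>j. a j \<in> FL q s" and b: "\<And>j. b j \<in> FL q s"
    and la: "(\<lambda>j. FL_norm q s (a j)) \<longlonglongrightarrow> 0" and lb: "(\<lambda>j. FL_norm q s (b j)) \<longlonglongrightarrow> 0"
  define g where "g j = fhat (a j)" for j
  define h where "h j = fhat (b j)" for j
  have g: "fourier_rep (a j) (g j)" "nF (g j) < top" for j using FL_rep[OF a] by (auto simp: g_def)
  have h: "fourier_rep (b j) (h j)" "nF (h j) < top" for j using FL_rep[OF b] by (auto simp: h_def)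
  have "(\<lambda>j. nF (g j) + nF (h j)) \<longlonglongrightarrow> 0 + 0"
    using la lb unfolding FL_norm_tendsto[OF g] FL_norm_tendsto[OF h] by (rule tendsto_add)
  then have "(\<lambda>j. nF (g j) + nF (h j)) \<longlonglongrightarrow> 0" by simp
  then have "(\<lambda>j. nF (\<lambda>x. g j x + h j x)) \<longlonglongrightarrow> 0"
    by (rule tendsto_0_cmult_le[where C="epow 2 q"])
       (use rep_int[OF g(1)] rep_int[OF h(1)] in \<open>auto intro!: nF_add_le\<close>)
  then show "(\<lambda>j. FL_norm q s (\<lambda>x. a j x + b j x)) \<longlonglongrightarrow> 0"
    by (subst FL_norm_tendsto[OF rep_add[OF g(1) h(1)]])
       (intro nF_add_finite g(2) h(2) rep_int[OF g(1)] rep_int[OF h(1)], assumption)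
next
  fix c and a :: "nat \<Rightarrow> 'a \<Rightarrow> complex"
  assume a: "\<And>j. a j \<in> FL q s" and la: "(\<lambda>j. FL_norm q s (a j)) \<longlonglongrightarrow> 0"
  define g where "g j = fhat (a j)" for j
  have g: "fourier_rep (a j) (g j)" "nF (g j) < top" for j using FL_rep[OF a] by (auto simp: g_def)
  have "(\<lambda>j. nF (g j)) \<longlonglongrightarrow> 0" using la unfolding FL_norm_tendsto[OF g] .
  then have "(\<lambda>j. nF (\<lambda>x. c * g j x)) \<longlonglongrightarrow> 0"
    by (rule tendsto_0_cmult_le[where C="epow (ennreal (cmod c)) q"])
       (use rep_int[OF g(1)] in \<open>auto simp: nF_cmult\<close>)
  then show "(\<lambda>j. FL_norm q s (\<lambda>x. c * a j x)) \<longlonglongrightarrow> 0"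
    by (subst FL_norm_tendsto[OF rep_scale[OF g(1)]])
       (intro nF_cmult_finite g(2) rep_int[OF g(1)], assumption)
next
  fix f :: "'a \<Rightarrow> complex" and a :: "nat \<Rightarrow> 'a \<Rightarrow> complex"
  assume "f \<in> FL q s" and a: "\<And>j. a j \<in> FL q s" and la: "(\<lambda>j. FL_norm q s (a j)) \<longlonglongrightarrow> 0"
  then have f: "fourier_rep f (fhat f)" "nF (fhat f) < top" using FL_rep by blast+
  define g where "g j = fhat (a j)" for j
  have g: "fourier_rep (a j) (g j)" "nF (g j) < top" for j using FL_rep[OF a] by (auto simp: g_def)
  obtain C where C: "C < top" and H: "\<forall>a\<in>borel_measurable borel. \<forall>g\<in>borel_measurable borel. nF (conv a g) \<le> C * nF a * nF g"
    using nF_conv by (elim exE conjE)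
  have "(\<lambda>j. nF (g j)) \<longlonglongrightarrow> 0" using la unfolding FL_norm_tendsto[OF g] .
  then have "(\<lambda>j. nF (\<lambda>x. kap * conv (fhat f) (g j) x)) \<longlonglongrightarrow> 0"
  proof (rule tendsto_0_cmult_le)
    show "epow (ennreal (cmod kap)) q * (C * nF (fhat f)) < top" using C f by (simp add: ennreal_mult_less_top)
    fix j
    have [measurable]: "fhat f \<in> borel_measurable borel" "g j \<in> borel_measurable borel"
      using rep_int[OF f(1)] rep_int[OF g(1)] by auto
    have "nF (\<lambda>x. kap * conv (fhat f) (g j) x) = epow (ennreal (cmod kap)) q * nF (conv (fhat f) (g j))"
      by (rule nF_cmult) measurable
    also have "\<dots> \<le> epow (ennreal (cmod kap)) q * (C * nF (fhat f) * nF (g j))"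
      by (intro mult_left_mono H[rule_format]) auto
    finally show "nF (\<lambda>x. kap * conv (fhat f) (g j) x) \<le> epow (ennreal (cmod kap)) q * (C * nF (fhat f)) * nF (g j)"
      by (simp add: mult.assoc)
  qed
  then show "(\<lambda>j. FL_norm q s (\<lambda>x. f x * a j x)) \<longlonglongrightarrow> 0"
    by (subst FL_norm_tendsto[OF rep_mult[OF f(1) g(1)]])
       (intro nF_cmult_finite nF_conv_finite integrable_conv f(2) g(2) rep_int[OF f(1)] rep_int[OF g(1)], assumption)
next
  fix f :: "'a \<Rightarrow> complex" and a :: "nat \<Rightarrow> 'a \<Rightarrow> complex"
  assume "f \<in> Mod \<phi> p q s" and a: "\<And>j. a j \<in> FL q s" and la: "(\<lambda>j. FL_norm q s (a j)) \<longlonglongrightarrow> 0"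
  then have f: "fourier_rep f (fhat f)" "nF (fhat f) < top" "nM (fhat f) < top" using Mod_rep by blast+
  define g where "g j = fhat (a j)" for j
  have g: "fourier_rep (a j) (g j)" "nF (g j) < top" for j using FL_rep[OF a] by (auto simp: g_def)
  obtain C where C: "C < top" and H: "\<forall>a g. integrable lborel a \<longrightarrow> integrable lborel g \<longrightarrow> nM g < top \<longrightarrow>
     nM (conv a g) \<le> C * nM g * nF a"
    using nM_conv by (elim exE conjE)
  have "(\<lambda>j. nF (g j)) \<longlonglongrightarrow> 0" using la unfolding FL_norm_tendsto[OF g] .
  \<comment> \<open>The factor from \<open>FL\<close> comes first, since \<open>nM_conv\<close>
    measures its second argument by \<open>nM\<close>; the order of the pointwise product is
    adjusted afterwards.\<close>
  then have "(\<lambda>j. nM (\<lambda>x. kap * conv (g j) (fhat f) x)) \<longlonglongrightarrow> 0"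
  proof (rule tendsto_0_cmult_le)
    show "epow (ennreal (cmod kap)) q * (C * nM (fhat f)) < top" using C f by (simp add: ennreal_mult_less_top)
    fix j
    have [measurable]: "fhat f \<in> borel_measurable borel" "g j \<in> borel_measurable borel"
      using rep_int[OF f(1)] rep_int[OF g(1)] by auto
    have "nM (\<lambda>x. kap * conv (g j) (fhat f) x) = epow (ennreal (cmod kap)) q * nM (conv (g j) (fhat f))"
      by (rule nM_cmult) measurable
    also have "\<dots> \<le> epow (ennreal (cmod kap)) q * (C * nM (fhat f) * nF (g j))"
      by (intro mult_left_mono H[rule_format] f rep_int[OF f(1)] rep_int[OF g(1)]) auto
    finally show "nM (\<lambda>x. kap * conv (g j) (fhat f) x) \<le> epow (ennreal (cmod kap)) q * (C * nM (fhat f)) * nF (g j)"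
      by (simp add: mult.assoc)
  qed
  moreover have "fourier_rep (\<lambda>x. f x * a j x) (\<lambda>x. kap * conv (g j) (fhat f) x)" for j
    using rep_mult[OF g(1) f(1), of j] by (simp add: mult.commute)
  moreover have "nM (\<lambda>x. kap * conv (g j) (fhat f) x) < top" for j
    by (intro nM_cmult_finite nM_conv_finite integrable_conv f(3) g(2) rep_int[OF f(1)] rep_int[OF g(1)])
  ultimately show "(\<lambda>j. Mod_norm \<phi> p q s (\<lambda>x. f x * a j x)) \<longlonglongrightarrow> 0"
    by (subst Mod_norm_tendsto)
next
  fix n
  show "ft (rho n) \<in> Mod \<phi> p q s"
    unfolding Mod_iff[OF rep_unit]
    by (intro conjI nF_cmult_finite nM_cmult_finite rho_int nF_rho_finite nM_rho_finite)
next
  fix f :: "'a \<Rightarrow> complex" assume "f \<in> FL q s"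
  then have f: "fourier_rep f (fhat f)" "nF (fhat f) < top" using FL_rep by blast+
  show "(\<lambda>n. FL_norm q s (\<lambda>x. ft (rho n) x * f x - f x)) \<longlonglongrightarrow> 0"
    by (subst FL_norm_tendsto[OF rep_diff[OF rep_unit_mult[OF f(1)] f(1)]])
       (intro nF_diff_finite nF_conv_finite integrable_conv rho_int nF_rho_finite f(2) rep_int[OF f(1)]
          nF_conv_rho_tendsto)+
next
  fix f assume "f \<in> Mod \<phi> p q s"
  then have f: "fourier_rep f (fhat f)" "nF (fhat f) < top" "nM (fhat f) < top" using Mod_rep by blast+
  show "(\<lambda>n. Mod_norm \<phi> p q s (\<lambda>x. ft (rho n) x * f x - f x)) \<longlonglongrightarrow> 0"
    by (subst Mod_norm_tendsto[OF rep_diff[OF rep_unit_mult[OF f(1)] f(1)]])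
       (intro nM_diff_finite nM_conv_finite integrable_conv rho_int nF_rho_finite f(3) rep_int[OF f(1)]
          nM_conv_rho_tendsto)+
next
  fix n and a :: "nat \<Rightarrow> 'a \<Rightarrow> complex"
  assume a: "\<And>j. a j \<in> Mod \<phi> p q s" and la: "(\<lambda>j. Mod_norm \<phi> p q s (a j)) \<longlonglongrightarrow> 0"
  define g where "g j = fhat (a j)" for j
  have g: "fourier_rep (a j) (g j)" "nF (g j) < top" "nM (g j) < top" for j
    using Mod_rep[OF a] by (auto simp: g_def)
  \<comment> \<open>The constant depends on n, which is harmless: multiplication by each single unit
    has to be continuous, without uniformity in n.\<close>
  obtain C where C: "C < top" and H: "\<forall>g. integrable lborel g \<longrightarrow> nF (conv (rho n) g) \<le> C * nM g"
    using nF_conv_nM[OF rho_int ft_rho_int, of n] rho_supp by blast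
  have "(\<lambda>j. nM (g j)) \<longlonglongrightarrow> 0" using la unfolding Mod_norm_tendsto[OF g(1,3)] .
  then have "(\<lambda>j. nF (conv (rho n) (g j))) \<longlonglongrightarrow> 0"
    by (rule tendsto_0_cmult_le[OF _ C]) (intro H[rule_format] rep_int[OF g(1)])
  then show "(\<lambda>j. FL_norm q s (\<lambda>x. ft (rho n) x * a j x)) \<longlonglongrightarrow> 0"
    by (subst FL_norm_tendsto[OF rep_unit_mult[OF g(1)]])
       (intro nF_conv_finite rho_int nF_rho_finite g(2) rep_int[OF g(1)], assumption)
qed

end

theorem mainTheorem17:
  fixes \<phi> :: "'a::euclidean_space \<Rightarrow> complex" and p q s :: real
  assumes win: "admissible_window \<phi>"
    and p: "1 \<le> p" "p \<le> 2"
    and qs: "(q = 1 \<and> s \<ge> 0) \<or>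
             (1 < q \<and> (p = 1 \<or> q \<le> p / (p - 1)) \<and> s > real DIM('a) / (q / (q - 1)))"
  defines "IF \<equiv> closed_ideals (FL q s) (FL_norm q s)"
    and "IM \<equiv> closed_ideals (Mod \<phi> p q s) (Mod_norm \<phi> p q s)"
  shows "(\<forall>I\<in>IF. I \<inter> Mod \<phi> p q s \<in> IM)
    \<and> bij_betw (\<lambda>I. I \<inter> Mod \<phi> p q s) IF IM
    \<and> (\<forall>J\<in>IM. nclosure (FL q s) (FL_norm q s) J \<in> IF
         \<and> the_inv_into IF (\<lambda>I. I \<inter> Mod \<phi> p q s) J = nclosure (FL q s) (FL_norm q s) J)
    \<and> (\<forall>J\<in>IM. nclosure (FL q s) (FL_norm q s) J \<inter> Mod \<phi> p q s = J)"
proof -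
  interpret window_setup \<phi> p q s
    using win p qs by unfold_locales auto
  show ?thesis
    unfolding IF_def IM_def by (rule segal.closed_ideals_correspondence[OF segal_FL_Mod])
qed

end
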